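(* Let $\mathscr{H}$ be an infinite dimensional separable complex Hilbert space and let $X$ be a locally compact Hausdorff space. (i) A linear map $\Phi: C_0(X,\mathscr{B}(\mathscr{H}))\to C_0(X,\mathscr{B}(\mathscr{H}))$ is an automorphism if and only if there exist a function $\tau: X\to \operatorname{Aut}(\mathscr{B}(\mathscr{H}))$ and a bijection $\varphi: X\to X$ such that $$\Phi(f)(x)=[\tau(x)](f(\varphi(x)))\qquad (f\in C_0(X,\mathscr{B}(\mathscr{H})),\ x\in X).\quad ( * )$$ (ii) A linear map $\Phi: C_0(X,\mathscr{B}(\mathscr{H}))\to C_0(X,\mathscr{B}(\mathscr{H}))$ is a surjective isometry if and only if there exist a function $\tau: X\to \operatorname{Iso}(\mathscr{B}(\mathscr{H}))$ and a bijection $\varphi: X\to X$ such that $\Phi$ is of the form $( * )$. (iii) Moreover, if the linear map $\Phi: C_0(X,\mathscr{B}(\mathscr{H}))\to C_0(X,\mathscr{B}(\mathscr{H}))$ is an automorphism, respectively a surjective isometry, then for the maps $\tau,\varphi$ appearing in $( * )$ (with $\tau$ taking values in $\operatorname{Aut}(\mathscr{B}(\mathscr{H}))$, respectively in $\operatorname{Iso}(\mathscr{B}(\mathscr{H}))$), the maps $x\mapsto\tau(x)$ and $x\mapsto\tau(x)^{-1}$ are strongly continuous and $\varphi: X\to X$ is a homeomorphism.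
   Context: $\mathscr{B}(\mathscr{H})$ is the algebra of all bounded linear operators on $\mathscr{H}$. $C_0(X,\mathscr{B}(\mathscr{H}))$ is the $C^*$-algebra of all norm-continuous functions $X\to\mathscr{B}(\mathscr{H})$ vanishing at infinity, with pointwise operations and sup norm. For a Banach algebra $\mathcal{A}$, an automorphism is a multiplicative linear bijection $\mathcal{A}\to\mathcal{A}$ (for $C^*$-algebras it is not required to preserve the involution); $\operatorname{Aut}(\mathcal{A})$ is the group of automorphisms of $\mathcal A$ and $\operatorname{Iso}(\mathcal{A})$ is the group of surjective linear isometries of $\mathcal{A}$. A map $\sigma$ from $X$ into the bounded linear maps on $\mathscr{B}(\mathscr{H})$ is strongly continuous if $x\mapsto[\sigma(x)](A)$ is norm continuous for every $A\in\mathscr{B}(\mathscr{H})$. *)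

theory Defs
  imports "HOL-Analysis.Analysis" "HOL-Library.Function_Algebras"
begin

section \<open>Complex Hilbert spaces\<close>

class scaleC =
  fixes scaleC :: "complex \<Rightarrow> 'a \<Rightarrow> 'a"  (infixr \<open>*\<^sub>C\<close> 75)

class complex_vector = real_vector + scaleC +
  assumes scaleC_add_right: "c *\<^sub>C (x + y) = c *\<^sub>C x + c *\<^sub>C y"
    and scaleC_add_left: "(c + d) *\<^sub>C x = c *\<^sub>C x + d *\<^sub>C x"
    and scaleC_scaleC: "c *\<^sub>C (d *\<^sub>C x) = (c * d) *\<^sub>C x"
    and scaleC_one: "1 *\<^sub>C x = x"
    and scaleR_scaleC: "r *\<^sub>R x = complex_of_real r *\<^sub>C x"

lemma vector_space_scaleC: "vector_space (scaleC :: complex \<Rightarrow> 'a \<Rightarrow> 'a::complex_vector)"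
  by unfold_locales
    (simp_all add: scaleC_add_right scaleC_add_left scaleC_scaleC scaleC_one)

lemma module_scaleC: "module (scaleC :: complex \<Rightarrow> 'a \<Rightarrow> 'a::complex_vector)"
  using vector_space_scaleC by (simp add: module_iff_vector_space)

text \<open>The inner product is linear in its first argument. Its positive definiteness follows from
  \<open>cinner_norm\<close> and the norm axioms.\<close>

class complex_inner = complex_vector + real_normed_vector +
  fixes cinner :: "'a \<Rightarrow> 'a \<Rightarrow> complex"
  assumes cinner_commute: "cinner x y = cnj (cinner y x)"
    and cinner_add_left: "cinner (x + y) z = cinner x z + cinner y z"
    and cinner_scaleC_left: "cinner (c *\<^sub>C x) y = c * cinner x y"
    and cinner_norm: "cinner x x = complex_of_real ((norm x)\<^sup>2)"

class complex_hilbert = complex_inner + complete_space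

lemma norm_scaleC: "norm (c *\<^sub>C x) = cmod c * norm (x::'a::complex_inner)"
proof -
  have "complex_of_real ((norm (c *\<^sub>C x))\<^sup>2) = c * cinner x (c *\<^sub>C x)"
    by (simp only: cinner_norm[symmetric] cinner_scaleC_left)
  also have "cinner x (c *\<^sub>C x) = cnj (c * cinner x x)"
    by (subst cinner_commute) (simp only: cinner_scaleC_left)
  also have "c * cnj (c * cinner x x) = (c * cnj c) * complex_of_real ((norm x)\<^sup>2)"
    by (simp add: cinner_norm)
  also have "\<dots> = complex_of_real ((cmod c * norm x)\<^sup>2)"
    by (simp add: complex_norm_square[symmetric] power_mult_distrib)
  finally have "(norm (c *\<^sub>C x))\<^sup>2 = (cmod c * norm x)\<^sup>2"
    by (simp only: of_real_eq_iff)
  then show ?thesis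
    by (rule power2_eq_imp_eq) simp_all
qed

definition infinite_cdim :: "'a::complex_vector itself \<Rightarrow> bool" where
  "infinite_cdim _ \<longleftrightarrow> \<not> (\<exists>B::'a set. finite B \<and> module.span scaleC B = UNIV)"


section \<open>The algebra of bounded linear operators\<close>

text \<open>Elements of \<open>'h \<Rightarrow>\<^sub>L 'h\<close> are bounded and real-linear. The norm \<open>onorm\<close> inherited from that
  type is the usual operator norm.\<close>

typedef (overloaded) 'h bop =
  "{A :: 'h::complex_hilbert \<Rightarrow>\<^sub>L 'h. \<forall>c x. blinfun_apply A (c *\<^sub>C x) = c *\<^sub>C blinfun_apply A x}"
  morphisms blinfun_of_bop bop_of_blinfun
  by (intro exI[of _ id_blinfun]) simp

setup_lifting type_definition_bop

instantiation bop :: (complex_hilbert) real_normed_algebra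
begin

lift_definition zero_bop :: "'a bop" is 0
  by (simp add: module.scale_zero_right[OF module_scaleC])
lift_definition plus_bop :: "'a bop \<Rightarrow> 'a bop \<Rightarrow> 'a bop" is "(+)"
  by (simp add: blinfun.add_left scaleC_add_right)
lift_definition uminus_bop :: "'a bop \<Rightarrow> 'a bop" is "uminus"
  by (simp add: blinfun.minus_left module.scale_minus_right[OF module_scaleC])
lift_definition minus_bop :: "'a bop \<Rightarrow> 'a bop \<Rightarrow> 'a bop" is "(-)"
  by (simp add: blinfun.diff_left module.scale_right_diff_distrib[OF module_scaleC])
lift_definition times_bop :: "'a bop \<Rightarrow> 'a bop \<Rightarrow> 'a bop" is "(o\<^sub>L)"
  by simp
lift_definition scaleR_bop :: "real \<Rightarrow> 'a bop \<Rightarrow> 'a bop" is "(*\<^sub>R)"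
  by (simp add: blinfun.scaleR_left scaleR_scaleC scaleC_scaleC mult.commute)
lift_definition norm_bop :: "'a bop \<Rightarrow> real" is norm .
lift_definition dist_bop :: "'a bop \<Rightarrow> 'a bop \<Rightarrow> real" is dist .
definition sgn_bop :: "'a bop \<Rightarrow> 'a bop" where
  "sgn_bop A = inverse (norm A) *\<^sub>R A"
definition uniformity_bop :: "('a bop \<times> 'a bop) filter" where
  "uniformity_bop = (INF e\<in>{0<..}. principal {(A, B). dist A B < e})"
definition open_bop :: "'a bop set \<Rightarrow> bool" where
  "open_bop S = (\<forall>A\<in>S. \<forall>\<^sub>F (A', B) in uniformity. A' = A \<longrightarrow> B \<in> S)"

instance
proof
  fix A B C :: "'a bop" and r s :: real and S :: "'a bop set"
  show "A + B + C = A + (B + C)" by transfer (simp add: add.assoc)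
  show "A + B = B + A" by transfer (simp add: add.commute)
  show "0 + A = A" by transfer simp
  show "- A + A = 0" by transfer simp
  show "A - B = A + - B" by transfer simp
  show "r *\<^sub>R (A + B) = r *\<^sub>R A + r *\<^sub>R B" by transfer (simp add: scaleR_add_right)
  show "(r + s) *\<^sub>R A = r *\<^sub>R A + s *\<^sub>R A" by transfer (simp add: scaleR_add_left)
  show "r *\<^sub>R s *\<^sub>R A = (r * s) *\<^sub>R A" by transfer simp
  show "1 *\<^sub>R A = A" by transfer simp
  show "A * B * C = A * (B * C)" by transfer (rule blinfun_eqI, simp)
  show "(A + B) * C = A * C + B * C"
    by transfer (rule blinfun_eqI, simp add: blinfun.add_left)
  show "A * (B + C) = A * B + A * C"
    by transfer (rule blinfun_eqI, simp add: blinfun.add_left blinfun.add_right)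
  show "r *\<^sub>R A * B = r *\<^sub>R (A * B)"
    by transfer (rule blinfun_eqI, simp add: blinfun.scaleR_left)
  show "A * r *\<^sub>R B = r *\<^sub>R (A * B)"
    by transfer (rule blinfun_eqI, simp add: blinfun.scaleR_left blinfun.scaleR_right)
  show "dist A B = norm (A - B)" by transfer (simp add: dist_norm)
  show "sgn A = inverse (norm A) *\<^sub>R A" by (rule sgn_bop_def)
  show "uniformity = (INF e\<in>{0<..}. principal {(A, B::'a bop). dist A B < e})"
    by (rule uniformity_bop_def)
  show "open S \<longleftrightarrow> (\<forall>A\<in>S. \<forall>\<^sub>F (A', B) in uniformity. A' = A \<longrightarrow> B \<in> S)"
    by (rule open_bop_def)
  show "norm A = 0 \<longleftrightarrow> A = 0" by transfer simp
  show "norm (A + B) \<le> norm A + norm B" by transfer (rule norm_triangle_ineq)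
  show "norm (r *\<^sub>R A) = \<bar>r\<bar> * norm A" by transfer simp
  show "norm (A * B) \<le> norm A * norm B" by transfer (rule norm_blinfun_compose)
qed

end

lemma bounded_linear_scaleC_blinfun:
  fixes A :: "'a::real_normed_vector \<Rightarrow>\<^sub>L 'b::complex_inner"
  shows "bounded_linear (\<lambda>x. c *\<^sub>C blinfun_apply A x)"
proof (rule bounded_linear_intro)
  show "norm (c *\<^sub>C blinfun_apply A x) \<le> norm x * (norm A * cmod c)" for x
    using mult_left_mono[OF norm_blinfun[of A x], of "cmod c"]
    by (simp add: norm_scaleC mult_ac)
qed (simp_all add: blinfun.add_right blinfun.scaleR_right scaleC_add_right scaleR_scaleC
      scaleC_scaleC mult.commute)

instantiation bop :: (complex_hilbert) complex_vector
begin

lift_definition scaleC_bop :: "complex \<Rightarrow> 'a bop \<Rightarrow> 'a bop" is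
  "\<lambda>c A. Blinfun (\<lambda>x. c *\<^sub>C blinfun_apply A x)"
  by (simp add: bounded_linear_Blinfun_apply bounded_linear_scaleC_blinfun scaleC_scaleC mult.commute)

instance
proof
  have *: "blinfun_apply (Blinfun (\<lambda>x. c *\<^sub>C blinfun_apply A x)) y = c *\<^sub>C blinfun_apply A y"
    for c and A :: "'a \<Rightarrow>\<^sub>L 'a" and y
    by (simp only: bounded_linear_Blinfun_apply bounded_linear_scaleC_blinfun)
  fix A B :: "'a bop" and c d :: complex and r :: real
  show "c *\<^sub>C (A + B) = c *\<^sub>C A + c *\<^sub>C B"
    by transfer (rule blinfun_eqI, simp only: *, simp only: blinfun.add_left *, simp only: scaleC_add_right)
  show "(c + d) *\<^sub>C A = c *\<^sub>C A + d *\<^sub>C A"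
    by transfer (rule blinfun_eqI, simp only: *, simp only: blinfun.add_left *, simp only: scaleC_add_left)
  show "c *\<^sub>C (d *\<^sub>C A) = (c * d) *\<^sub>C A"
    by transfer (rule blinfun_eqI, simp only: *, simp only: scaleC_scaleC *)
  show "1 *\<^sub>C A = A"
    by transfer (rule blinfun_eqI, simp only: *, simp only: scaleC_one)
  show "r *\<^sub>R A = complex_of_real r *\<^sub>C A"
    by transfer (rule blinfun_eqI, simp only: *, simp only: blinfun.scaleR_left scaleR_scaleC)
qed

end


section \<open>Automorphisms and surjective isometries\<close>

text \<open>The algebras are given as carrier sets \<open>A\<close> in a type with the algebra operations; the
  operations on functions are the pointwise ones. Linearity is over the complex numbers.\<close>

instantiation "fun" :: (type, scaleC) scaleC
begin

definition scaleC_fun :: "complex \<Rightarrow> ('a \<Rightarrow> 'b) \<Rightarrow> 'a \<Rightarrow> 'b" where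
  "scaleC_fun c f = (\<lambda>x. c *\<^sub>C f x)"

instance ..

end

definition linear_maps :: "'a::{plus,scaleC} set \<Rightarrow> ('a \<Rightarrow> 'a) set" where
  "linear_maps A = {\<Phi>. \<Phi> \<in> A \<rightarrow> A \<and> (\<forall>a\<in>A. \<forall>b\<in>A. \<Phi> (a + b) = \<Phi> a + \<Phi> b) \<and>
     (\<forall>c. \<forall>a\<in>A. \<Phi> (c *\<^sub>C a) = c *\<^sub>C \<Phi> a)}"

definition Aut :: "'a::{plus,times,scaleC} set \<Rightarrow> ('a \<Rightarrow> 'a) set" where
  "Aut A = {\<Phi> \<in> linear_maps A. bij_betw \<Phi> A A \<and> (\<forall>a\<in>A. \<forall>b\<in>A. \<Phi> (a * b) = \<Phi> a * \<Phi> b)}"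

definition Iso :: "('a \<Rightarrow> real) \<Rightarrow> 'a::{plus,minus,scaleC} set \<Rightarrow> ('a \<Rightarrow> 'a) set" where
  "Iso N A = {\<Phi> \<in> linear_maps A. \<Phi> ` A = A \<and> (\<forall>a\<in>A. \<forall>b\<in>A. N (\<Phi> a - \<Phi> b) = N (a - b))}"


section \<open>Continuous functions vanishing at infinity\<close>

text \<open>A function on \<open>topspace X\<close> is represented by its extension by zero to the whole type, so
  that the pointwise operations, and the supremum over the whole type in \<open>sup_norm\<close>, are the right
  ones (also for empty \<open>X\<close>).\<close>

definition C0 :: "'x topology \<Rightarrow> ('x \<Rightarrow> 'b::real_normed_vector) set" where
  "C0 X = {f. continuous_map X euclidean f \<and>
     (\<forall>e>0. \<exists>K. compactin X K \<and> (\<forall>x\<in>topspace X - K. norm (f x) < e)) \<and>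
     (\<forall>x. x \<notin> topspace X \<longrightarrow> f x = 0)}"

definition sup_norm :: "('x \<Rightarrow> 'b::real_normed_vector) \<Rightarrow> real" where
  "sup_norm f = (SUP x. norm (f x))"

definition strongly_continuous :: "'x topology \<Rightarrow> ('x \<Rightarrow> 'h bop \<Rightarrow> 'h::complex_hilbert bop) \<Rightarrow> bool"
  where "strongly_continuous X \<sigma> \<longleftrightarrow>
    (\<forall>x\<in>topspace X. \<sigma> x \<in> linear_maps UNIV \<and> bounded_linear (\<sigma> x)) \<and>
    (\<forall>A. continuous_map X euclidean (\<lambda>x. \<sigma> x A))"

text \<open>\<open>\<Phi>\<close> has the form \<open>\<Phi> f x = \<tau> x (f (\<phi> x))\<close> with \<open>\<tau> x\<close> in \<open>G\<close> and \<open>\<phi>\<close> a bijection.\<close>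

definition has_form :: "'x topology \<Rightarrow> ('b \<Rightarrow> 'b) set \<Rightarrow>
    (('x \<Rightarrow> 'b) \<Rightarrow> 'x \<Rightarrow> 'b::real_normed_vector) \<Rightarrow> ('x \<Rightarrow> 'b \<Rightarrow> 'b) \<Rightarrow> ('x \<Rightarrow> 'x) \<Rightarrow> bool" where
  "has_form X G \<Phi> \<tau> \<phi> \<longleftrightarrow> \<tau> \<in> topspace X \<rightarrow> G \<and> bij_betw \<phi> (topspace X) (topspace X) \<and>
     (\<forall>f\<in>C0 X. \<forall>x\<in>topspace X. \<Phi> f x = \<tau> x (f (\<phi> x)))"

end

theory Submission
  imports Defs
begin

text \<open>Both parts reduce to one Banach--Stone argument. A bijective linear map \<open>\<Phi>\<close> of the algebra which
  turns multiplication by scalar functions \<open>h\<close> into multiplication by scalar functions yields, at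
  each point \<open>x\<close>, a character of the algebra of scalar functions, hence a point \<open>\<phi> x\<close>. Every \<open>f\<close>
  factors as \<open>h g\<close> with \<open>h\<^sup>2 = \<parallel>f\<parallel>\<close>, so \<open>\<Phi> f x\<close> depends on \<open>f (\<phi> x)\<close> alone. For an automorphism the
  module property holds because \<open>h 1\<close> is central. For a surjective isometry it holds because
  multiplication by \<open>h\<close> can be described by inclusions of balls, and operators
  satisfying such inclusions are multiplications by scalar functions, the centraliser of the algebra
  of all bounded operators being trivial. Conversely, a map of the form \<open>(*)\<close> has a continuous
  proper \<open>\<phi>\<close>; it is surjective because the inverses of the \<open>\<tau> x\<close> are uniformly bounded, which for
  automorphisms follows from the uniform boundedness principle and
  \<open>\<parallel>\<tau>\<inverse>\<parallel> = \<parallel>S\<parallel> \<parallel>S\<inverse>\<parallel> = \<parallel>\<tau>\<parallel>\<close> for \<open>\<tau> A = S A S\<inverse>\<close>.\<close>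

section \<open>Hilbert spaces and bounded operators\<close>

text \<open>An automorphism comes without any continuity, and \<open>C0 X\<close> in general has no
  unit. The characters are therefore handled by algebra alone: the quasi-inverse
  \<open>h / (1 - h)\<close> stands in for an inverse, and a compactness argument extracts just one
  inclusion, that functions vanishing at \<open>\<phi> x\<close> are killed at \<open>x\<close>. In
  the factorisation \<open>f = h g\<close> the scalar factor has the zeros of \<open>f\<close>; this
  carries the inclusion from scalar functions to operator valued ones. An isometry comes without any
  product, so multiplication by scalars has to be recognised from norms. Ball inclusions are metric
  statements and survive conjugation by an isometry; rank one operators turn them into statements on
  matrix coefficients. If the coefficient of \<open>A\<close> at a pair of unit vectors is zero,
  adding the rank one operator of that pair with factor \<open>R\<close> gives norm at most
  \<open>sqrt (R^2 + C)\<close>, whereas a coefficient of modulus \<open>p\<close> in the same phase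
  gives norm at least \<open>p + R\<close>. For large \<open>R\<close> the two are incompatible
  unless \<open>p = 0\<close>, so vanishing coefficients stay zero, and an operator map preserving
  them is a scalar.\<close>

lemma cinner_add_right: "cinner x (y + z) = cinner x y + cinner x (z::'a::complex_inner)"
  by (metis cinner_add_left cinner_commute complex_cnj_add)

lemma cinner_scaleC_right: "cinner x (c *\<^sub>C y) = cnj c * cinner x (y::'a::complex_inner)"
  by (metis cinner_commute cinner_scaleC_left complex_cnj_mult)

lemma scaleC_zero_left [simp]: "0 *\<^sub>C x = (0::'a::complex_vector)"
  by (rule module.scale_zero_left[OF module_scaleC])

lemma scaleC_zero_right [simp]: "c *\<^sub>C 0 = (0::'a::complex_vector)"
  by (rule module.scale_zero_right[OF module_scaleC])

lemma scaleC_minus_left: "(- c) *\<^sub>C x = - (c *\<^sub>C (x::'a::complex_vector))"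
  by (rule module.scale_minus_left[OF module_scaleC])

lemma scaleC_diff_left: "(c - d) *\<^sub>C x = c *\<^sub>C x - d *\<^sub>C (x::'a::complex_vector)"
  by (rule module.scale_left_diff_distrib[OF module_scaleC])

lemma scaleC_diff_right: "c *\<^sub>C (x - y) = c *\<^sub>C x - c *\<^sub>C (y::'a::complex_vector)"
  by (rule module.scale_right_diff_distrib[OF module_scaleC])

lemma scaleC_eq_0_iff [simp]: "c *\<^sub>C x = 0 \<longleftrightarrow> c = 0 \<or> x = (0::'a::complex_vector)"
  by (rule vector_space.scale_eq_0_iff[OF vector_space_scaleC])

lemma cinner_zero_left [simp]: "cinner 0 (y::'a::complex_inner) = 0"
  by (metis cinner_scaleC_left mult_zero_left scaleC_zero_left)

lemma cinner_zero_right [simp]: "cinner (y::'a::complex_inner) 0 = 0"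
  by (metis cinner_commute cinner_zero_left complex_cnj_zero)

lemma cinner_minus_left: "cinner (- x) (y::'a::complex_inner) = - cinner x y"
  by (metis add.right_inverse cinner_add_left cinner_zero_left eq_neg_iff_add_eq_0 add.commute)

lemma cinner_diff_left: "cinner (x - z) (y::'a::complex_inner) = cinner x y - cinner z y"
  by (metis cinner_add_left cinner_minus_left diff_conv_add_uminus)

lemma cinner_minus_right: "cinner (y::'a::complex_inner) (- x) = - cinner y x"
  by (metis cinner_commute cinner_minus_left complex_cnj_minus)

lemma cinner_diff_right: "cinner (y::'a::complex_inner) (x - z) = cinner y x - cinner y z"
  by (metis cinner_add_right cinner_minus_right diff_conv_add_uminus)

lemma cinner_self_eq_0 [simp]: "cinner x x = 0 \<longleftrightarrow> x = (0::'a::complex_inner)"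
  by (simp add: cinner_norm)

lemmas cinner_simps = cinner_add_left cinner_add_right cinner_diff_left cinner_diff_right
  cinner_minus_left cinner_minus_right cinner_scaleC_left cinner_scaleC_right

section \<open>Pythagoras, Cauchy-Schwarz and linear maps preserving lines\<close>

lemma norm_add_squared:
  "(norm (x + y))\<^sup>2 = (norm x)\<^sup>2 + 2 * Re (cinner x y) + (norm (y::'a::complex_inner))\<^sup>2"
proof -
  have "complex_of_real ((norm (x + y))\<^sup>2) = cinner x x + cinner x y + cnj (cinner x y) + cinner y y"
    unfolding cinner_norm[symmetric] by (simp add: cinner_simps cinner_commute[of y x])
  then have "Re (complex_of_real ((norm (x + y))\<^sup>2))
      = Re (cinner x x) + Re (cinner x y) + Re (cnj (cinner x y)) + Re (cinner y y)"
    by simp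
  then show ?thesis
    by (simp add: cinner_norm)
qed

lemma norm_add_squared_orthogonal:
  "cinner x y = 0 \<Longrightarrow> (norm (x + y))\<^sup>2 = (norm x)\<^sup>2 + (norm (y::'a::complex_inner))\<^sup>2"
  by (simp add: norm_add_squared)

text \<open>Pythagoras for the component of \<open>x\<close> along \<open>w\<close> and the rest.
  Cauchy-Schwarz and the operator estimate \<open>norm_add_rank_one_le\<close> rest on it.\<close>

lemma norm_squared_decompose:
  fixes x w :: "'a::complex_inner"
  assumes "norm w = 1"
  shows "(norm x)\<^sup>2 = (cmod (cinner x w))\<^sup>2 + (norm (x - cinner x w *\<^sub>C w))\<^sup>2"
proof -
  have "cinner (cinner x w *\<^sub>C w) (x - cinner x w *\<^sub>C w) = 0"
    using assms by (simp add: cinner_simps cinner_norm[of w] cinner_commute[of w x])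
  from norm_add_squared_orthogonal[OF this] show ?thesis
    using assms by (simp add: norm_scaleC)
qed

lemma cinner_unit_le: "norm w = 1 \<Longrightarrow> cmod (cinner x w) \<le> norm (x::'a::complex_inner)"
  by (rule power2_le_imp_le) (simp_all add: norm_squared_decompose[of w x])

lemma Cauchy_Schwarz_cinner: "cmod (cinner x y) \<le> norm x * norm (y::'a::complex_inner)"
proof (cases "y = 0")
  case False
  define w where "w = complex_of_real (1 / norm y) *\<^sub>C y"
  have "norm w = 1"
    using False by (simp add: w_def norm_scaleC norm_divide)
  from cinner_unit_le[OF this, of x] False show ?thesis
    by (simp add: w_def cinner_scaleC_right norm_mult norm_divide field_simps)
qed simp

lemma ex_unit_vector:
  fixes y :: "'a::complex_inner"
  assumes "y \<noteq> 0"
  shows "\<exists>w. norm w = 1 \<and> y = complex_of_real (norm y) *\<^sub>C w"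
proof (intro exI conjI)
  show "norm (complex_of_real (1 / norm y) *\<^sub>C y) = 1"
    using assms by (simp add: norm_scaleC norm_divide)
  show "y = complex_of_real (norm y) *\<^sub>C complex_of_real (1 / norm y) *\<^sub>C y"
    using assms by (simp add: scaleC_scaleC scaleC_one)
qed

text \<open>Every vector is an eigenvector. For \<open>p\<close> outside the line of
  \<open>p0\<close>, the eigenvalue of \<open>p + p0\<close> must equal that of \<open>p\<close> and
  that of \<open>p0\<close>, because otherwise \<open>p\<close> would be a multiple of
  \<open>p0\<close>.\<close>

lemma line_preserving_imp_scalar:
  fixes L :: "'a::complex_vector \<Rightarrow> 'a"
  assumes add: "\<And>p q. L (p + q) = L p + L q"
    and scale: "\<And>c p. L (c *\<^sub>C p) = c *\<^sub>C L p"
    and line: "\<And>p. \<exists>d. L p = d *\<^sub>C p"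
  shows "\<exists>c. \<forall>p. L p = c *\<^sub>C p"
proof (cases "\<forall>p::'a. p = 0")
  case True
  then have zero: "p = 0" for p :: 'a
    by (rule spec)
  have "L p = 0 *\<^sub>C p" for p
    by (rule trans[OF zero zero[symmetric]])
  then show ?thesis by blast
next
  case False
  then obtain p0 :: 'a where p0: "p0 \<noteq> 0" by blast
  obtain c where c: "L p0 = c *\<^sub>C p0" using line by blast
  have "L p = c *\<^sub>C p" for p
  proof (cases "\<exists>k. p = k *\<^sub>C p0")
    case True
    then show ?thesis by (auto simp: scale c scaleC_scaleC mult.commute)
  next
    case False
    obtain d where d: "L p = d *\<^sub>C p" using line by blast
    obtain d' where d': "L (p + p0) = d' *\<^sub>C (p + p0)" using line by blast
    have *: "(d - d') *\<^sub>C p = (d' - c) *\<^sub>C p0"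
      using add[of p p0] unfolding c d d'
      by (simp add: scaleC_add_right scaleC_diff_left algebra_simps)
    have "d = d'"
    proof (rule ccontr)
      assume "d \<noteq> d'"
      then have "p = ((d' - c) / (d - d')) *\<^sub>C p0"
        using arg_cong[OF *, of "scaleC (1 / (d - d'))"] by (simp add: scaleC_scaleC scaleC_one)
      with False show False by blast
    qed
    with * p0 d show ?thesis by simp
  qed
  then show ?thesis by blast
qed

section \<open>Calculus of operators, rank one operators, the centraliser and completeness\<close>

abbreviation bop_apply :: "'h::complex_hilbert bop \<Rightarrow> 'h \<Rightarrow> 'h"  (infixr \<open>\<cdot>\<close> 78) where
  "A \<cdot> x \<equiv> blinfun_apply (blinfun_of_bop A) x"

lemma bop_eqI: "(\<And>x. A \<cdot> x = B \<cdot> x) \<Longrightarrow> A = B"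
  by (metis blinfun_eqI blinfun_of_bop_inject)

lemma bop_apply_add [simp]: "(A + B) \<cdot> x = A \<cdot> x + B \<cdot> x"
  by transfer (simp add: blinfun.add_left)

lemma bop_apply_diff [simp]: "(A - B) \<cdot> x = A \<cdot> x - B \<cdot> x"
  by transfer (simp add: blinfun.diff_left)

lemma bop_apply_zero [simp]: "(0::'h::complex_hilbert bop) \<cdot> x = 0"
  by transfer simp

lemma bop_apply_times [simp]: "(A * B) \<cdot> x = A \<cdot> B \<cdot> x"
  by transfer simp

lemma bop_apply_scaleC [simp]: "(c *\<^sub>C A) \<cdot> x = c *\<^sub>C A \<cdot> x"
  by (simp add: scaleC_bop.rep_eq bounded_linear_Blinfun_apply bounded_linear_scaleC_blinfun)

lemma bop_apply_scaleC_right [simp]: "A \<cdot> (c *\<^sub>C x) = c *\<^sub>C A \<cdot> x"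
  using blinfun_of_bop[of A] by simp

lemmas bop_apply_right [simp] = blinfun.add_right[of "blinfun_of_bop A" for A]
  blinfun.diff_right[of "blinfun_of_bop A" for A]

lemma norm_bop_apply: "norm (A \<cdot> x) \<le> norm A * norm x"
  by transfer (rule norm_blinfun)

lemma norm_bop_le: "0 \<le> C \<Longrightarrow> (\<And>x. norm (A \<cdot> x) \<le> C * norm x) \<Longrightarrow> norm A \<le> C"
  by (simp add: norm_bop.rep_eq norm_blinfun_bound)

lemma cmod_cinner_bop_le: "norm v = 1 \<Longrightarrow> norm w = 1 \<Longrightarrow> cmod (cinner (A \<cdot> w) v) \<le> norm A"
  using cinner_unit_le[of v "A \<cdot> w"] norm_bop_apply[of A w] by simp

lemma norm_scaleC_bop [simp]: "norm (c *\<^sub>C A) = cmod c * norm (A::'h::complex_hilbert bop)"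
proof -
  have le: "norm (d *\<^sub>C B) \<le> cmod d * norm B" for d and B :: "'h bop"
    using mult_left_mono[OF norm_bop_apply, of "cmod d" B]
    by (intro norm_bop_le) (simp_all add: norm_scaleC mult.assoc)
  show ?thesis
  proof (cases "c = 0")
    case False
    have "norm A \<le> inverse (cmod c) * norm (c *\<^sub>C A)"
      using le[of "inverse c" "c *\<^sub>C A"] False
      by (simp add: scaleC_scaleC scaleC_one norm_inverse)
    with le[of c A] False show ?thesis
      by (intro antisym) (simp_all add: field_simps)
  qed simp
qed

lemma scaleC_bop_mult_left: "(c *\<^sub>C A) * B = c *\<^sub>C (A * (B::'h::complex_hilbert bop))"
  by (rule bop_eqI) simp

lemma scaleC_bop_mult_right: "A * (c *\<^sub>C B) = c *\<^sub>C (A * (B::'h::complex_hilbert bop))"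
  by (rule bop_eqI) simp

lift_definition id_bop :: "'h::complex_hilbert bop" is id_blinfun
  by simp

lemma id_bop_apply [simp]: "id_bop \<cdot> x = x"
  by transfer simp

lemma id_bop_mult [simp]: "id_bop * A = A" "A * id_bop = A"
  by (auto intro: bop_eqI)

lemma bounded_linear_rank_one: "bounded_linear (\<lambda>w. cinner w z *\<^sub>C (y::'h::complex_inner))"
proof (rule bounded_linear_intro)
  show "norm (cinner w z *\<^sub>C y) \<le> norm w * (norm z * norm y)" for w
    using mult_right_mono[OF Cauchy_Schwarz_cinner[of w z], of "norm y"]
    by (simp add: norm_scaleC mult.assoc)
qed (simp_all add: cinner_simps scaleC_add_left scaleR_scaleC scaleC_scaleC)

lift_definition rank_one :: "'h::complex_hilbert \<Rightarrow> 'h \<Rightarrow> 'h bop" is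
  "\<lambda>y z. Blinfun (\<lambda>w. cinner w z *\<^sub>C y)"
  by (simp add: bounded_linear_Blinfun_apply bounded_linear_rank_one cinner_simps scaleC_scaleC)

lemma rank_one_apply [simp]: "rank_one y z \<cdot> w = cinner w z *\<^sub>C y"
  by (simp add: rank_one.rep_eq bounded_linear_Blinfun_apply bounded_linear_rank_one)

lemma norm_rank_one_le: "norm (rank_one y z) \<le> norm y * norm (z::'h::complex_hilbert)"
proof (rule norm_bop_le)
  fix x :: 'h
  show "norm (rank_one y z \<cdot> x) \<le> norm y * norm z * norm x"
    using mult_right_mono[OF Cauchy_Schwarz_cinner[of x z], of "norm y"]
    by (simp add: norm_scaleC mult_ac)
qed simp

text \<open>Rank one operators suffice as test elements: commuting with \<open>rank_one y w\<close>
  and evaluating at the unit vector \<open>w\<close> gives \<open>A \<cdot> y\<close> as a multiple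
  of \<open>y\<close> whose factor depends on \<open>w\<close> only.\<close>

lemma commutes_with_all_imp_scalar:
  fixes A :: "'h::complex_hilbert bop"
  assumes "\<And>B. A * B = B * A"
  shows "\<exists>c. A = c *\<^sub>C id_bop"
proof (cases "\<forall>z::'h. z = 0")
  case True
  then have zero: "z = 0" for z :: 'h
    by (rule spec)
  show ?thesis
    by (intro exI[of _ 0] bop_eqI) (rule trans[OF zero zero[symmetric]])
next
  case False
  then obtain z :: 'h where "z \<noteq> 0" by blast
  then obtain w :: 'h where w: "norm w = 1" using ex_unit_vector by blast
  have "A \<cdot> y = cinner (A \<cdot> w) w *\<^sub>C y" for y
    using arg_cong[OF assms[of "rank_one y w"], of "\<lambda>B. B \<cdot> w"] w
    by (simp add: cinner_norm scaleC_one)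
  then have "A \<cdot> y = (cinner (A \<cdot> w) w *\<^sub>C id_bop) \<cdot> y" for y
    unfolding bop_apply_scaleC id_bop_apply by this
  then show ?thesis
    by (intro exI[of _ "cinner (A \<cdot> w) w"] bop_eqI)
qed

lemma norm_id_bop:
  assumes "(z::'h::complex_hilbert) \<noteq> 0"
  shows "norm (id_bop :: 'h bop) = 1"
proof (rule antisym)
  show "norm (id_bop :: 'h bop) \<le> 1"
    by (rule norm_bop_le) simp_all
  have "1 * norm z \<le> norm (id_bop :: 'h bop) * norm z"
    using norm_bop_apply[of id_bop z] by simp
  then show "1 \<le> norm (id_bop :: 'h bop)"
    by (rule mult_right_le_imp_le) (use assms in simp)
qed

instance complex_hilbert \<subseteq> banach ..

text \<open>The ambient space of bounded real-linear maps is complete, and a norm limit of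
  complex-linear maps is complex-linear, so the limit lies in \<open>bop\<close> again.\<close>

instance bop :: (complex_hilbert) banach
proof
  fix A :: "nat \<Rightarrow> 'a bop"
  assume "Cauchy A"
  then have "Cauchy (\<lambda>n. blinfun_of_bop (A n))"
    by (simp add: Cauchy_def dist_bop.rep_eq)
  then obtain T where T: "(\<lambda>n. blinfun_of_bop (A n)) \<longlonglongrightarrow> T"
    by (blast dest: Cauchy_convergent convergentD)
  have lim: "(\<lambda>n. A n \<cdot> x) \<longlonglongrightarrow> blinfun_apply T x" for x
    using T by (intro tendsto_intros)
  have scale: "blinfun_apply T (c *\<^sub>C x) = c *\<^sub>C blinfun_apply T x" for c x
  proof (rule LIMSEQ_unique[OF lim])
    have "bounded_linear (\<lambda>y::'a. c *\<^sub>C y)"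
      using bounded_linear_scaleC_blinfun[of c "id_blinfun :: 'a \<Rightarrow>\<^sub>L 'a"] by simp
    from bounded_linear.tendsto[OF this lim]
    show "(\<lambda>n. A n \<cdot> (c *\<^sub>C x)) \<longlonglongrightarrow> c *\<^sub>C blinfun_apply T x"
      by (simp only: bop_apply_scaleC_right)
  qed
  define B where "B = bop_of_blinfun T"
  have B: "blinfun_of_bop B = T"
    unfolding B_def by (rule bop_of_blinfun_inverse) (use scale in simp)
  have "A \<longlonglongrightarrow> B"
    unfolding tendsto_dist_iff[of A B] dist_bop.rep_eq
    by (rule tendsto_dist_iff[THEN iffD1, OF T[folded B]])
  then show "convergent A" by (rule convergentI)
qed

section \<open>The uniform boundedness principle\<close>

text \<open>Class \<open>complex_vector\<close> extends \<open>real_vector\<close>, so functions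
  need a real scaling before they become a complex vector space. This lets \<open>C0 X\<close> serve
  as the carrier \<open>V\<close> in \<open>uniform_boundedness\<close>.\<close>

instantiation "fun" :: (type, scaleR) scaleR
begin

definition scaleR_fun :: "real \<Rightarrow> ('a \<Rightarrow> 'b) \<Rightarrow> 'a \<Rightarrow> 'b" where
  "scaleR_fun r f = (\<lambda>x. r *\<^sub>R f x)"

instance ..

end

instance "fun" :: (type, complex_vector) complex_vector
  by standard (auto simp: scaleR_fun_def scaleC_fun_def fun_eq_iff scaleC_add_right scaleC_add_left
      scaleC_scaleC scaleC_one scaleR_add_right scaleR_add_left scaleR_scaleC)

lemma scaleC_fun_apply [simp]: "(c *\<^sub>C f) x = c *\<^sub>C f x"
  by (simp add: scaleC_fun_def)

text \<open>Sokal's proof of the uniform boundedness principle: at every point \<open>v\<close> and for every increment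
  \<open>\<xi>\<close> one of \<open>q (v + \<xi>)\<close>, \<open>q (v - \<xi>)\<close> is at least \<open>q \<xi>\<close>, so that no category argument is needed.\<close>

lemma uniform_boundedness:
  fixes V :: "'v::complex_vector set" and N :: "'v \<Rightarrow> real" and q :: "'i \<Rightarrow> 'v \<Rightarrow> real"
  assumes zero: "0 \<in> V"
    and add: "\<And>u v. u \<in> V \<Longrightarrow> v \<in> V \<Longrightarrow> u + v \<in> V"
    and scale: "\<And>c v. v \<in> V \<Longrightarrow> c *\<^sub>C v \<in> V"
    and N_add: "\<And>u v. u \<in> V \<Longrightarrow> v \<in> V \<Longrightarrow> N (u + v) \<le> N u + N v"
    and N_scale: "\<And>c v. v \<in> V \<Longrightarrow> N (c *\<^sub>C v) = cmod c * N v"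
    and complete: "\<And>s b. range s \<subseteq> V \<Longrightarrow> (\<And>m n. n \<le> m \<Longrightarrow> N (s m - s n) \<le> b n) \<Longrightarrow>
      b \<longlonglongrightarrow> 0 \<Longrightarrow> \<exists>v\<in>V. \<forall>n. N (v - s n) \<le> b n"
    and q_add: "\<And>i u v. u \<in> V \<Longrightarrow> v \<in> V \<Longrightarrow> q i (u + v) \<le> q i u + q i v"
    and q_scale: "\<And>i c v. v \<in> V \<Longrightarrow> q i (c *\<^sub>C v) = cmod c * q i v"
    and bounded: "\<And>i. \<exists>B. \<forall>v\<in>V. q i v \<le> B * N v"
    and pointwise: "\<And>v. v \<in> V \<Longrightarrow> \<exists>C. \<forall>i. q i v \<le> C"
  shows "\<exists>C\<ge>0. \<forall>i. \<forall>v\<in>V. q i v \<le> C * N v"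
proof (rule ccontr)
  assume unbounded: "\<not> (\<exists>C\<ge>0. \<forall>i. \<forall>v\<in>V. q i v \<le> C * N v)"
  have minus: "- v \<in> V" "N (- v) = N v" "q i (- v) = q i v" if "v \<in> V" for v i
    using scale[OF that, of "-1"] N_scale[OF that, of "-1"] q_scale[OF that, of i "-1"]
    by (simp_all add: scaleC_minus_left scaleC_one)
  have diff: "u - v \<in> V" if "u \<in> V" "v \<in> V" for u v
    using add[OF that(1) minus(1)[OF that(2)]] by simp
  have N_zero: "N 0 = 0"
    using N_scale[OF zero, of 0] by simp
  have N_nonneg: "0 \<le> N v" if "v \<in> V" for v
    using N_add[OF that minus(1)[OF that]] minus(2)[OF that] N_zero by simp
  \<comment> \<open>\<open>L i\<close> is the operator norm of \<open>q i\<close>, the least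
    constant in its bound. As \<open>N\<close> is only a seminorm, vectors with
    \<open>N v = 0\<close> are treated separately.\<close>
  define S where "S i = {B. 0 \<le> B \<and> (\<forall>v\<in>V. q i v \<le> B * N v)}" for i
  define L where "L i = Inf (S i)" for i
  have S_ne: "S i \<noteq> {}" for i
  proof -
    obtain B where "\<forall>v\<in>V. q i v \<le> B * N v" using bounded by blast
    then have "\<bar>B\<bar> \<in> S i"
      unfolding S_def by (auto intro: order_trans[OF _ mult_right_mono] N_nonneg)
    then show ?thesis by blast
  qed
  have S_bdd: "bdd_below (S i)" for i
    by (auto simp: S_def intro: bdd_belowI)
  have L_nonneg: "0 \<le> L i" for i
    unfolding L_def by (rule cInf_greatest[OF S_ne]) (auto simp: S_def)
  have L_bound: "q i v \<le> L i * N v" if v: "v \<in> V" for i v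
  proof (cases "N v = 0")
    case True
    then show ?thesis
      using S_ne[of i] v by (auto simp: S_def)
  next
    case False
    then have pos: "0 < N v" using N_nonneg[OF v] by simp
    have "q i v / N v \<le> L i"
      unfolding L_def
      by (rule cInf_greatest[OF S_ne]) (use v pos in \<open>auto simp: S_def field_simps\<close>)
    with pos show ?thesis by (simp add: field_simps)
  qed
  have L_least: "\<exists>v\<in>V. c * N v < q i v" if "0 \<le> c" "c < L i" for c i
  proof (rule ccontr)
    assume "\<not> ?thesis"
    then have "c \<in> S i" using that by (auto simp: S_def not_less)
    then have "L i \<le> c" unfolding L_def by (rule cInf_lower[OF _ S_bdd])
    with that show False by simp
  qed
  \<comment> \<open>The growth \<open>4 ^ n\<close> is matched with increments of size
    \<open>(1/3) ^ Suc n\<close>: their product still grows like \<open>(4/3) ^ n\<close>.\<close>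
  have "\<exists>i. (4::real) ^ n < L i" for n
  proof (rule ccontr)
    assume "\<not> ?thesis"
    then have "L i \<le> 4 ^ n" for i by (simp add: not_less)
    then have "q i v \<le> 4 ^ n * N v" if "v \<in> V" for i v
      using L_bound[OF that, of i] mult_right_mono[OF _ N_nonneg[OF that], of "L i"] order_trans by blast
    with unbounded show False
      by (meson zero_le_numeral zero_le_power)
  qed
  then obtain i where i: "(4::real) ^ n < L (i n)" for n by metis
  \<comment> \<open>A vector almost attaining \<open>L j\<close>, rescaled to length
    \<open>r\<close>, is the increment. The factor 3/4 is the loss from attaining the norm only
    approximately; it must exceed the 1/2 of the tail estimate below.\<close>
  have step: "\<exists>v'\<in>V. N (v' - v) \<le> r \<and> 3/4 * L j * r \<le> q j v'"
    if v: "v \<in> V" and r: "0 < r" and j: "0 < L j" for v r j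
  proof -
    obtain w where w: "w \<in> V" "3/4 * L j * N w < q j w"
      using L_least[of "3/4 * L j" j] j by auto
    have "N w \<noteq> 0" using L_bound[OF w(1), of j] w(2) by auto
    then have Nw: "0 < N w" using N_nonneg[OF w(1)] by simp
    define \<xi> where "\<xi> = complex_of_real (r / N w) *\<^sub>C w"
    have \<xi>: "\<xi> \<in> V" "N \<xi> = r" "3/4 * L j * r \<le> q j \<xi>"
      using Nw r w mult_right_mono[of "3/4 * L j * N w" "q j w" "r / N w"]
      by (simp_all add: \<xi>_def scale N_scale q_scale norm_divide field_simps)
    have "2 * q j \<xi> = q j (2 *\<^sub>C \<xi>)"
      using q_scale[OF \<xi>(1)] by simp
    also have "2 *\<^sub>C \<xi> = (v + \<xi>) + - (v - \<xi>)"
      using scaleC_add_left[of 1 1 \<xi>] by (simp add: scaleC_one)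
    also have "q j \<dots> \<le> q j (v + \<xi>) + q j (- (v - \<xi>))"
      using diff[OF v \<xi>(1)] by (intro q_add add v \<xi>(1) minus(1))
    also have "q j (- (v - \<xi>)) = q j (v - \<xi>)"
      by (intro minus(3) diff v \<xi>(1))
    finally have "q j \<xi> \<le> q j (v + \<xi>) \<or> q j \<xi> \<le> q j (v - \<xi>)" by linarith
    then show ?thesis
    proof
      assume "q j \<xi> \<le> q j (v + \<xi>)"
      then show ?thesis
        using \<xi> v add by (intro bexI[of _ "v + \<xi>"]) auto
    next
      assume "q j \<xi> \<le> q j (v - \<xi>)"
      then show ?thesis
        using \<xi> v diff minus[OF \<xi>(1)] by (intro bexI[of _ "v - \<xi>"]) auto
    qed
  qed
  have "0 < L (i n)" for n
    using i[of n] zero_less_power[of "4::real" n] by linarith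
  then have "\<forall>n v. \<exists>v'. v \<in> V \<longrightarrow> v' \<in> V \<and> N (v' - v) \<le> (1/3) ^ Suc n \<and>
      3/4 * L (i n) * (1/3) ^ Suc n \<le> q (i n) v'"
    using step[of _ "(1/3) ^ Suc n" for n] by fastforce
  then obtain F where F: "\<And>n v. v \<in> V \<Longrightarrow> F n v \<in> V \<and> N (F n v - v) \<le> (1/3) ^ Suc n \<and>
      3/4 * L (i n) * (1/3) ^ Suc n \<le> q (i n) (F n v)"
    by metis
  define s where "s = rec_nat 0 F"
  have s_Suc: "s (Suc n) = F n (s n)" for n by (simp add: s_def)
  have s: "s n \<in> V" for n
    by (induction n) (simp_all add: s_Suc F, simp add: s_def zero)
  \<comment> \<open>The partial geometric sum of \<open>(1/3) ^ Suc n\<close>,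
    \<open>(1/3) ^ Suc (Suc n)\<close>, ..., whose total is \<open>1/2 * (1/3) ^ n\<close>.\<close>
  have tail: "N (s (n + k) - s n) \<le> 1/2 * (1/3) ^ n * (1 - (1/3) ^ k)" for n k
  proof (induction k)
    case (Suc k)
    have "N (s (n + Suc k) - s n) \<le> N (s (Suc (n + k)) - s (n + k)) + N (s (n + k) - s n)"
      using N_add[OF diff[OF s s] diff[OF s s], of "Suc (n + k)" "n + k" "n + k" n] by simp
    also have "N (s (Suc (n + k)) - s (n + k)) \<le> (1/3) ^ Suc (n + k)"
      using F[OF s, of "n + k"] by (simp add: s_Suc)
    also note Suc.IH
    finally show ?case by (simp add: power_add field_simps)
  qed (simp add: N_zero)
  have "\<exists>v\<in>V. \<forall>n. N (v - s n) \<le> 1/2 * (1/3) ^ n"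
  proof (rule complete)
    fix m n :: nat
    assume "n \<le> m"
    then obtain k where "m = n + k" using le_Suc_ex by blast
    have "1/2 * (1/3) ^ n * (1 - (1/3) ^ k) \<le> 1/2 * (1/3::real) ^ n * 1"
      by (intro mult_left_mono) simp_all
    with tail[of n k] show "N (s m - s n) \<le> 1/2 * (1/3) ^ n"
      unfolding \<open>m = n + k\<close> mult_1_right by (rule order_trans)
  next
    show "(\<lambda>n. 1/2 * (1/3::real) ^ n) \<longlonglongrightarrow> 0"
      by (intro tendsto_mult_right_zero LIMSEQ_power_zero) simp
  qed (use s in auto)
  then obtain v where v: "v \<in> V" "\<And>n. N (v - s n) \<le> 1/2 * (1/3) ^ n" by blast
  obtain C where C: "\<And>j. q j v \<le> C" using pointwise[OF v(1)] by blast
  \<comment> \<open>The gain 3/4 minus the later loss 1/2 leaves 1/4, and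
    \<open>(1/3) ^ Suc n\<close> contributes another 1/3: hence
    \<open>L (i n) * (1/3) ^ n \<le> 12 * C\<close>.\<close>
  obtain n where n: "12 * C < (4/3) ^ n"
    using real_arch_pow[of "4/3" "12 * C"] by auto
  have "3/4 * L (i n) * (1/3) ^ Suc n \<le> q (i n) (v + - (v - s (Suc n)))"
    using F[OF s, of n] by (simp add: s_Suc)
  also have "\<dots> \<le> q (i n) v + q (i n) (- (v - s (Suc n)))"
    by (intro q_add minus(1) diff v(1) s)
  also have "q (i n) (- (v - s (Suc n))) = q (i n) (v - s (Suc n))"
    by (intro minus(3) diff v(1) s)
  also have "q (i n) (v - s (Suc n)) \<le> L (i n) * N (v - s (Suc n))"
    by (intro L_bound diff v(1) s)
  also have "\<dots> \<le> L (i n) * (1/2 * (1/3) ^ Suc n)"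
    using v(2)[of "Suc n"] by (intro mult_left_mono L_nonneg) simp
  also note C[of "i n"]
  finally have "L (i n) * (1/3) ^ n \<le> 12 * C" by simp
  moreover have "(4/3) ^ n \<le> L (i n) * (1/3) ^ n"
    using mult_right_mono[OF less_imp_le[OF i[of n]], of "(1/3) ^ n"]
    by (simp add: power_mult_distrib[symmetric])
  ultimately show False using n by linarith
qed

text \<open>Completeness in the form required by \<open>uniform_boundedness\<close>: the limit
  inherits the rate \<open>b\<close>.\<close>

lemma Cauchy_bound_limit:
  fixes s :: "nat \<Rightarrow> 'b::banach"
  assumes le: "\<And>m n. n \<le> m \<Longrightarrow> norm (s m - s n) \<le> b n" and b: "b \<longlonglongrightarrow> 0"
  shows "\<exists>v. \<forall>n. norm (v - s n) \<le> b n"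
proof -
  have "Cauchy s"
  proof (rule CauchyI')
    fix e :: real
    assume "e > 0"
    then obtain M where M: "\<And>n. n \<ge> M \<Longrightarrow> b n < e"
      using order_tendstoD(2)[OF b] by (auto simp: eventually_sequentially)
    have "norm (s m - s n) < e" if "m \<ge> M" "m < n" for m n
      using le[of m n] M[of m] that by (simp add: norm_minus_commute)
    then show "\<exists>M. \<forall>m\<ge>M. \<forall>n>m. dist (s m) (s n) < e" by (auto simp: dist_norm)
  qed
  then obtain v where v: "s \<longlonglongrightarrow> v" by (blast dest: Cauchy_convergent convergentD)
  have "norm (v - s n) \<le> b n" for n
  proof (rule LIMSEQ_le_const2)
    show "(\<lambda>m. norm (s m - s n)) \<longlonglongrightarrow> norm (v - s n)"
      using v by (intro tendsto_intros)
  qed (use le in blast)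
  then show ?thesis by blast
qed

text \<open>Weakly bounded families are norm bounded: the principle is applied to the seminorms
  \<open>cmod (cinner (y i) z)\<close> in \<open>z\<close>, and the resulting bound is evaluated at
  \<open>z = y i\<close>.\<close>

lemma uniform_boundedness_cinner:
  fixes y :: "'i \<Rightarrow> 'h::complex_hilbert"
  assumes "\<And>z. \<exists>C. \<forall>i. cmod (cinner (y i) z) \<le> C"
  shows "\<exists>C. \<forall>i. norm (y i) \<le> C"
proof -
  have "\<exists>C\<ge>0. \<forall>i. \<forall>z\<in>UNIV. cmod (cinner (y i) z) \<le> C * norm z"
  proof (rule uniform_boundedness)
    show "\<exists>B. \<forall>z\<in>UNIV. cmod (cinner (y i) z) \<le> B * norm z" for i
      using Cauchy_Schwarz_cinner by blast
  next
    fix s :: "nat \<Rightarrow> 'h" and b :: "nat \<Rightarrow> real"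
    assume le: "\<And>m n. n \<le> m \<Longrightarrow> norm (s m - s n) \<le> b n" and b: "b \<longlonglongrightarrow> 0"
    have "\<exists>v. \<forall>n. norm (v - s n) \<le> b n"
      using le b by (rule Cauchy_bound_limit)
    then show "\<exists>v\<in>UNIV. \<forall>n. norm (v - s n) \<le> b n" by blast
  qed (use assms in \<open>auto simp: cinner_simps norm_scaleC norm_mult intro: norm_triangle_ineq\<close>)
  then obtain C where C: "C \<ge> 0" "\<And>i z. cmod (cinner (y i) z) \<le> C * norm z" by blast
  have "norm (y i) \<le> C" for i
  proof (cases "y i = 0")
    case False
    have "norm (y i) * norm (y i) \<le> C * norm (y i)"
      using C(2)[of i "y i"] by (simp add: cinner_norm norm_power power2_eq_square norm_mult)
    with False show ?thesis by simp
  qed (use C in simp)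
  then show ?thesis by blast
qed

section \<open>Automorphisms of the operator algebra\<close>

lemma linear_maps_UNIV_D:
  assumes "\<tau> \<in> linear_maps (UNIV :: 'b::complex_vector set)"
  shows "\<tau> (A + B) = \<tau> A + \<tau> B" "\<tau> (c *\<^sub>C A) = c *\<^sub>C \<tau> A" "\<tau> 0 = 0" "\<tau> (- A) = - \<tau> A"
    "\<tau> (A - B) = \<tau> A - \<tau> B"
proof -
  show add: "\<tau> (A + B) = \<tau> A + \<tau> B" and scale: "\<tau> (c *\<^sub>C A) = c *\<^sub>C \<tau> A" for A B c
    using assms by (auto simp: linear_maps_def)
  show "\<tau> 0 = 0"
    using scale[of 0 0] by simp
  show minus: "\<tau> (- A) = - \<tau> A" for A
    using scale[of "-1" A] by (simp add: scaleC_minus_left scaleC_one)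
  show "\<tau> (A - B) = \<tau> A - \<tau> B"
    using add[of A "- B"] by (simp add: minus)
qed

lemma linear_maps_inv:
  assumes "\<tau> \<in> linear_maps (UNIV :: 'b::complex_vector set)" "bij \<tau>"
  shows "inv \<tau> \<in> linear_maps UNIV"
proof -
  have "inv \<tau> (A + B) = inv \<tau> A + inv \<tau> B" for A B
    by (rule inv_f_eq) (use assms in \<open>simp_all add: linear_maps_UNIV_D bij_is_inj bij_is_surj surj_f_inv_f\<close>)
  moreover have "inv \<tau> (c *\<^sub>C A) = c *\<^sub>C inv \<tau> A" for A c
    by (rule inv_f_eq) (use assms in \<open>simp_all add: linear_maps_UNIV_D bij_is_inj bij_is_surj surj_f_inv_f\<close>)
  ultimately show ?thesis
    by (simp add: linear_maps_def)
qed

text \<open>With \<open>u\<close> a fixed vector of the range of the idempotent \<open>\<tau> (e \<otimes> e)\<close>, the map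
  \<open>S y = \<tau> (y \<otimes> e) u\<close> implements \<open>\<tau>\<close>.\<close>

lemma Aut_bop_spatial:
  fixes \<tau> :: "'h::complex_hilbert bop \<Rightarrow> 'h bop"
  assumes \<tau>: "\<tau> \<in> Aut UNIV"
  obtains S :: "'h \<Rightarrow> 'h" where "bij S" "\<And>x y. S (x + y) = S x + S y"
    "\<And>c x. S (c *\<^sub>C x) = c *\<^sub>C S x" "\<And>A x. \<tau> A \<cdot> S x = S (A \<cdot> x)"
proof (cases "\<exists>z::'h. z \<noteq> 0")
  case False
  then have zero: "x = y" for x y :: 'h by metis
  show ?thesis
    by (rule that[of id]) (auto intro: zero)
next
  case True
  then obtain e :: 'h where e: "norm e = 1" using ex_unit_vector by blast
  have lin: "\<tau> \<in> linear_maps UNIV" and bij: "bij \<tau>" and mult: "\<tau> (A * B) = \<tau> A * \<tau> B" for A B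
    using \<tau> by (auto simp: Aut_def)
  have PP: "rank_one e e * rank_one e e = rank_one e e"
    by (rule bop_eqI) (use e in \<open>simp add: cinner_norm scaleC_scaleC scaleC_one\<close>)
  have "rank_one e e \<cdot> e \<noteq> 0 \<cdot> e"
    using e by (auto simp: cinner_norm)
  then have "rank_one e e \<noteq> 0" by metis
  then have "\<tau> (rank_one e e) \<noteq> 0"
    using bij linear_maps_UNIV_D(3)[OF lin] by (metis bij_is_inj injD)
  then obtain v where v: "\<tau> (rank_one e e) \<cdot> v \<noteq> 0"
    by (metis bop_apply_zero bop_eqI)
  define u where "u = \<tau> (rank_one e e) \<cdot> v"
  have u: "\<tau> (rank_one e e) \<cdot> u = u" "u \<noteq> 0"
    using v by (simp_all add: u_def flip: bop_apply_times mult) (simp add: PP)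
  define S where "S y = \<tau> (rank_one y e) \<cdot> u" for y
  \<comment> \<open>Left multiplication by \<open>A\<close> moves only the first vector of a rank
    one operator. Together with multiplicativity of \<open>\<tau>\<close> this yields the
    intertwining relation for \<open>S\<close>.\<close>
  have rank: "rank_one (x + y) e = rank_one x e + rank_one y e"
    "rank_one (c *\<^sub>C x) e = c *\<^sub>C rank_one x e" "rank_one (A \<cdot> x) e = A * rank_one x e"
    for x y c and A :: "'h bop"
    by (auto intro!: bop_eqI simp: scaleC_add_right scaleC_scaleC mult.commute)
  have S: "S (x + y) = S x + S y" "S (c *\<^sub>C x) = c *\<^sub>C S x" "S (A \<cdot> x) = \<tau> A \<cdot> S x" for x y c A
    by (simp_all add: S_def rank linear_maps_UNIV_D[OF lin] mult)
  have Se: "S e = u" by (simp add: S_def u)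
  \<comment> \<open>\<open>rank_one e y\<close> sends \<open>y\<close> to
    \<open>cinner y y *\<^sub>C e\<close>, and \<open>S\<close> intertwines; so
    \<open>S y = 0\<close> would force a nonzero multiple of \<open>u\<close> to vanish.\<close>
  have S_eq_0: "y = 0" if "S y = 0" for y
  proof (rule ccontr)
    assume "y \<noteq> 0"
    have "S (rank_one e y \<cdot> y) = 0" by (simp only: S(3) that) simp
    then have "cinner y y *\<^sub>C u = 0" by (simp add: S(2) Se)
    with \<open>y \<noteq> 0\<close> u show False by simp
  qed
  have "inj S"
  proof (rule injI)
    fix x y
    assume "S x = S y"
    then have "S (x + (-1) *\<^sub>C y) = 0" unfolding S by (simp add: \<open>S x = S y\<close> scaleC_minus_left scaleC_one)
    from S_eq_0[OF this] show "x = y" by (simp add: scaleC_minus_left scaleC_one)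
  qed
  moreover have "surj S"
  proof (rule surjI)
    fix w
    \<comment> \<open>Surjectivity of \<open>\<tau>\<close> provides an \<open>A\<close> whose image
      is the rank one operator sending \<open>u\<close> to \<open>w\<close>; then
      \<open>S (A \<cdot> e) = \<tau> A \<cdot> u = w\<close>.\<close>
    define A where "A = inv \<tau> (complex_of_real (1 / (norm u)\<^sup>2) *\<^sub>C rank_one w u)"
    have "\<tau> A = complex_of_real (1 / (norm u)\<^sup>2) *\<^sub>C rank_one w u"
      using bij by (simp add: A_def bij_is_surj surj_f_inv_f)
    then have "S (A \<cdot> e) = w"
      using u by (simp add: S(3) Se cinner_norm scaleC_scaleC scaleC_one flip: of_real_mult)
    then show "S (inv \<tau> (complex_of_real (1 / (norm u)\<^sup>2) *\<^sub>C rank_one w u) \<cdot> e) = w"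
      by (simp add: A_def)
  qed
  ultimately show ?thesis
    using S by (intro that[of S]) (auto simp: bij_def)
qed

text \<open>Automatic continuity. The operator \<open>\<tau> (rank_one y z)\<close> is bounded and
  sends \<open>x\<close> to \<open>cinner (inv S x) z *\<^sub>C S y\<close>, so every functional
  \<open>cinner (inv S x) z\<close> is bounded in \<open>x\<close>. Thus \<open>inv S\<close> takes
  the unit sphere to a weakly bounded set, and weakly bounded sets are bounded.\<close>

lemma spatial_inv_bounded:
  fixes S :: "'h::complex_hilbert \<Rightarrow> 'h"
  assumes "bij S" and add: "\<And>x y. S (x + y) = S x + S y"
    and scale: "\<And>c x. S (c *\<^sub>C x) = c *\<^sub>C S x" and S: "\<And>A x. \<tau> A \<cdot> S x = S (A \<cdot> x)"
  shows "\<exists>C\<ge>0. \<forall>x. norm (inv S x) \<le> C * norm x"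
proof (cases "\<exists>z::'h. z \<noteq> 0")
  case False
  then have zero: "x = 0" for x :: 'h by metis
  have "norm (inv S x) \<le> 0 * norm x" for x
    using zero[of "inv S x"] by simp
  then show ?thesis by blast
next
  case True
  then obtain y :: 'h where "y \<noteq> 0" by blast
  have S_inv: "S (inv S x) = x" for x
    using assms(1) by (simp add: bij_is_surj surj_f_inv_f)
  have "S 0 = 0"
    using scale[of 0 0] by simp
  then have Sy: "S y \<noteq> 0"
    using \<open>bij S\<close> \<open>y \<noteq> 0\<close> by (metis bij_is_inj injD)
  have inv_scale: "inv S (c *\<^sub>C x) = c *\<^sub>C inv S x" for c x
    by (rule inv_f_eq) (use assms in \<open>simp_all add: S_inv bij_is_inj\<close>)
  \<comment> \<open>The family runs over all \<open>x\<close>, normalised. For \<open>x = 0\<close>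
    the convention on division by zero makes the vector 0, which is harmless.\<close>
  have "\<exists>C. \<forall>x. norm (inv S (complex_of_real (1 / norm x) *\<^sub>C x)) \<le> C"
  proof (rule uniform_boundedness_cinner)
    fix z :: 'h
    have "cmod (cinner (inv S x) z) * norm (S y) \<le> norm (\<tau> (rank_one y z)) * norm x" for x
      using norm_bop_apply[of "\<tau> (rank_one y z)" x] S[of "rank_one y z" "inv S x"]
      by (simp add: S_inv scale norm_scaleC)
    then have le: "cmod (cinner (inv S x) z) \<le> norm (\<tau> (rank_one y z)) / norm (S y) * norm x" for x
      using Sy by (simp add: field_simps)
    have "cmod (cinner (inv S (complex_of_real (1 / norm x) *\<^sub>C x)) z)
        \<le> norm (\<tau> (rank_one y z)) / norm (S y)" for x
      using le[of "complex_of_real (1 / norm x) *\<^sub>C x"]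
      by (cases "x = 0") (simp_all add: norm_scaleC norm_divide order_trans[OF _ divide_nonneg_nonneg])
    then show "\<exists>C. \<forall>x. cmod (cinner (inv S (complex_of_real (1 / norm x) *\<^sub>C x)) z) \<le> C" by blast
  qed
  then obtain C where C: "norm (inv S (complex_of_real (1 / norm x) *\<^sub>C x)) \<le> C" for x by blast
  have "norm (inv S x) \<le> C * norm x" for x
  proof (cases "x = 0")
    case True
    then show ?thesis using inv_scale[of 0 0] by simp
  next
    case False
    then show ?thesis
      using C[of x] by (simp add: inv_scale norm_scaleC norm_divide field_simps)
  qed
  moreover have "0 \<le> C"
    using C[of 0] norm_ge_zero order_trans by blast
  ultimately show ?thesis by blast
qed

text \<open>\<open>inv S\<close> is bounded by \<open>spatial_inv_bounded\<close>. The same lemma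
  applied to \<open>inv S\<close>, which implements \<open>inv \<tau>\<close>, bounds
  \<open>S\<close>; then \<open>\<tau> A = S A S^-1\<close> is bounded by the product of the two
  constants.\<close>

lemma Aut_bop_bounded:
  assumes \<tau>: "\<tau> \<in> Aut (UNIV :: 'h::complex_hilbert bop set)"
  obtains M where "\<And>A. norm (\<tau> A) \<le> M * norm A"
proof -
  obtain S :: "'h \<Rightarrow> 'h" where S: "bij S" "\<And>x y. S (x + y) = S x + S y"
    "\<And>c x. S (c *\<^sub>C x) = c *\<^sub>C S x" "\<And>A x. \<tau> A \<cdot> S x = S (A \<cdot> x)"
    using Aut_bop_spatial[OF \<tau>] by metis
  have "bij \<tau>" using \<tau> by (simp add: Aut_def)
  have S_inv: "S (inv S x) = x" "inv S (S x) = x" for x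
    using S(1) by (simp_all add: bij_is_surj surj_f_inv_f bij_is_inj)
  have \<tau>_inv: "\<tau> (inv \<tau> A) = A" for A
    using \<open>bij \<tau>\<close> by (simp add: bij_is_surj surj_f_inv_f)
  obtain C where C: "C \<ge> 0" "\<And>x. norm (inv S x) \<le> C * norm x"
    using spatial_inv_bounded[OF S] by blast
  have "\<exists>C\<ge>0. \<forall>x. norm (inv (inv S) x) \<le> C * norm x"
  proof (rule spatial_inv_bounded[of _ "inv \<tau>"])
    show "bij (inv S)" using S(1) by (rule bij_imp_bij_inv)
    have inj: "x = y" if "S x = S y" for x y using S(1) that by (metis bij_is_inj injD)
    show "inv S (x + y) = inv S x + inv S y" "inv S (c *\<^sub>C x) = c *\<^sub>C inv S x"
      "inv \<tau> A \<cdot> inv S x = inv S (A \<cdot> x)" for x y c A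
      by (rule inj, simp add: S_inv S(2,3) S(4)[symmetric] \<tau>_inv)+
  qed
  then obtain D where D: "D \<ge> 0" "\<And>x. norm (S x) \<le> D * norm x"
    using S(1) by (auto simp: inv_inv_eq)
  have "norm (\<tau> A) \<le> (D * C) * norm A" for A
  proof (rule norm_bop_le)
    fix x
    have "norm (\<tau> A \<cdot> x) = norm (S (A \<cdot> inv S x))"
      using S(4)[of A "inv S x"] by (simp add: S_inv)
    also have "\<dots> \<le> D * (norm A * (C * norm x))"
      by (intro order_trans[OF D(2)] mult_left_mono[OF _ D(1)] order_trans[OF norm_bop_apply]
          mult_left_mono C norm_ge_zero)
    finally show "norm (\<tau> A \<cdot> x) \<le> D * C * norm A * norm x"
      by (simp add: mult_ac)
  qed (use C D in simp)
  then show ?thesis by (rule that)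
qed

text \<open>If \<open>\<tau> A = S A S\<inverse>\<close>, then both \<open>\<tau>\<close> and its inverse have norm \<open>\<parallel>S\<parallel> \<parallel>S\<inverse>\<parallel>\<close>.\<close>

lemma Aut_bop_inv_bounded:
  assumes \<tau>: "\<tau> \<in> Aut (UNIV :: 'h::complex_hilbert bop set)"
    and M: "\<And>A. norm (\<tau> A) \<le> M * norm A"
  shows "norm A \<le> \<bar>M\<bar> * norm (\<tau> A)"
proof -
  obtain S :: "'h \<Rightarrow> 'h" where S: "bij S" "\<And>x y. S (x + y) = S x + S y"
    "\<And>c x. S (c *\<^sub>C x) = c *\<^sub>C S x" "\<And>A x. \<tau> A \<cdot> S x = S (A \<cdot> x)"
    using Aut_bop_spatial[OF \<tau>] by metis
  have inj: "x = y" if "S x = S y" for x y using S(1) that by (metis bij_is_inj injD)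
  have S0: "S 0 = 0"
    using S(3)[of 0 0] by simp
  \<comment> \<open>Applying \<open>\<tau> (rank_one y z)\<close> to \<open>S z\<close> gives the
    product bound for the norms of \<open>S\<close> and its inverse in terms of \<open>M\<close>. It
    is used below with \<open>A \<cdot> y\<close> in place of \<open>z\<close>.\<close>
  have le: "norm z * norm (S y) \<le> \<bar>M\<bar> * norm y * norm (S z)" for y z
  proof (cases "z = 0")
    case False
    have "(norm z)\<^sup>2 * norm (S y) = norm (\<tau> (rank_one y z) \<cdot> S z)"
      by (simp add: S(3,4) cinner_norm norm_scaleC norm_power)
    also have "\<dots> \<le> norm (\<tau> (rank_one y z)) * norm (S z)"
      by (rule norm_bop_apply)
    also have "norm (\<tau> (rank_one y z)) \<le> \<bar>M\<bar> * norm (rank_one y z)"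
      using M by (rule order_trans) (simp add: mult_right_mono)
    also have "\<dots> \<le> \<bar>M\<bar> * (norm y * norm z)"
      by (intro mult_left_mono norm_rank_one_le) simp
    finally show ?thesis
      using False by (simp add: power2_eq_square mult_right_mono mult_ac)
  qed simp
  show ?thesis
  proof (rule norm_bop_le)
    fix y
    show "norm (A \<cdot> y) \<le> \<bar>M\<bar> * norm (\<tau> A) * norm y"
    proof (cases "y = 0")
      case False
      then have Sy: "S y \<noteq> 0" using inj[of y 0] S0 by auto
      have "norm (A \<cdot> y) * norm (S y) \<le> \<bar>M\<bar> * norm y * norm (\<tau> A \<cdot> S y)"
        using le[of "A \<cdot> y" y] by (simp add: S(4))
      also have "\<dots> \<le> \<bar>M\<bar> * norm y * (norm (\<tau> A) * norm (S y))"
        by (intro mult_left_mono norm_bop_apply) simp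
      finally show ?thesis
        using Sy by (simp add: mult_ac)
    qed simp
  qed simp
qed

lemma Aut_bop_id:
  assumes "\<tau> \<in> Aut (UNIV :: 'h::complex_hilbert bop set)"
  shows "\<tau> id_bop = id_bop"
proof -
  have "surj \<tau>" and mult: "\<tau> (A * B) = \<tau> A * \<tau> B" for A B
    using assms by (auto simp: Aut_def bij_is_surj)
  then obtain A where "\<tau> A = id_bop" by (metis surjD)
  then show ?thesis
    using mult[of id_bop A] by simp
qed

section \<open>Continuous functions vanishing at infinity\<close>

lemma continuous_map_euclidean_iff_tendsto:
  "continuous_map X euclidean f \<longleftrightarrow> (\<forall>x\<in>topspace X. (f \<longlongrightarrow> f x) (atin X x))"
  by (simp add: continuous_map_atin)

lemma bounded_bilinear_scaleC_bop:
  "bounded_bilinear (\<lambda>c (A::'h::complex_hilbert bop). c *\<^sub>C A)"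
  by unfold_locales
    (auto simp: scaleC_add_left scaleC_add_right scaleR_scaleC scaleC_scaleC scaleR_conv_of_real mult.commute
      intro!: exI[of _ 1])

lemmas tendsto_scaleC_bop [tendsto_intros] = bounded_bilinear.tendsto[OF bounded_bilinear_scaleC_bop]

lemma C0_continuous: "f \<in> C0 X \<Longrightarrow> continuous_map X euclidean f"
  and C0_vanish: "f \<in> C0 X \<Longrightarrow> 0 < e \<Longrightarrow> \<exists>K. compactin X K \<and> (\<forall>x\<in>topspace X - K. norm (f x) < e)"
  and C0_outside: "f \<in> C0 X \<Longrightarrow> x \<notin> topspace X \<Longrightarrow> f x = 0"
  by (simp_all add: C0_def)

lemma C0_tendsto: "f \<in> C0 X \<Longrightarrow> x \<in> topspace X \<Longrightarrow> (f \<longlongrightarrow> f x) (atin X x)"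
  by (simp add: C0_def continuous_map_euclidean_iff_tendsto)

lemma C0I:
  assumes "\<And>x. x \<in> topspace X \<Longrightarrow> (f \<longlongrightarrow> f x) (atin X x)"
    and "\<And>e. 0 < e \<Longrightarrow> \<exists>K. compactin X K \<and> (\<forall>x\<in>topspace X - K. norm (f x) < e)"
    and "\<And>x. x \<notin> topspace X \<Longrightarrow> f x = 0"
  shows "f \<in> C0 X"
  using assms by (auto simp: C0_def continuous_map_euclidean_iff_tendsto)

lemma C0_bounded:
  assumes f: "f \<in> C0 X"
  shows "\<exists>B>0. \<forall>x. norm (f x) \<le> B"
proof -
  obtain K where K: "compactin X K" "\<And>x. x \<in> topspace X - K \<Longrightarrow> norm (f x) < 1"
    using C0_vanish[OF f, of 1] by auto
  have "compact (f ` K)"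
    using image_compactin[OF K(1) C0_continuous[OF f]] by simp
  then have "bounded (f ` K)" by (rule compact_imp_bounded)
  then obtain B where B: "\<forall>y\<in>f ` K. norm y \<le> B" unfolding bounded_iff ..
  have "norm (f x) \<le> max B 1" for x
    using B K(2)[of x] C0_outside[OF f, of x]
    by (cases "x \<in> K"; cases "x \<in> topspace X") auto
  then show ?thesis
    by (intro exI[of _ "max B 1"]) auto
qed

lemma norm_le_sup_norm:
  assumes "f \<in> C0 X"
  shows "norm (f x) \<le> sup_norm f"
proof -
  obtain B where "norm (f x) \<le> B" for x using C0_bounded[OF assms] by blast
  then show ?thesis
    unfolding sup_norm_def by (intro cSUP_upper bdd_aboveI2[where M = B]) simp_all
qed

lemma sup_norm_le: "(\<And>x. norm (f x) \<le> r) \<Longrightarrow> sup_norm f \<le> r"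
  unfolding sup_norm_def by (intro cSUP_least) auto

text \<open>The common source of closure of \<open>C0 X\<close> under scalings, products and
  conjugation: domination takes care of vanishing at infinity and of the value 0 outside the space,
  so that continuity alone remains. The two functions may have different ranges.\<close>

lemma C0_dominated:
  assumes f: "f \<in> C0 X"
    and g: "\<And>x. x \<in> topspace X \<Longrightarrow> (g \<longlongrightarrow> g x) (atin X x)"
    and le: "\<And>x. norm (g x) \<le> B * norm (f x)"
  shows "g \<in> C0 X"
proof (rule C0I[OF g])
  fix e :: real
  assume "0 < e"
  then obtain K where K: "compactin X K" "\<And>x. x \<in> topspace X - K \<Longrightarrow> norm (f x) < e / (\<bar>B\<bar> + 1)"
    using C0_vanish[OF f, of "e / (\<bar>B\<bar> + 1)"] by auto
  have "norm (g x) < e" if "x \<in> topspace X - K" for x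
  proof -
    have "norm (g x) \<le> (\<bar>B\<bar> + 1) * norm (f x)"
      using le by (rule order_trans) (intro mult_right_mono, auto)
    also have "\<dots> < e"
      using K(2)[OF that] by (simp add: field_simps)
    finally show ?thesis .
  qed
  with K(1) show "\<exists>K. compactin X K \<and> (\<forall>x\<in>topspace X - K. norm (g x) < e)" by blast
next
  fix x
  assume "x \<notin> topspace X"
  with le[of x] show "g x = 0" by (simp add: C0_outside[OF f])
qed

lemma C0_zero: "0 \<in> C0 X"
  unfolding zero_fun_def by (rule C0I) (auto intro: exI[of _ "{}"])

lemma C0_add:
  assumes f: "f \<in> C0 X" and g: "g \<in> C0 X"
  shows "f + g \<in> C0 X"
proof (rule C0I)
  fix e :: real
  assume "0 < e"
  then obtain K L where K: "compactin X K" "\<And>x. x \<in> topspace X - K \<Longrightarrow> norm (f x) < e / 2"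
    and L: "compactin X L" "\<And>x. x \<in> topspace X - L \<Longrightarrow> norm (g x) < e / 2"
    using C0_vanish[OF f, of "e / 2"] C0_vanish[OF g, of "e / 2"] by auto
  have "norm ((f + g) x) < e" if "x \<in> topspace X - (K \<union> L)" for x
    using norm_triangle_ineq[of "f x" "g x"] K(2)[of x] L(2)[of x] that by simp
  with compactin_Un[OF K(1) L(1)]
  show "\<exists>K. compactin X K \<and> (\<forall>x\<in>topspace X - K. norm ((f + g) x) < e)" by blast
qed (auto simp: plus_fun_def C0_outside[OF f] C0_outside[OF g]
    intro!: tendsto_add C0_tendsto[OF f] C0_tendsto[OF g])

lemma C0_scaleC_fun:
  fixes f :: "'x \<Rightarrow> 'h::complex_hilbert bop"
  assumes h: "h \<in> C0 X" and f: "f \<in> C0 X"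
  shows "(\<lambda>x. h x *\<^sub>C f x) \<in> C0 X"
proof -
  obtain B where "\<And>x. cmod (h x) \<le> B" using C0_bounded[OF h] by auto
  then show ?thesis
    by (intro C0_dominated[OF f, of _ B])
      (auto intro!: tendsto_scaleC_bop C0_tendsto[OF f] C0_tendsto[OF h] mult_right_mono)
qed

lemma C0_scaleC_const:
  fixes A :: "'h::complex_hilbert bop"
  assumes h: "h \<in> C0 X"
  shows "(\<lambda>x. h x *\<^sub>C A) \<in> C0 X"
  by (rule C0_dominated[OF h, of _ "norm A"])
    (auto intro!: tendsto_scaleC_bop C0_tendsto[OF h])

lemma C0_scaleC:
  fixes f :: "'x \<Rightarrow> 'h::complex_hilbert bop"
  assumes f: "f \<in> C0 X"
  shows "c *\<^sub>C f \<in> C0 X"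
  unfolding scaleC_fun_def
  by (rule C0_dominated[OF f, of _ "cmod c"]) (auto intro!: tendsto_scaleC_bop C0_tendsto[OF f])

lemma C0_diff: "f \<in> C0 X \<Longrightarrow> g \<in> C0 X \<Longrightarrow> f - g \<in> C0 X" for f :: "'x \<Rightarrow> 'h::complex_hilbert bop"
  using C0_add[of f X "(-1) *\<^sub>C g"] C0_scaleC[of g X "-1"]
  by (simp add: scaleC_minus_left scaleC_one)

lemma C0_times:
  fixes f g :: "'x \<Rightarrow> 'b::real_normed_algebra"
  assumes f: "f \<in> C0 X" and g: "g \<in> C0 X"
  shows "f * g \<in> C0 X"
proof -
  obtain B where B: "\<And>x. norm (f x) \<le> B" using C0_bounded[OF f] by auto
  have "norm (f x * g x) \<le> B * norm (g x)" for x
    using norm_mult_ineq mult_right_mono[OF B norm_ge_zero] by (rule order_trans)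
  then show ?thesis
    unfolding times_fun_def
    by (intro C0_dominated[OF g, of _ B]) (auto intro!: tendsto_mult C0_tendsto[OF f] C0_tendsto[OF g])
qed

text \<open>Complete regularity separates \<open>x\<close> from the complement of
  \<open>U \<inter> V\<close>, where \<open>V\<close> lies in a compact set; the bump therefore has
  compact support. Its values are recorded as reals in [0,1] because norm estimates use it as a
  weight.\<close>

lemma C0_bump:
  assumes X: "locally_compact_space X" "Hausdorff_space X" and U: "openin X U" "x \<in> U"
  obtains u :: "'x \<Rightarrow> complex" where "u \<in> C0 X" "u x = 1" "\<And>y. y \<notin> U \<Longrightarrow> u y = 0"
    "\<And>y. \<exists>r\<in>{0..1}. u y = complex_of_real r"
proof -
  have x: "x \<in> topspace X" using U openin_subset by blast
  obtain V K where V: "openin X V" "compactin X K" "x \<in> V" "V \<subseteq> K"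
    using X(1) x unfolding locally_compact_space_def by blast
  have "completely_regular_space X"
    using X by (intro locally_compact_regular_imp_completely_regular_space
        locally_compact_Hausdorff_imp_regular_space) auto
  moreover have "closedin X (topspace X - U \<inter> V)"
    using U(1) V(1) by auto
  ultimately obtain f :: "'x \<Rightarrow> real" where
    f: "continuous_map X (top_of_set {0..1}) f" "f x = 0" "f ` (topspace X - U \<inter> V) \<subseteq> {1}"
    using x U(2) V(3) unfolding completely_regular_space_def
    by (metis Diff_iff IntI)
  define u where "u y = (if y \<in> topspace X then complex_of_real (1 - f y) else 0)" for y
  have f': "continuous_map X euclidean f" "f ` topspace X \<subseteq> {0..1}"
    using f(1) by (auto simp: continuous_map_in_subtopology)
  have u0: "u y = 0" if "y \<notin> U \<inter> V" for y
    using f(3) that by (auto simp: u_def)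
  show ?thesis
  proof
    show "u \<in> C0 X"
    proof (rule C0I)
      fix e :: real
      assume "0 < e"
      have "norm (u y) < e" if "y \<in> topspace X - K" for y
      proof -
        have "y \<notin> U \<inter> V" using V(4) that by blast
        from u0[OF this] \<open>0 < e\<close> show ?thesis by simp
      qed
      with V(2) show "\<exists>K. compactin X K \<and> (\<forall>y\<in>topspace X - K. norm (u y) < e)"
        by blast
    next
      fix y
      assume y: "y \<in> topspace X"
      have "((\<lambda>y. complex_of_real (1 - f y)) \<longlongrightarrow> complex_of_real (1 - f y)) (atin X y)"
        using f'(1) y by (auto simp: continuous_map_euclidean_iff_tendsto intro!: tendsto_intros)
      moreover have "\<forall>\<^sub>F z in atin X y. complex_of_real (1 - f z) = u z"
        using y by (auto simp: eventually_atin u_def intro!: exI[of _ "topspace X"])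
      ultimately show "(u \<longlongrightarrow> u y) (atin X y)"
        using y by (auto simp: u_def[of y] intro: Lim_transform_eventually)
    qed (simp add: u_def)
    show "u x = 1" using x f(2) by (simp add: u_def)
    show "u y = 0" if "y \<notin> U" for y using u0 that by blast
    show "\<exists>r\<in>{0..1}. u y = complex_of_real r" for y
      using f'(2) by (intro bexI[of _ "if y \<in> topspace X then 1 - f y else 0"]) (auto simp: u_def)
  qed
qed

text \<open>Splitting off the square root of the norm leaves a \<open>g\<close> with
  \<open>norm (g x) = sqrt (norm (f x))\<close>. So \<open>g\<close> tends to 0 at the zeros of
  \<open>f\<close>, where division by zero already sets it to 0, and it vanishes at infinity along
  with \<open>f\<close>.\<close>

lemma C0_factor:
  fixes f :: "'x \<Rightarrow> 'h::complex_hilbert bop"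
  assumes f: "f \<in> C0 X"
  obtains h g where "h \<in> C0 X" "g \<in> C0 X" "f = (\<lambda>x. h x *\<^sub>C g x)" "\<And>x. f x = 0 \<Longrightarrow> h x = 0"
proof
  define h where "h x = complex_of_real (sqrt (norm (f x)))" for x
  define g where "g x = complex_of_real (1 / sqrt (norm (f x))) *\<^sub>C f x" for x
  have norm_g: "norm (g x) = sqrt (norm (f x))" for x
    by (simp add: g_def norm_divide real_div_sqrt)
  have vanish: "\<exists>K. compactin X K \<and> (\<forall>x\<in>topspace X - K. sqrt (norm (f x)) < e)" if "0 < e" for e
  proof -
    obtain K where "compactin X K" "\<And>x. x \<in> topspace X - K \<Longrightarrow> norm (f x) < e\<^sup>2"
      using C0_vanish[OF f, of "e\<^sup>2"] \<open>0 < e\<close> by auto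
    with \<open>0 < e\<close> show ?thesis
      by (auto intro!: exI[of _ K] real_less_lsqrt)
  qed
  have lim: "((\<lambda>y. sqrt (norm (f y))) \<longlongrightarrow> sqrt (norm (f x))) (atin X x)" if "x \<in> topspace X" for x
    by (intro tendsto_intros C0_tendsto[OF f] that)
  show "h \<in> C0 X"
    unfolding h_def using vanish lim by (intro C0I) (auto simp: C0_outside[OF f] intro!: tendsto_of_real)
  show "g \<in> C0 X"
  proof (rule C0I)
    fix x
    assume x: "x \<in> topspace X"
    show "(g \<longlongrightarrow> g x) (atin X x)"
    proof (cases "f x = 0")
      case True
      have "((\<lambda>y. norm (g y)) \<longlongrightarrow> 0) (atin X x)"
        using lim[OF x] unfolding norm_g True by simp
      then show ?thesis
        using tendsto_norm_zero_cancel[of g] by (simp add: g_def[of x] True)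
    next
      case False
      then show ?thesis
        unfolding g_def by (intro tendsto_scaleC_bop tendsto_intros C0_tendsto[OF f] lim x) auto
    qed
  next
    show "\<exists>K. compactin X K \<and> (\<forall>x\<in>topspace X - K. norm (g x) < e)" if "0 < e" for e
      unfolding norm_g using that by (rule vanish)
  qed (simp add: C0_outside[OF f] g_def)
  show "f = (\<lambda>x. h x *\<^sub>C g x)"
  proof
    fix x
    show "f x = h x *\<^sub>C g x"
      by (cases "f x = 0") (auto simp: h_def g_def scaleC_scaleC scaleC_one simp flip: of_real_mult)
  qed
  show "f x = 0 \<Longrightarrow> h x = 0" for x
    by (simp add: h_def)
qed

text \<open>The rate \<open>b n\<close> does not depend on the point, so the pointwise limit is
  uniform; continuity and vanishing at infinity follow by approximating with one
  \<open>s n\<close>.\<close>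

lemma C0_complete:
  fixes s :: "nat \<Rightarrow> 'x \<Rightarrow> 'h::complex_hilbert bop"
  assumes s: "range s \<subseteq> C0 X" and le: "\<And>m n. n \<le> m \<Longrightarrow> sup_norm (s m - s n) \<le> b n"
    and b: "b \<longlonglongrightarrow> 0"
  shows "\<exists>v\<in>C0 X. \<forall>n. sup_norm (v - s n) \<le> b n"
proof -
  have s: "s n \<in> C0 X" for n using s by auto
  have "\<exists>v. \<forall>n. norm (v - s n x) \<le> b n" for x
  proof (rule Cauchy_bound_limit[OF _ b])
    show "norm (s m x - s n x) \<le> b n" if "n \<le> m" for m n
      using norm_le_sup_norm[OF C0_diff[OF s s], of m n x] le[OF that] by simp
  qed
  then obtain v where v: "\<And>x n. norm (v x - s n x) \<le> b n" by metis
  have small: "\<exists>n. b n < e" if "0 < e" for e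
    using order_tendstoD(2)[OF b that] by (auto simp: eventually_sequentially)
  have "v \<in> C0 X"
  proof (rule C0I)
    fix x
    assume x: "x \<in> topspace X"
    show "(v \<longlongrightarrow> v x) (atin X x)"
    proof (rule tendstoI)
      fix e :: real
      assume "0 < e"
      then obtain n where n: "b n < e / 3" using small[of "e / 3"] by auto
      have "\<forall>\<^sub>F y in atin X x. dist (s n y) (s n x) < e / 3"
        using C0_tendsto[OF s x, of n] \<open>0 < e\<close> by (intro tendstoD) auto
      then show "\<forall>\<^sub>F y in atin X x. dist (v y) (v x) < e"
      proof eventually_elim
        case (elim y)
        have "norm (v y - v x) \<le> norm (v y - s n y) + norm (s n y - s n x) + norm (v x - s n x)"
          using norm_triangle_ineq[of "v y - s n y" "s n y - s n x"]
            norm_triangle_ineq4[of "v y - s n x" "v x - s n x"] by simp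
        with elim n v[of y n] v[of x n] show ?case by (simp add: dist_norm)
      qed
    qed
  next
    fix e :: real
    assume "0 < e"
    then obtain n where n: "b n < e / 2" using small[of "e / 2"] by auto
    obtain K where K: "compactin X K" "\<And>x. x \<in> topspace X - K \<Longrightarrow> norm (s n x) < e / 2"
      using C0_vanish[OF s, of "e / 2" n] \<open>0 < e\<close> by auto
    have "norm (v x) < e" if "x \<in> topspace X - K" for x
      using norm_triangle_ineq[of "v x - s n x" "s n x"] v[of x n] n K(2)[OF that] by simp
    with K(1) show "\<exists>K. compactin X K \<and> (\<forall>x\<in>topspace X - K. norm (v x) < e)" by blast
  next
    fix x
    assume "x \<notin> topspace X"
    then have "norm (v x) \<le> b n" for n
      using v[of x n] C0_outside[OF s, of x n] by simp
    then have "norm (v x) \<le> 0"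
      using small[of "norm (v x)"] by (meson linorder_not_less)
    then show "v x = 0" by simp
  qed
  moreover have "sup_norm (v - s n) \<le> b n" for n
    by (rule sup_norm_le) (use v in simp)
  ultimately show ?thesis by blast
qed

section \<open>Characters\<close>

text \<open>If \<open>h\<close> omits the value 1, the quasi-inverse \<open>k = h / (1 - h)\<close>
  lies in \<open>C0 X\<close>, and \<open>k = h + h * k\<close> gives the contradiction
  \<open>\<omega> k = 1 + \<omega> k\<close>.\<close>

lemma character_attains_one:
  fixes \<omega> :: "('x \<Rightarrow> complex) \<Rightarrow> complex"
  assumes add: "\<And>h k. h \<in> C0 X \<Longrightarrow> k \<in> C0 X \<Longrightarrow> \<omega> (h + k) = \<omega> h + \<omega> k"
    and mult: "\<And>h k. h \<in> C0 X \<Longrightarrow> k \<in> C0 X \<Longrightarrow> \<omega> (h * k) = \<omega> h * \<omega> k"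
    and h: "h \<in> C0 X" "\<omega> h = 1"
  shows "\<exists>x\<in>topspace X. h x = 1"
proof (rule ccontr)
  assume "\<not> ?thesis"
  then have ne: "h x \<noteq> 1" for x
    using C0_outside[OF h(1), of x] by (cases "x \<in> topspace X") auto
  define k where "k x = h x / (1 - h x)" for x
  have k: "k \<in> C0 X"
  proof (rule C0I)
    fix e :: real
    assume "0 < e"
    \<comment> \<open>Off \<open>K\<close> the bound 1/2 keeps \<open>1 - h\<close> away from 0, so
      that \<open>norm (k x)\<close> is at most twice \<open>norm (h x)\<close>, hence below
      \<open>e\<close>.\<close>
    then obtain K where K: "compactin X K" "\<And>x. x \<in> topspace X - K \<Longrightarrow> norm (h x) < min (1/2) (e/2)"
      using C0_vanish[OF h(1), of "min (1/2) (e/2)"] by auto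
    have "norm (k x) < e" if "x \<in> topspace X - K" for x
    proof -
      have "1/2 \<le> norm (1 - h x)"
        using norm_triangle_ineq2[of 1 "h x"] K(2)[OF that] by simp
      then have "norm (k x) \<le> norm (h x) / (1/2)"
        unfolding k_def norm_divide by (intro divide_left_mono) auto
      with K(2)[OF that] show ?thesis by simp
    qed
    with K(1) show "\<exists>K. compactin X K \<and> (\<forall>x\<in>topspace X - K. norm (k x) < e)" by blast
  next
    show "(k \<longlongrightarrow> k x) (atin X x)" if "x \<in> topspace X" for x
      unfolding k_def using ne[of x] by (intro tendsto_intros C0_tendsto[OF h(1) that]) simp
  qed (simp add: k_def C0_outside[OF h(1)])
  have "k = h + h * k"
    using ne by (auto simp: fun_eq_iff k_def field_simps)
  then have "\<omega> k = \<omega> h + \<omega> h * \<omega> k"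
    using add[OF h(1) C0_times[OF h(1) k]] mult[OF h(1) k] by simp
  with h(2) show False by simp
qed

lemma C0_complex_mult:
  fixes h :: "'x \<Rightarrow> complex"
  assumes h: "h \<in> C0 X"
  shows "(\<lambda>x. c * h x) \<in> C0 X"
  by (rule C0_dominated[OF h, of _ "cmod c"]) (auto intro!: tendsto_intros C0_tendsto[OF h] simp: norm_mult)

lemma C0_cnj:
  assumes h: "h \<in> C0 X"
  shows "(\<lambda>x. cnj (h x)) \<in> C0 X"
  by (rule C0_dominated[OF h, of _ 1]) (auto intro!: tendsto_intros C0_tendsto[OF h])

text \<open>Let \<open>\<omega> e = 1\<close>. If every point were missed by some kernel element,
  compactness would yield one kernel element \<open>r\<close> for which the real part of
  \<open>e - r\<close> is below 1 everywhere. But \<open>\<omega> (e - r) = 1\<close>, so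
  \<open>e - r\<close> attains 1 by \<open>character_attains_one\<close>.\<close>

lemma character_kernel_point:
  fixes \<omega> :: "('x \<Rightarrow> complex) \<Rightarrow> complex"
  assumes add: "\<And>h k. h \<in> C0 X \<Longrightarrow> k \<in> C0 X \<Longrightarrow> \<omega> (h + k) = \<omega> h + \<omega> k"
    and mult: "\<And>h k. h \<in> C0 X \<Longrightarrow> k \<in> C0 X \<Longrightarrow> \<omega> (h * k) = \<omega> h * \<omega> k"
    and scale: "\<And>c h. h \<in> C0 X \<Longrightarrow> \<omega> (\<lambda>x. c * h x) = c * \<omega> h"
    and nonzero: "e0 \<in> C0 X" "\<omega> e0 \<noteq> 0"
  shows "\<exists>y\<in>topspace X. \<forall>h\<in>C0 X. h y = 0 \<longrightarrow> \<omega> h = 0"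
proof (rule ccontr)
  assume neg: "\<not> ?thesis"
  define e where "e x = (1 / \<omega> e0) * e0 x" for x
  have e: "e \<in> C0 X" "\<omega> e = 1"
    unfolding e_def using nonzero by (simp_all only: C0_complex_mult scale) simp
  obtain K where K: "compactin X K" "\<And>x. x \<in> topspace X - K \<Longrightarrow> norm (e x) < 1"
    using C0_vanish[OF e(1), of 1] by auto
  define Z where "Z = {q \<in> C0 X. \<omega> q = 0 \<and> (\<forall>x. 0 \<le> Re (q x))}"
  have "\<exists>q\<in>Z. Re (e y) - Re (q y) < 1" if y: "y \<in> topspace X" for y
  proof -
    obtain h where h: "h \<in> C0 X" "h y = 0" "\<omega> h \<noteq> 0" using neg y by blast
    \<comment> \<open>The multiple of \<open>h e\<close> is chosen so that
      \<open>\<omega> f = 0\<close>; since \<open>h y = 0\<close>, the value of \<open>f\<close> at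
      \<open>y\<close> is still \<open>e y\<close>.\<close>
    define f where "f x = e x + (- 1 / \<omega> h) * (h x * e x)" for x
    have he: "h * e \<in> C0 X" by (rule C0_times[OF h(1) e(1)])
    have f_eq: "f = e + (\<lambda>x. (- 1 / \<omega> h) * (h * e) x)"
      by (simp add: fun_eq_iff f_def)
    have f: "f \<in> C0 X" unfolding f_eq by (intro C0_add C0_complex_mult e(1) he)
    have "\<omega> f = 0"
      unfolding f_eq using h(3)
      by (simp only: add[OF e(1) C0_complex_mult[OF he]] scale[OF he] mult[OF h(1) e(1)] e(2)) simp
    \<comment> \<open>Multiplying \<open>f\<close> by its conjugate gives a nonnegative function
      that stays in the kernel by multiplicativity alone. The constant makes
      \<open>q y = \<bar>Re (e y)\<bar> + 1\<close> when \<open>e y \<noteq> 0\<close>; when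
      \<open>e y = 0\<close> it is 0 by division by zero, and \<open>q = 0\<close> is good
      enough.\<close>
    define q where "q x = complex_of_real ((\<bar>Re (e y)\<bar> + 1) / (cmod (e y))\<^sup>2) * (f * (\<lambda>x. cnj (f x))) x" for x
    have q_eq: "q x = complex_of_real ((\<bar>Re (e y)\<bar> + 1) / (cmod (e y))\<^sup>2 * (cmod (f x))\<^sup>2)" for x
      unfolding q_def times_fun_def of_real_mult complex_norm_square by simp
    have "q \<in> Z"
      unfolding Z_def
    proof (intro CollectI conjI allI)
      have ff: "f * (\<lambda>x. cnj (f x)) \<in> C0 X" by (intro C0_times C0_cnj f)
      show "q \<in> C0 X" unfolding q_def by (intro C0_complex_mult ff)
      show "\<omega> q = 0"
        unfolding q_def using \<open>\<omega> f = 0\<close> by (simp only: scale[OF ff] mult[OF f C0_cnj[OF f]]) simp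
      show "0 \<le> Re (q x)" for x unfolding q_eq by simp
    qed
    moreover have "Re (e y) - Re (q y) < 1"
    proof (cases "e y = 0")
      case True
      then show ?thesis by (simp add: q_eq)
    next
      case False
      then have "Re (q y) = \<bar>Re (e y)\<bar> + 1" by (simp add: q_eq f_def h(2))
      then show ?thesis by simp
    qed
    ultimately show ?thesis by blast
  qed
  then obtain q where q: "\<And>y. y \<in> topspace X \<Longrightarrow> q y \<in> Z \<and> Re (e y) - Re (q y y) < 1" by metis
  have KX: "K \<subseteq> topspace X" using K(1) by (rule compactin_subset_topspace)
  define U where "U y = {x \<in> topspace X. Re (e x) - Re (q y x) \<in> {..<1}}" for y
  have U_open: "openin X (U y)" if "y \<in> K" for y
    unfolding U_def
  proof (rule openin_continuous_map_preimage)
    have "q y \<in> C0 X" using q KX that by (auto simp: Z_def)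
    then show "continuous_map X euclidean (\<lambda>x. Re (e x) - Re (q y x))"
      unfolding continuous_map_euclidean_iff_tendsto
      by (intro ballI tendsto_intros C0_tendsto e(1))
  qed simp
  have "K \<subseteq> \<Union> (U ` K)" using q KX by (auto simp: U_def)
  then obtain \<F> where "finite \<F>" "\<F> \<subseteq> U ` K" "K \<subseteq> \<Union>\<F>"
    using compactinD[OF K(1), of "U ` K"] U_open by auto
  then obtain F where F: "finite F" "F \<subseteq> K" "K \<subseteq> \<Union> (U ` F)"
    by (metis finite_subset_image)
  \<comment> \<open>The sum of the finitely many \<open>q y\<close>: all have nonnegative real part,
    so it dominates each of them.\<close>
  have "\<exists>r\<in>Z. \<forall>y\<in>F. \<forall>x. Re (q y x) \<le> Re (r x)"
    using F(1,2)
  proof (induction F rule: finite_induct)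
    case empty
    have "0 \<in> Z" using C0_zero scale[OF C0_zero, of 0] by (auto simp: Z_def zero_fun_def)
    then show ?case by blast
  next
    case (insert y F)
    then obtain r where r: "r \<in> Z" "\<forall>y\<in>F. \<forall>x. Re (q y x) \<le> Re (r x)" by auto
    have qy: "q y \<in> Z" using q insert.prems KX by auto
    have "q y + r \<in> Z" using r(1) qy by (auto simp: Z_def C0_add add)
    moreover have "Re (q y' x) \<le> Re ((q y + r) x)" if "y' \<in> insert y F" for y' x
    proof -
      have "0 \<le> Re (q y x)" "0 \<le> Re (r x)" using r(1) qy by (auto simp: Z_def)
      moreover have "y' = y \<or> Re (q y' x) \<le> Re (r x)" using r(2) that by auto
      ultimately show ?thesis by auto
    qed
    ultimately show ?case by blast
  qed
  then obtain r where r: "r \<in> Z" "\<And>y x. y \<in> F \<Longrightarrow> Re (q y x) \<le> Re (r x)" by blast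
  \<comment> \<open>On \<open>K\<close> the cover makes the real part of \<open>e - r\<close> less
    than 1; off \<open>K\<close> already \<open>e\<close> has modulus below 1 and \<open>r\<close>
    only lowers the real part.\<close>
  define g where "g = e + (\<lambda>x. (- 1) * r x)"
  have rC: "r \<in> C0 X" "\<omega> r = 0" using r(1) by (auto simp: Z_def)
  have g: "g \<in> C0 X" unfolding g_def by (intro C0_add C0_complex_mult e(1) rC(1))
  have "\<omega> g = 1"
    unfolding g_def
    by (simp only: add[OF e(1) C0_complex_mult[OF rC(1)]] scale[OF rC(1)] rC(2) e(2)) simp
  from character_attains_one[OF add mult g this]
  obtain x where x: "x \<in> topspace X" "g x = 1" by blast
  have "Re (e x) - Re (r x) < 1"
  proof (cases "x \<in> K")
    case True
    then obtain y where "y \<in> F" "x \<in> U y" using F(3) by auto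
    then show ?thesis using r(2)[of y x] by (simp add: U_def)
  next
    case False
    have "Re (e x) < 1"
      using K(2)[of x] False x(1) complex_Re_le_cmod[of "e x"] by simp
    moreover have "0 \<le> Re (r x)" using r(1) by (simp add: Z_def)
    ultimately show ?thesis by simp
  qed
  with x(2) show False
    by (metis (no_types) g_def plus_fun_apply minus_complex.simps(1) diff_conv_add_uminus
        mult_minus1 one_complex.simps(1) order_less_irrefl)
qed

section \<open>Module isomorphisms\<close>

lemma scaleC_cancel_left: "A \<noteq> 0 \<Longrightarrow> c *\<^sub>C A = d *\<^sub>C A \<Longrightarrow> c = d" for A :: "'a::complex_vector"
  by (metis right_minus_eq scaleC_diff_left scaleC_eq_0_iff)

lemma linear_maps_D:
  assumes "\<Phi> \<in> linear_maps V"
  shows "f \<in> V \<Longrightarrow> \<Phi> f \<in> V" "f \<in> V \<Longrightarrow> g \<in> V \<Longrightarrow> \<Phi> (f + g) = \<Phi> f + \<Phi> g"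
    "f \<in> V \<Longrightarrow> \<Phi> (c *\<^sub>C f) = c *\<^sub>C \<Phi> f"
  using assms by (auto simp: linear_maps_def)

lemma linear_maps_C0_diff:
  fixes f g :: "'x \<Rightarrow> 'h::complex_hilbert bop"
  assumes \<Phi>: "\<Phi> \<in> linear_maps (C0 X)" and f: "f \<in> C0 X" and g: "g \<in> C0 X"
  shows "\<Phi> (f - g) = \<Phi> f - \<Phi> g"
  using linear_maps_D(2)[OF \<Phi> f C0_scaleC[OF g, of "-1"]] linear_maps_D(3)[OF \<Phi> g, of "-1"]
  by (simp add: scaleC_minus_left scaleC_one)

lemma linear_maps_inv_into:
  assumes \<Phi>: "\<Phi> \<in> linear_maps V" and bij: "bij_betw \<Phi> V V"
    and add: "\<And>f g. f \<in> V \<Longrightarrow> g \<in> V \<Longrightarrow> f + g \<in> V" and scale: "\<And>c f. f \<in> V \<Longrightarrow> c *\<^sub>C f \<in> V"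
  shows "inv_into V \<Phi> \<in> linear_maps V"
proof -
  have inj: "inj_on \<Phi> V" and img: "\<Phi> ` V = V" using bij by (auto simp: bij_betw_def)
  have in_V: "inv_into V \<Phi> f \<in> V" if "f \<in> V" for f
    using that img by (metis inv_into_into)
  have \<Phi>_inv: "\<Phi> (inv_into V \<Phi> f) = f" if "f \<in> V" for f
    using that img by (metis f_inv_into_f)
  have "inv_into V \<Phi> (f + g) = inv_into V \<Phi> f + inv_into V \<Phi> g" if "f \<in> V" "g \<in> V" for f g
    by (rule inv_into_f_eq[OF inj]) (simp_all add: that in_V add linear_maps_D[OF \<Phi>] \<Phi>_inv)
  moreover have "inv_into V \<Phi> (c *\<^sub>C f) = c *\<^sub>C inv_into V \<Phi> f" if "f \<in> V" for c f
    by (rule inv_into_f_eq[OF inj]) (simp_all add: that in_V scale linear_maps_D[OF \<Phi>] \<Phi>_inv)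
  ultimately show ?thesis
    using in_V by (auto simp: linear_maps_def)
qed

context
  fixes X :: "'x topology"
  assumes X: "locally_compact_space X" "Hausdorff_space X"
begin

text \<open>A bump function times \<open>A\<close>. With the bump supported in the complement of the
  closed point \<open>y\<close> the same construction separates points; the bound on
  \<open>sup_norm f\<close> lets estimates for \<open>\<Phi>\<close> pass to
  \<open>\<tau> x\<close>.\<close>

lemma C0_value:
  fixes A :: "'h::complex_hilbert bop"
  assumes x: "x \<in> topspace X"
  obtains f where "f \<in> C0 X" "f x = A" "sup_norm f \<le> norm A" "\<And>y. y \<noteq> x \<Longrightarrow> \<exists>g\<in>C0 X. g y = 0 \<and> g x = A"
proof -
  have 1: "\<exists>f\<in>C0 X. f x = A \<and> (\<forall>y. norm (f y) \<le> norm A) \<and> (\<forall>y. y \<notin> U \<longrightarrow> f y = 0)"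
    if U: "openin X U" "x \<in> U" for U
  proof -
    obtain u :: "'x \<Rightarrow> complex" where u: "u \<in> C0 X" "u x = 1" "\<And>y. y \<notin> U \<Longrightarrow> u y = 0"
        "\<And>y. \<exists>r\<in>{0..1}. u y = complex_of_real r"
      using C0_bump[OF X U] by metis
    have "norm (u y *\<^sub>C A) \<le> norm A" for y
      using u(4)[of y] by (auto simp: mult_left_le_one_le)
    then show ?thesis
      using u(2,3) C0_scaleC_const[OF u(1), of A]
      by (intro bexI[of _ "\<lambda>y. u y *\<^sub>C A"]) (auto simp: scaleC_one)
  qed
  obtain f where f: "f \<in> C0 X" "f x = A" "\<And>y. norm (f y) \<le> norm A"
    using 1[OF openin_topspace x] by auto
  have ex: "\<exists>g\<in>C0 X. g y = 0 \<and> g x = A" if "y \<noteq> x" for y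
  proof -
    have "openin X (topspace X - {y})"
    proof (cases "y \<in> topspace X")
      case True
      then show ?thesis
        using X(2) by (simp add: Hausdorff_imp_t1_space closedin_t1_singleton openin_diff)
    qed simp
    from 1[OF this] x that show ?thesis by auto
  qed
  show ?thesis
    by (rule that[OF f(1,2) sup_norm_le[OF f(3)] ex])
qed

text \<open>At a fixed \<open>x\<close> the module property reads
  \<open>\<Phi> (h f) x = \<kappa> h *\<^sub>C \<Phi> f x\<close>. Testing with one
  \<open>f0\<close> for which \<open>\<Phi> f0 x \<noteq> 0\<close> shows that
  \<open>\<kappa>\<close> is a character of the scalar functions; its kernel point is the wanted
  \<open>y\<close>.\<close>

lemma module_map_point:
  fixes \<Phi> :: "('x \<Rightarrow> 'h::complex_hilbert bop) \<Rightarrow> 'x \<Rightarrow> 'h bop"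
  assumes \<Phi>: "\<Phi> \<in> linear_maps (C0 X)" "\<Phi> ` C0 X = C0 X"
    and z: "(z::'h) \<noteq> 0"
    and mod: "\<And>h. h \<in> C0 X \<Longrightarrow> \<exists>k. \<forall>f\<in>C0 X. \<forall>x\<in>topspace X. \<Phi> (\<lambda>y. h y *\<^sub>C f y) x = k x *\<^sub>C \<Phi> f x"
    and x: "x \<in> topspace X"
  shows "\<exists>y\<in>topspace X. \<forall>f\<in>C0 X. f y = 0 \<longrightarrow> \<Phi> f x = 0"
proof -
  have "\<exists>c. \<forall>f\<in>C0 X. \<Phi> (\<lambda>y. h y *\<^sub>C f y) x = c *\<^sub>C \<Phi> f x" if h: "h \<in> C0 X" for h
  proof -
    obtain k where "\<forall>f\<in>C0 X. \<forall>x\<in>topspace X. \<Phi> (\<lambda>y. h y *\<^sub>C f y) x = k x *\<^sub>C \<Phi> f x"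
      using mod[OF h] ..
    with x have "\<forall>f\<in>C0 X. \<Phi> (\<lambda>y. h y *\<^sub>C f y) x = k x *\<^sub>C \<Phi> f x" by simp
    then show ?thesis ..
  qed
  then have "\<forall>h\<in>C0 X. \<exists>c. \<forall>f\<in>C0 X. \<Phi> (\<lambda>y. h y *\<^sub>C f y) x = c *\<^sub>C \<Phi> f x" ..
  from bchoice[OF this] obtain \<kappa> where "\<forall>h\<in>C0 X. \<forall>f\<in>C0 X. \<Phi> (\<lambda>y. h y *\<^sub>C f y) x = \<kappa> h *\<^sub>C \<Phi> f x" ..
  then have \<kappa>: "\<Phi> (\<lambda>y. h y *\<^sub>C f y) x = \<kappa> h *\<^sub>C \<Phi> f x" if "h \<in> C0 X" "f \<in> C0 X" for h f
    using that by simp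
  obtain f1 :: "'x \<Rightarrow> 'h bop" where "f1 \<in> C0 X" "f1 x = id_bop"
    using C0_value[OF x] by metis
  then obtain f0 where f0: "f0 \<in> C0 X" "\<Phi> f0 x = id_bop"
    using \<Phi>(2) by (metis imageE)
  have ne: "\<Phi> f0 x \<noteq> 0"
    using norm_id_bop[OF z] f0(2) by auto
  \<comment> \<open>The factorisation of \<open>f0\<close> shows that \<open>\<kappa>\<close> is
    nonzero: \<open>\<kappa> h0 *\<^sub>C \<Phi> g x = \<Phi> f0 x\<close>.\<close>
  obtain h0 g where hg: "h0 \<in> C0 X" "g \<in> C0 X" "f0 = (\<lambda>x. h0 x *\<^sub>C g x)"
    using C0_factor[OF f0(1)] by metis
  have "\<exists>y\<in>topspace X. \<forall>h\<in>C0 X. h y = 0 \<longrightarrow> \<kappa> h = 0"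
  proof (rule character_kernel_point)
    fix h k :: "'x \<Rightarrow> complex"
    assume h: "h \<in> C0 X" and k: "k \<in> C0 X"
    have "(\<lambda>y. (h + k) y *\<^sub>C f0 y) = (\<lambda>y. h y *\<^sub>C f0 y) + (\<lambda>y. k y *\<^sub>C f0 y)"
      by (simp add: fun_eq_iff scaleC_add_left)
    then have "\<kappa> (h + k) *\<^sub>C \<Phi> f0 x = (\<kappa> h + \<kappa> k) *\<^sub>C \<Phi> f0 x"
      using \<kappa>[OF C0_add[OF h k] f0(1)] \<kappa>[OF h f0(1)] \<kappa>[OF k f0(1)]
        linear_maps_D(2)[OF \<Phi>(1) C0_scaleC_fun[OF h f0(1)] C0_scaleC_fun[OF k f0(1)]]
      by (simp only: plus_fun_apply scaleC_add_left)
    then show "\<kappa> (h + k) = \<kappa> h + \<kappa> k" by (rule scaleC_cancel_left[OF ne])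
    have "(\<lambda>y. (h * k) y *\<^sub>C f0 y) = (\<lambda>y. h y *\<^sub>C (k y *\<^sub>C f0 y))"
      by (simp add: fun_eq_iff scaleC_scaleC)
    then have "\<kappa> (h * k) *\<^sub>C \<Phi> f0 x = (\<kappa> h * \<kappa> k) *\<^sub>C \<Phi> f0 x"
      using \<kappa>[OF C0_times[OF h k] f0(1)] \<kappa>[OF h C0_scaleC_fun[OF k f0(1)]] \<kappa>[OF k f0(1)]
      by (simp only: scaleC_scaleC)
    then show "\<kappa> (h * k) = \<kappa> h * \<kappa> k" by (rule scaleC_cancel_left[OF ne])
  next
    fix c and h :: "'x \<Rightarrow> complex"
    assume h: "h \<in> C0 X"
    have "(\<lambda>y. (c * h y) *\<^sub>C f0 y) = c *\<^sub>C (\<lambda>y. h y *\<^sub>C f0 y)"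
      by (simp add: fun_eq_iff scaleC_scaleC)
    then have "\<kappa> (\<lambda>y. c * h y) *\<^sub>C \<Phi> f0 x = (c * \<kappa> h) *\<^sub>C \<Phi> f0 x"
      using \<kappa>[OF C0_complex_mult[OF h] f0(1), of c] \<kappa>[OF h f0(1)]
        linear_maps_D(3)[OF \<Phi>(1) C0_scaleC_fun[OF h f0(1)], of c]
      by (simp only: scaleC_scaleC scaleC_fun_apply)
    then show "\<kappa> (\<lambda>y. c * h y) = c * \<kappa> h" by (rule scaleC_cancel_left[OF ne])
  next
    show "h0 \<in> C0 X" "\<kappa> h0 \<noteq> 0"
      using hg(1) \<kappa>[OF hg(1,2)] ne unfolding hg(3)[symmetric] by auto
  qed
  then obtain y where y: "y \<in> topspace X" "\<And>h. h \<in> C0 X \<Longrightarrow> h y = 0 \<Longrightarrow> \<kappa> h = 0" by blast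
  have "\<Phi> f x = 0" if f: "f \<in> C0 X" "f y = 0" for f
  proof -
    obtain h g where hg: "h \<in> C0 X" "g \<in> C0 X" "f = (\<lambda>x. h x *\<^sub>C g x)" "h y = 0"
      using C0_factor[OF f(1)] f(2) by metis
    then show ?thesis
      using \<kappa>[OF hg(1,2)] y(2)[OF hg(1) hg(4)] by simp
  qed
  with y(1) show ?thesis by blast
qed

text \<open>As \<open>\<Phi> f x\<close> vanishes with \<open>f (\<phi> x)\<close>, it depends on
  that value only. So \<open>\<tau> x A\<close> can be read off from any function with value
  \<open>A\<close> at \<open>\<phi> x\<close>; a bump function times \<open>A\<close> makes it
  linear in \<open>A\<close>.\<close>

lemma module_map_form:
  fixes \<Phi> :: "('x \<Rightarrow> 'h::complex_hilbert bop) \<Rightarrow> 'x \<Rightarrow> 'h bop"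
  assumes \<Phi>: "\<Phi> \<in> linear_maps (C0 X)" "\<Phi> ` C0 X = C0 X"
    and z: "(z::'h) \<noteq> 0"
    and mod: "\<And>h. h \<in> C0 X \<Longrightarrow> \<exists>k. \<forall>f\<in>C0 X. \<forall>x\<in>topspace X. \<Phi> (\<lambda>y. h y *\<^sub>C f y) x = k x *\<^sub>C \<Phi> f x"
  obtains \<tau> \<phi> where "\<And>x. x \<in> topspace X \<Longrightarrow> \<phi> x \<in> topspace X"
    "\<And>x. x \<in> topspace X \<Longrightarrow> \<tau> x \<in> linear_maps UNIV"
    "\<And>x f. x \<in> topspace X \<Longrightarrow> f \<in> C0 X \<Longrightarrow> \<Phi> f x = \<tau> x (f (\<phi> x))"
proof -
  have "\<exists>y. x \<in> topspace X \<longrightarrow> y \<in> topspace X \<and> (\<forall>f\<in>C0 X. f y = 0 \<longrightarrow> \<Phi> f x = 0)" for x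
    using module_map_point[OF assms, of x] by blast
  then obtain \<phi> where \<phi>: "\<And>x. x \<in> topspace X \<Longrightarrow> \<phi> x \<in> topspace X"
    "\<And>x f. x \<in> topspace X \<Longrightarrow> f \<in> C0 X \<Longrightarrow> f (\<phi> x) = 0 \<Longrightarrow> \<Phi> f x = 0"
    by metis
  have "\<forall>y\<in>topspace X. \<exists>u :: 'x \<Rightarrow> complex. u \<in> C0 X \<and> u y = 1"
    by (blast intro: C0_bump[OF X openin_topspace])
  then obtain u :: "'x \<Rightarrow> 'x \<Rightarrow> complex" where
    u: "\<And>y. y \<in> topspace X \<Longrightarrow> u y \<in> C0 X" "\<And>y. y \<in> topspace X \<Longrightarrow> u y y = 1"
    by metis
  define \<tau> where "\<tau> x A = \<Phi> (\<lambda>y. u (\<phi> x) y *\<^sub>C A) x" for x A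
  show ?thesis
  proof
    fix x
    assume x: "x \<in> topspace X"
    show "\<phi> x \<in> topspace X" by (rule \<phi>(1)[OF x])
    have uA: "(\<lambda>y. u (\<phi> x) y *\<^sub>C A) \<in> C0 X" for A :: "'h bop"
      by (rule C0_scaleC_const[OF u(1)[OF \<phi>(1)[OF x]]])
    have eq: "(\<lambda>y. u (\<phi> x) y *\<^sub>C (A + B)) = (\<lambda>y. u (\<phi> x) y *\<^sub>C A) + (\<lambda>y. u (\<phi> x) y *\<^sub>C B)"
      "(\<lambda>y. u (\<phi> x) y *\<^sub>C (c *\<^sub>C A)) = c *\<^sub>C (\<lambda>y. u (\<phi> x) y *\<^sub>C A)" for A B :: "'h bop" and c
      by (auto simp: fun_eq_iff scaleC_add_right scaleC_scaleC mult.commute)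
    show "\<tau> x \<in> linear_maps UNIV"
    proof -
      have "\<tau> x (A + B) = \<tau> x A + \<tau> x B" "\<tau> x (c *\<^sub>C A) = c *\<^sub>C \<tau> x A" for A B c
        by (simp_all only: \<tau>_def eq linear_maps_D[OF \<Phi>(1)] uA plus_fun_apply scaleC_fun_apply)
      then show ?thesis by (simp add: linear_maps_def)
    qed
    fix f :: "'x \<Rightarrow> 'h bop"
    assume f: "f \<in> C0 X"
    let ?g = "f - (\<lambda>y. u (\<phi> x) y *\<^sub>C f (\<phi> x))"
    have "\<Phi> ?g x = 0"
      by (rule \<phi>(2)[OF x C0_diff[OF f uA]]) (simp add: u(2)[OF \<phi>(1)[OF x]] scaleC_one)
    then show "\<Phi> f x = \<tau> x (f (\<phi> x))"
      by (simp add: linear_maps_C0_diff[OF \<Phi>(1) f uA] \<tau>_def)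
  qed
qed

text \<open>Both \<open>\<Phi>\<close> and its inverse are of composition type. In the composite,
  separation of points forces the two point maps to be inverse to each other, and interpolation then
  does the same for the operator maps.\<close>

lemma module_isomorphism_form:
  fixes \<Phi> \<Psi> :: "('x \<Rightarrow> 'h::complex_hilbert bop) \<Rightarrow> 'x \<Rightarrow> 'h bop"
  assumes \<Phi>: "\<Phi> \<in> linear_maps (C0 X)" "\<Phi> ` C0 X = C0 X"
    and \<Psi>: "\<Psi> \<in> linear_maps (C0 X)" "\<Psi> ` C0 X = C0 X"
    and inv: "\<And>f. f \<in> C0 X \<Longrightarrow> \<Psi> (\<Phi> f) = f" "\<And>f. f \<in> C0 X \<Longrightarrow> \<Phi> (\<Psi> f) = f"
    and z: "(z::'h) \<noteq> 0"
    and mod: "\<And>h. h \<in> C0 X \<Longrightarrow> \<exists>k. \<forall>f\<in>C0 X. \<forall>x\<in>topspace X. \<Phi> (\<lambda>y. h y *\<^sub>C f y) x = k x *\<^sub>C \<Phi> f x"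
      "\<And>h. h \<in> C0 X \<Longrightarrow> \<exists>k. \<forall>f\<in>C0 X. \<forall>x\<in>topspace X. \<Psi> (\<lambda>y. h y *\<^sub>C f y) x = k x *\<^sub>C \<Psi> f x"
  shows "\<exists>\<tau> \<phi>. bij_betw \<phi> (topspace X) (topspace X) \<and> (\<forall>x\<in>topspace X. \<tau> x \<in> linear_maps UNIV \<and>
    bij (\<tau> x) \<and> (\<forall>f\<in>C0 X. \<Phi> f x = \<tau> x (f (\<phi> x))))"
proof -
  obtain \<tau> \<phi> where \<tau>: "\<And>x. x \<in> topspace X \<Longrightarrow> \<phi> x \<in> topspace X"
    "\<And>x. x \<in> topspace X \<Longrightarrow> \<tau> x \<in> linear_maps UNIV"
    "\<And>x f. x \<in> topspace X \<Longrightarrow> f \<in> C0 X \<Longrightarrow> \<Phi> f x = \<tau> x (f (\<phi> x))"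
    using module_map_form[OF \<Phi> z mod(1)] by metis
  obtain \<sigma> \<psi> where \<sigma>: "\<And>x. x \<in> topspace X \<Longrightarrow> \<psi> x \<in> topspace X"
    "\<And>x. x \<in> topspace X \<Longrightarrow> \<sigma> x \<in> linear_maps UNIV"
    "\<And>x f. x \<in> topspace X \<Longrightarrow> f \<in> C0 X \<Longrightarrow> \<Psi> f x = \<sigma> x (f (\<psi> x))"
    using module_map_form[OF \<Psi> z mod(2)] by metis
  have id_ne: "(id_bop :: 'h bop) \<noteq> 0"
    using norm_id_bop[OF z] by auto
  have comp: "q (p x) = x \<and> (\<forall>A. S x (T (p x) A) = A)"
    if x: "x \<in> topspace X" and ST: "S x 0 = 0" "T (p x) 0 = 0"
      and f: "\<And>f. f \<in> C0 X \<Longrightarrow> f x = S x (T (p x) (f (q (p x))))"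
    for x and p q :: "'x \<Rightarrow> 'x" and S T :: "'x \<Rightarrow> 'h bop \<Rightarrow> 'h bop"
  proof -
    have "q (p x) = x"
    proof (rule ccontr)
      assume "q (p x) \<noteq> x"
      then obtain g :: "'x \<Rightarrow> 'h bop" where "g \<in> C0 X" "g (q (p x)) = 0" "g x = id_bop"
        using C0_value[OF x, of id_bop] by metis
      with f[of g] ST id_ne show False by simp
    qed
    moreover have "S x (T (p x) A) = A" for A
    proof -
      obtain g :: "'x \<Rightarrow> 'h bop" where "g \<in> C0 X" "g x = A"
        using C0_value[OF x, of A] by metis
      with f[of g] \<open>q (p x) = x\<close> show ?thesis by simp
    qed
    ultimately show ?thesis by blast
  qed
  have 1: "\<phi> (\<psi> x) = x \<and> (\<forall>A. \<sigma> x (\<tau> (\<psi> x) A) = A)" if x: "x \<in> topspace X" for x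
  proof (rule comp[OF x])
    show "f x = \<sigma> x (\<tau> (\<psi> x) (f (\<phi> (\<psi> x))))" if "f \<in> C0 X" for f
      using \<sigma>(3)[OF x linear_maps_D(1)[OF \<Phi>(1) that]] \<tau>(3)[OF \<sigma>(1)[OF x] that] inv(1)[OF that]
      by simp
  qed (simp_all add: linear_maps_UNIV_D(3) \<sigma>(1,2) \<tau>(2) x)
  have 2: "\<psi> (\<phi> x) = x \<and> (\<forall>A. \<tau> x (\<sigma> (\<phi> x) A) = A)" if x: "x \<in> topspace X" for x
  proof (rule comp[OF x])
    show "f x = \<tau> x (\<sigma> (\<phi> x) (f (\<psi> (\<phi> x))))" if "f \<in> C0 X" for f
      using \<tau>(3)[OF x linear_maps_D(1)[OF \<Psi>(1) that]] \<sigma>(3)[OF \<tau>(1)[OF x] that] inv(2)[OF that]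
      by simp
  qed (simp_all add: linear_maps_UNIV_D(3) \<sigma>(2) \<tau>(1,2) x)
  have "bij_betw \<phi> (topspace X) (topspace X)"
    by (rule bij_betw_byWitness[of _ \<psi>]) (use 1 2 \<tau>(1) \<sigma>(1) in auto)
  moreover have "bij (\<tau> x)" if x: "x \<in> topspace X" for x
    by (rule o_bij[of "\<sigma> (\<phi> x)"]) (use 1[OF \<tau>(1)[OF x]] 2[OF x] in \<open>auto simp: fun_eq_iff\<close>)
  ultimately show ?thesis
    using \<tau>(2,3) by (intro exI[of _ \<tau>] exI[of _ \<phi>]) simp
qed

end

section \<open>M-bounded operators\<close>

text \<open>For large \<open>\<nu>\<close> the bound exceeds \<open>|\<nu>|\<close> only by an amount of order \<open>1 / |\<nu>|\<close>.\<close>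

lemma norm_add_rank_one_le:
  fixes A :: "'h::complex_hilbert bop"
  assumes v: "norm v = 1" and w: "norm w = 1" and A: "cinner (A \<cdot> w) v = 0"
  shows "norm (A + \<nu> *\<^sub>C rank_one v w) \<le> sqrt ((cmod \<nu>)\<^sup>2 + 2 * (norm A)\<^sup>2)"
proof (rule norm_bop_le)
  fix x
  define \<alpha> where "\<alpha> = cinner x w"
  define x' where "x' = x - \<alpha> *\<^sub>C w"
  define y where "y = (A + \<nu> *\<^sub>C rank_one v w) \<cdot> x"
  let ?a = "norm A" and ?R = "cmod \<nu>" and ?c = "cmod \<alpha>" and ?s = "norm x'"
  have norm_x: "(norm x)\<^sup>2 = ?c\<^sup>2 + ?s\<^sup>2"
    unfolding x'_def \<alpha>_def by (rule norm_squared_decompose[OF w])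
  have y: "y = A \<cdot> x + (\<nu> * \<alpha>) *\<^sub>C v"
    by (simp add: y_def \<alpha>_def scaleC_scaleC)
  have vv: "cinner v v = 1" using v by (simp add: cinner_norm)
  \<comment> \<open>Since \<open>A \<cdot> w\<close> is orthogonal to \<open>v\<close>, only the
    part \<open>x'\<close> orthogonal to \<open>w\<close> contributes through \<open>A\<close> to
    the coefficient of \<open>y\<close> at \<open>v\<close>.\<close>
  have "A \<cdot> x = A \<cdot> x' + \<alpha> *\<^sub>C (A \<cdot> w)"
    by (simp add: x'_def)
  then have yv: "cinner y v = cinner (A \<cdot> x') v + \<nu> * \<alpha>"
    by (simp add: y cinner_simps A vv)
  have "cmod (cinner y v) \<le> cmod (cinner (A \<cdot> x') v) + ?R * ?c"
    unfolding yv using norm_triangle_ineq by (rule order_trans) (simp add: norm_mult)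
  also have "cmod (cinner (A \<cdot> x') v) \<le> ?a * ?s"
    using cinner_unit_le[OF v] norm_bop_apply by (rule order_trans)
  finally have "cmod (cinner y v) \<le> ?a * ?s + ?R * ?c"
    by simp
  then have "(cmod (cinner y v))\<^sup>2 \<le> (?a * ?s + ?R * ?c)\<^sup>2"
    by (rule power_mono) simp
  \<comment> \<open>Cauchy-Schwarz in the plane; the difference of the two sides is
    \<open>(?R * ?s - ?a * ?c)\<^sup>2\<close>.\<close>
  also have "\<dots> \<le> (?R\<^sup>2 + ?a\<^sup>2) * (?c\<^sup>2 + ?s\<^sup>2)"
    using zero_le_power2[of "?R * ?s - ?a * ?c"] by (simp add: power2_eq_square algebra_simps)
  finally have 1: "(cmod (cinner y v))\<^sup>2 \<le> (?R\<^sup>2 + ?a\<^sup>2) * (norm x)\<^sup>2"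
    unfolding norm_x .
  \<comment> \<open>The rank one term acts along \<open>v\<close>, so the part of \<open>y\<close>
    orthogonal to \<open>v\<close> comes from \<open>A\<close> alone.\<close>
  have "y - cinner y v *\<^sub>C v = A \<cdot> x - cinner (A \<cdot> x) v *\<^sub>C v"
    by (simp add: y cinner_simps vv scaleC_add_left)
  then have "(norm (y - cinner y v *\<^sub>C v))\<^sup>2 \<le> (norm (A \<cdot> x))\<^sup>2"
    using norm_squared_decompose[OF v, of "A \<cdot> x"] by simp
  also have "\<dots> \<le> (?a * norm x)\<^sup>2"
    by (intro power_mono norm_bop_apply) simp
  finally have 2: "(norm (y - cinner y v *\<^sub>C v))\<^sup>2 \<le> ?a\<^sup>2 * (norm x)\<^sup>2"
    by (simp add: power_mult_distrib)
  have "(norm y)\<^sup>2 \<le> (?R\<^sup>2 + 2 * ?a\<^sup>2) * (norm x)\<^sup>2"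
    using 1 2 norm_squared_decompose[OF v, of y] by (simp add: algebra_simps)
  then have "norm y \<le> sqrt ((?R\<^sup>2 + 2 * ?a\<^sup>2) * (norm x)\<^sup>2)"
    by (rule real_le_rsqrt)
  then show "norm ((A + \<nu> *\<^sub>C rank_one v w) \<cdot> x) \<le> sqrt (?R\<^sup>2 + 2 * ?a\<^sup>2) * norm x"
    unfolding y_def[symmetric] by (simp add: real_sqrt_mult)
qed simp

text \<open>The residual \<open>r\<close> of projecting \<open>q\<close> to the line of
  \<open>p\<close> is orthogonal to \<open>p\<close>, hence by assumption to \<open>q\<close>, hence
  to itself. For \<open>p = 0\<close> the choice \<open>d = 0\<close> makes \<open>r = q\<close>,
  and the same argument applies.\<close>

lemma proportional_if_orthogonal:
  fixes p q :: "'a::complex_inner"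
  assumes "\<And>v. norm v = 1 \<Longrightarrow> cinner p v = 0 \<Longrightarrow> cinner q v = 0"
  shows "\<exists>d. q = d *\<^sub>C p"
proof -
  have orth: "cinner q r = 0" if "cinner p r = 0" for r
  proof (cases "r = 0")
    case False
    then obtain v where v: "norm v = 1" "r = complex_of_real (norm r) *\<^sub>C v"
      using ex_unit_vector by blast
    have "cinner p v = 0"
      using that False by (subst (asm) v(2)) (simp add: cinner_scaleC_right)
    from assms[OF v(1) this] show ?thesis
      by (subst v(2)) (simp add: cinner_scaleC_right)
  qed simp
  define d where "d = (if p = 0 then 0 else cinner q p / cinner p p)"
  define r where "r = q - d *\<^sub>C p"
  have rp: "cinner r p = 0"
    by (simp add: r_def d_def cinner_simps)
  have pr: "cinner p r = 0"
    using cinner_commute[of p r] rp by simp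
  have "cinner r r = cinner q r - d * cinner p r"
    by (subst r_def) (simp add: cinner_simps)
  then have "r = 0"
    using orth[OF pr] pr by simp
  then show ?thesis
    by (auto simp: r_def)
qed

text \<open>As \<open>R\<close> grows, \<open>sqrt (R\<^sup>2 + C) - R\<close> tends to 0, which
  leaves \<open>p \<le> p / 2\<close>. The term \<open>p / 2\<close> is the localisation error
  allowed in \<open>M_bounded_orthogonal\<close>.\<close>

lemma nonpos_if_add_le_sqrt:
  fixes p C R0 :: real
  assumes "\<And>R. R0 \<le> R \<Longrightarrow> p + R \<le> p / 2 + sqrt (R\<^sup>2 + C)" and "0 \<le> C"
  shows "p \<le> 0"
proof (rule ccontr)
  assume "\<not> p \<le> 0"
  then have p: "0 < p" by simp
  define R where "R = max \<bar>R0\<bar> ((C + 1) / p)"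
  have "(C + 1) / p \<le> R" "\<bar>R0\<bar> \<le> R"
    by (simp_all add: R_def)
  then have R: "0 \<le> R" "R0 \<le> R" "C + 1 \<le> p * R"
    using p by (auto simp: pos_divide_le_eq mult.commute)
  have "p / 2 + R \<le> sqrt (R\<^sup>2 + C)"
    using assms(1)[OF R(2)] by simp
  then have "(p / 2 + R)\<^sup>2 \<le> (sqrt (R\<^sup>2 + C))\<^sup>2"
    using p R(1) by (intro power_mono) auto
  then have "(p / 2)\<^sup>2 + p * R \<le> C"
    using assms(2) by (simp add: power2_sum)
  with R(3) zero_le_power2[of "p / 2"] show False by linarith
qed

text \<open>An operator \<open>T\<close> which maps \<open>f\<close> into every ball containing all \<open>\<mu> f\<close> with \<open>|\<mu>| \<le> l\<close> is
  M-bounded in the sense of Alfsen and Effros. Multiplication by a scalar function of modulus at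
  most \<open>l\<close> has this property, and the property is preserved by conjugation with surjective linear
  isometries. Testing it against large multiples of a localised rank one operator shows that
  such a \<open>T\<close> is a multiplication by a scalar function.\<close>

definition M_bounded :: "'x topology \<Rightarrow> real \<Rightarrow> (('x \<Rightarrow> 'h::complex_hilbert bop) \<Rightarrow> 'x \<Rightarrow> 'h bop) \<Rightarrow> bool"
  where "M_bounded X l T \<longleftrightarrow> T \<in> linear_maps (C0 X) \<and> (\<forall>f\<in>C0 X. \<forall>g\<in>C0 X. \<forall>r.
    (\<forall>\<mu>. cmod \<mu> \<le> l \<longrightarrow> sup_norm (\<mu> *\<^sub>C f - g) \<le> r) \<longrightarrow> sup_norm (T f - g) \<le> r)"

context
  fixes X :: "'x topology"
  assumes X: "locally_compact_space X" "Hausdorff_space X"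
begin

text \<open>The ball is centred at \<open>g\<close>, a large negative multiple of a bump function
  times \<open>rank_one v w\<close>. Because the coefficient of \<open>f x\<close> vanishes, all
  \<open>\<mu> f\<close> lie within \<open>p / 2 + sqrt (R\<^sup>2 + C)\<close> of \<open>g\<close>;
  the coefficient of \<open>T f - g\<close> at \<open>x\<close> has modulus \<open>p + R\<close>.
  Letting \<open>R\<close> grow forces \<open>p = 0\<close>.\<close>

lemma M_bounded_orthogonal:
  fixes T :: "('x \<Rightarrow> 'h::complex_hilbert bop) \<Rightarrow> 'x \<Rightarrow> 'h bop"
  assumes T: "M_bounded X l T" and l: "0 \<le> l"
    and x: "x \<in> topspace X" and f: "f \<in> C0 X"
    and v: "norm v = 1" and w: "norm w = 1" and orth: "cinner (f x \<cdot> w) v = 0"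
  shows "cinner (T f x \<cdot> w) v = 0"
proof -
  obtain B where B: "0 < B" "\<And>y. norm (f y) \<le> B" using C0_bounded[OF f] by blast
  define p where "p = cmod (cinner (T f x \<cdot> w) v)"
  \<comment> \<open>The phase of the coefficient. It is built into \<open>g\<close> so that the two
    contributions to \<open>T f - g\<close> add up without cancellation.\<close>
  define \<beta> where "\<beta> = (if p = 0 then 1 else cinner (T f x \<cdot> w) v / complex_of_real p)"
  have \<beta>: "cmod \<beta> = 1" "cinner (T f x \<cdot> w) v = \<beta> * complex_of_real p"
    by (auto simp: \<beta>_def p_def norm_divide)
  \<comment> \<open>On the support \<open>U\<close> of the bump, \<open>f\<close> varies by less
    than \<open>\<delta>\<close>, so \<open>\<mu> f\<close> varies by at most
    \<open>l * \<delta> \<le> p / 2\<close>; \<open>l + 1\<close> avoids a zero divisor. The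
    constant \<open>C\<close> is the error term of \<open>norm_add_rank_one_le\<close> for
    \<open>\<mu> *\<^sub>C f x\<close>.\<close>
  define \<delta> where "\<delta> = p / (2 * (l + 1))"
  define C where "C = 2 * (l * norm (f x))\<^sup>2"
  have "p \<le> 0"
  proof (rule ccontr)
    assume "\<not> p \<le> 0"
    then have \<delta>: "0 < \<delta>" "l * \<delta> \<le> p / 2"
      using l by (auto simp: \<delta>_def field_simps)
    define U where "U = {y \<in> topspace X. f y \<in> ball (f x) \<delta>}"
    have "openin X U"
      unfolding U_def by (rule openin_continuous_map_preimage[OF C0_continuous[OF f]]) simp
    moreover have "x \<in> U" using x \<delta> by (simp add: U_def)
    ultimately obtain u where u: "u \<in> C0 X" "u x = 1" "\<And>y. y \<notin> U \<Longrightarrow> u y = 0"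
        "\<And>y. \<exists>r\<in>{0..1}. u y = complex_of_real r"
      using C0_bump[OF X] by metis
    \<comment> \<open>The restriction \<open>l * B \<le> R\<close> handles the points outside
      \<open>U\<close>: there \<open>g\<close> vanishes and \<open>\<mu> f\<close> is at most
      \<open>l * B\<close> in norm.\<close>
    have "p + R \<le> p / 2 + sqrt (R\<^sup>2 + C)" if "l * B \<le> R" for R
    proof -
      have R: "0 \<le> R" using that l B(1) by (meson mult_nonneg_nonneg less_imp_le order_trans)
      define g where "g y = (- complex_of_real R * \<beta> * u y) *\<^sub>C rank_one v w" for y
      have g: "g \<in> C0 X"
        unfolding g_def by (intro C0_scaleC_const C0_complex_mult u(1))
      have "norm (\<mu> *\<^sub>C f y - g y) \<le> p / 2 + sqrt (R\<^sup>2 + C)" if \<mu>: "cmod \<mu> \<le> l" for \<mu> y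
      proof (cases "y \<in> U")
        case False
        have "norm (\<mu> *\<^sub>C f y) \<le> l * B"
          unfolding norm_scaleC_bop using \<mu> B l by (intro mult_mono) auto
        also have "\<dots> \<le> sqrt (R\<^sup>2 + C)"
          using \<open>l * B \<le> R\<close> by (rule order_trans) (simp add: C_def real_le_rsqrt)
        finally show ?thesis
          using False u(3) \<open>\<not> p \<le> 0\<close> by (simp add: g_def)
      next
        case True
        obtain t where t: "0 \<le> t" "t \<le> 1" "u y = complex_of_real t" using u(4)[of y] by auto
        define \<nu> where "\<nu> = complex_of_real R * \<beta> * u y"
        have \<nu>: "cmod \<nu> \<le> R"
          using t R by (simp add: \<nu>_def norm_mult \<beta>(1) mult_left_le)
        have "norm (\<mu> *\<^sub>C f x + \<nu> *\<^sub>C rank_one v w)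
            \<le> sqrt ((cmod \<nu>)\<^sup>2 + 2 * (norm (\<mu> *\<^sub>C f x))\<^sup>2)"
          using orth by (intro norm_add_rank_one_le v w) (simp add: cinner_simps)
        also have "\<dots> \<le> sqrt (R\<^sup>2 + C)"
          unfolding C_def norm_scaleC_bop using \<nu> \<mu>
          by (intro real_sqrt_le_mono add_mono mult_left_mono power_mono mult_right_mono) auto
        finally have 1: "norm (\<mu> *\<^sub>C f x + \<nu> *\<^sub>C rank_one v w) \<le> sqrt (R\<^sup>2 + C)" .
        have "norm (\<mu> *\<^sub>C (f y - f x)) \<le> l * \<delta>"
          unfolding norm_scaleC_bop using \<mu> l True
          by (intro mult_mono) (auto simp: U_def dist_norm norm_minus_commute)
        then have 2: "norm (\<mu> *\<^sub>C (f y - f x)) \<le> p / 2" using \<delta>(2) by simp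
        have "\<mu> *\<^sub>C f y - g y = \<mu> *\<^sub>C (f y - f x) + (\<mu> *\<^sub>C f x + \<nu> *\<^sub>C rank_one v w)"
          by (simp add: g_def \<nu>_def scaleC_diff_right scaleC_minus_left)
        then show ?thesis
          using norm_triangle_ineq[of "\<mu> *\<^sub>C (f y - f x)" "\<mu> *\<^sub>C f x + \<nu> *\<^sub>C rank_one v w"] 1 2
          by simp
      qed
      then have "sup_norm (\<mu> *\<^sub>C f - g) \<le> p / 2 + sqrt (R\<^sup>2 + C)" if "cmod \<mu> \<le> l" for \<mu>
        using that by (intro sup_norm_le) simp
      then have "sup_norm (T f - g) \<le> p / 2 + sqrt (R\<^sup>2 + C)"
        using T f g unfolding M_bounded_def by blast
      moreover have "T f \<in> C0 X"
        using T f by (auto simp: M_bounded_def linear_maps_def)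
      then have "norm ((T f - g) x) \<le> sup_norm (T f - g)"
        by (intro norm_le_sup_norm[of _ X] C0_diff g)
      moreover have eq: "p + R = cmod (cinner ((T f - g) x \<cdot> w) v)"
      proof -
        have "cinner ((T f - g) x \<cdot> w) v = \<beta> * complex_of_real (p + R)"
          using v w by (simp add: g_def u(2) cinner_simps cinner_norm \<beta>(2) scaleC_scaleC algebra_simps)
        then show ?thesis
          using R \<open>\<not> p \<le> 0\<close> by (simp add: norm_mult \<beta>(1) del: of_real_add)
      qed
      moreover have "cmod (cinner ((T f - g) x \<cdot> w) v) \<le> norm ((T f - g) x)"
        by (rule cmod_cinner_bop_le[OF v w])
      ultimately show ?thesis by linarith
    qed
    then have "p \<le> 0"
      by (rule nonpos_if_add_le_sqrt) (simp_all add: C_def)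
    with \<open>\<not> p \<le> 0\<close> show False by simp
  qed
  then show ?thesis by (simp add: p_def)
qed

text \<open>Preservation of vanishing coefficients makes \<open>T f x \<cdot> w\<close> a multiple
  of \<open>f x \<cdot> w\<close>. The factor is shown to be independent first of \<open>f\<close>,
  with \<open>w\<close> fixed, and then of \<open>w\<close>.\<close>

lemma M_bounded_imp_multiplication:
  fixes T :: "('x \<Rightarrow> 'h::complex_hilbert bop) \<Rightarrow> 'x \<Rightarrow> 'h bop"
  assumes T: "M_bounded X l T" and l: "0 \<le> l" and x: "x \<in> topspace X"
  shows "\<exists>k. \<forall>f\<in>C0 X. T f x = k *\<^sub>C f x"
proof -
  have lin: "T \<in> linear_maps (C0 X)" using T by (simp add: M_bounded_def)
  have proportional: "\<exists>d. T f x \<cdot> w = d *\<^sub>C (f x \<cdot> w)" if "f \<in> C0 X" "norm w = 1" for f w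
    by (rule proportional_if_orthogonal) (rule M_bounded_orthogonal[OF T l x that(1) _ that(2)])
  obtain u :: "'x \<Rightarrow> complex" where u: "u \<in> C0 X" "u x = 1"
    using C0_bump[OF X openin_topspace x] by metis
  define I where "I A = (\<lambda>y. u y *\<^sub>C A)" for A :: "'h bop"
  have I: "I A \<in> C0 X" "I A x = A" "I (A + B) = I A + I B" "I (c *\<^sub>C A) = c *\<^sub>C I A" for A B c
    using u by (auto simp: I_def C0_scaleC_const scaleC_one fun_eq_iff scaleC_add_right scaleC_scaleC
        mult.commute)
  \<comment> \<open>Feeding in rank one operators \<open>rank_one p w\<close> makes the value at
    \<open>w\<close> an arbitrary vector \<open>p\<close>, and the result is a linear map in
    \<open>p\<close> that preserves lines, hence a scalar.\<close>
  have cw: "\<exists>c. \<forall>f\<in>C0 X. T f x \<cdot> w = c *\<^sub>C (f x \<cdot> w)" if w: "norm w = 1" for w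
  proof -
    have ww: "cinner w w = 1" using w by (simp add: cinner_norm)
    have rank: "rank_one (p + q) w = rank_one p w + rank_one q w"
      "rank_one (c *\<^sub>C p) w = c *\<^sub>C rank_one p w" for p q c
      by (auto intro!: bop_eqI simp: scaleC_add_right scaleC_scaleC mult.commute)
    have "\<exists>c. \<forall>p. T (I (rank_one p w)) x \<cdot> w = c *\<^sub>C p"
    proof (rule line_preserving_imp_scalar)
      show "\<exists>d. T (I (rank_one p w)) x \<cdot> w = d *\<^sub>C p" for p
        using proportional[OF I(1) w, of "rank_one p w"] by (simp add: I(2) ww scaleC_one)
    qed (simp_all add: rank I linear_maps_D[OF lin])
    then obtain c where c: "\<And>p. T (I (rank_one p w)) x \<cdot> w = c *\<^sub>C p" by blast
    have "T f x \<cdot> w = c *\<^sub>C (f x \<cdot> w)" if f: "f \<in> C0 X" for f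
    proof -
      let ?g = "I (rank_one (f x \<cdot> w) w)"
      \<comment> \<open>At \<open>x\<close> the difference \<open>f - ?g\<close> kills
        \<open>w\<close>, so by proportionality its image does too: \<open>f\<close> may be replaced
        by \<open>?g\<close>.\<close>
      obtain d where "T (f - ?g) x \<cdot> w = d *\<^sub>C ((f - ?g) x \<cdot> w)"
        using proportional[OF C0_diff[OF f I(1)] w] by blast
      then have "T f x \<cdot> w = T ?g x \<cdot> w"
        by (simp add: linear_maps_C0_diff[OF lin f I(1)] I(2) ww scaleC_one)
      then show ?thesis by (simp only: c)
    qed
    then show ?thesis by blast
  qed
  \<comment> \<open>The function with value \<open>id_bop\<close> at \<open>x\<close> compares
    different \<open>w\<close>: its image is a line preserving operator, so the factors belonging to
    all \<open>w\<close> coincide.\<close>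
  have "\<exists>c. \<forall>p. T (I id_bop) x \<cdot> p = c *\<^sub>C p"
  proof (rule line_preserving_imp_scalar)
    fix p :: 'h
    show "\<exists>d. T (I id_bop) x \<cdot> p = d *\<^sub>C p"
    proof (cases "p = 0")
      case False
      then obtain w where w: "norm w = 1" "p = complex_of_real (norm p) *\<^sub>C w"
        using ex_unit_vector by blast
      obtain c where c: "\<forall>f\<in>C0 X. T f x \<cdot> w = c *\<^sub>C (f x \<cdot> w)" using cw[OF w(1)] ..
      have "T (I id_bop) x \<cdot> p = complex_of_real (norm p) *\<^sub>C (T (I id_bop) x \<cdot> w)"
        by (subst w(2)) simp
      also have "\<dots> = c *\<^sub>C (complex_of_real (norm p) *\<^sub>C w)"
        using c I(1)[of id_bop] by (simp add: I(2) scaleC_scaleC mult.commute)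
      finally show ?thesis unfolding w(2)[symmetric] ..
    qed simp
  qed simp_all
  then obtain c where c: "\<And>p. T (I id_bop) x \<cdot> p = c *\<^sub>C p" by blast
  have unit: "T f x \<cdot> w = c *\<^sub>C (f x \<cdot> w)" if f: "f \<in> C0 X" and w: "norm w = 1" for f w
  proof -
    obtain d where d: "\<forall>f\<in>C0 X. T f x \<cdot> w = d *\<^sub>C (f x \<cdot> w)" using cw[OF w] ..
    have "d *\<^sub>C w = c *\<^sub>C w"
      using d I(1)[of id_bop] c[of w] by (simp add: I(2))
    then have "d = c"
      by (rule scaleC_cancel_left[rotated]) (use w in auto)
    with d f show ?thesis by simp
  qed
  have "T f x = c *\<^sub>C f x" if f: "f \<in> C0 X" for f
  proof (rule bop_eqI)
    fix p
    show "T f x \<cdot> p = (c *\<^sub>C f x) \<cdot> p"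
    proof (cases "p = 0")
      case False
      then obtain w where w: "norm w = 1" "p = complex_of_real (norm p) *\<^sub>C w"
        using ex_unit_vector by blast
      have "T f x \<cdot> p = complex_of_real (norm p) *\<^sub>C (T f x \<cdot> w)"
        by (subst w(2)) simp
      also have "\<dots> = (c *\<^sub>C f x) \<cdot> (complex_of_real (norm p) *\<^sub>C w)"
        by (simp add: unit[OF f w(1)] scaleC_scaleC mult.commute)
      finally show ?thesis unfolding w(2)[symmetric] .
    qed simp
  qed
  then show ?thesis by blast
qed

end

section \<open>Maps of composition type\<close>

text \<open>Uniform boundedness of the seminorms \<open>norm (\<Phi> f x)\<close> in
  \<open>f\<close>, indexed by \<open>x\<close>: each is bounded because \<open>\<tau> x\<close> is,
  and for fixed \<open>f\<close> they are bounded because \<open>\<Phi> f\<close> is in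
  \<open>C0 X\<close>. Interpolating functions with \<open>sup_norm f \<le> norm A\<close> bring the
  bound back to \<open>\<tau> x\<close>. Outside the space the seminorms are zero.\<close>

lemma C0_form_uniform_bound:
  fixes \<Phi> :: "('x \<Rightarrow> 'h::complex_hilbert bop) \<Rightarrow> 'x \<Rightarrow> 'h bop"
  assumes X: "locally_compact_space X" "Hausdorff_space X"
    and \<Phi>: "\<Phi> \<in> linear_maps (C0 X)"
    and \<phi>: "\<And>x. x \<in> topspace X \<Longrightarrow> \<phi> x \<in> topspace X"
    and form: "\<And>x f. x \<in> topspace X \<Longrightarrow> f \<in> C0 X \<Longrightarrow> \<Phi> f x = \<tau> x (f (\<phi> x))"
    and bounded: "\<And>x. x \<in> topspace X \<Longrightarrow> \<exists>M. \<forall>A. norm (\<tau> x A) \<le> M * norm A"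
  shows "\<exists>M\<ge>0. \<forall>x\<in>topspace X. \<forall>A. norm (\<tau> x A) \<le> M * norm A"
proof -
  have \<Phi>_C0: "\<Phi> f \<in> C0 X" if "f \<in> C0 X" for f
    by (rule linear_maps_D(1)[OF \<Phi> that])
  have nonneg: "0 \<le> sup_norm f" if "f \<in> C0 X" for f :: "'x \<Rightarrow> 'h bop"
    using norm_le_sup_norm[OF that, of undefined] norm_ge_zero by (rule order_trans[rotated])
  have "\<exists>C\<ge>0. \<forall>x. \<forall>f\<in>C0 X. norm (\<Phi> f x) \<le> C * sup_norm f"
  proof (rule uniform_boundedness)
    fix f g :: "'x \<Rightarrow> 'h bop"
    assume f: "f \<in> C0 X" and g: "g \<in> C0 X"
    show "f + g \<in> C0 X" by (rule C0_add[OF f g])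
    show "sup_norm (f + g) \<le> sup_norm f + sup_norm g"
      by (rule sup_norm_le)
        (auto intro!: norm_triangle_le add_mono norm_le_sup_norm[OF f] norm_le_sup_norm[OF g])
    show "norm (\<Phi> (f + g) x) \<le> norm (\<Phi> f x) + norm (\<Phi> g x)" for x
      by (simp add: linear_maps_D(2)[OF \<Phi> f g] norm_triangle_ineq)
  next
    fix c and f :: "'x \<Rightarrow> 'h bop"
    assume f: "f \<in> C0 X"
    show "c *\<^sub>C f \<in> C0 X" by (rule C0_scaleC[OF f])
    have le: "sup_norm (d *\<^sub>C g) \<le> cmod d * sup_norm g" if "g \<in> C0 X" for d and g :: "'x \<Rightarrow> 'h bop"
      by (rule sup_norm_le) (auto intro!: mult_left_mono norm_le_sup_norm[OF that])
    show "sup_norm (c *\<^sub>C f) = cmod c * sup_norm f"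
    proof (cases "c = 0")
      case True
      then show ?thesis using le[OF f, of 0] nonneg[OF C0_zero] by (simp add: antisym)
    next
      case False
      have "sup_norm (inverse c *\<^sub>C (c *\<^sub>C f)) \<le> cmod (inverse c) * sup_norm (c *\<^sub>C f)"
        by (rule le[OF C0_scaleC[OF f]])
      then have "cmod c * sup_norm f \<le> sup_norm (c *\<^sub>C f)"
        using False by (simp add: scaleC_scaleC scaleC_one norm_inverse norm_divide field_simps)
      with le[OF f, of c] show ?thesis by (rule antisym)
    qed
    show "norm (\<Phi> (c *\<^sub>C f) x) = cmod c * norm (\<Phi> f x)" for x
      by (simp add: linear_maps_D(3)[OF \<Phi> f])
    show "\<exists>C. \<forall>x. norm (\<Phi> f x) \<le> C"
      using norm_le_sup_norm[OF \<Phi>_C0[OF f]] by blast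
  next
    fix s :: "nat \<Rightarrow> 'x \<Rightarrow> 'h bop" and b :: "nat \<Rightarrow> real"
    assume "range s \<subseteq> C0 X" "\<And>m n. n \<le> m \<Longrightarrow> sup_norm (s m - s n) \<le> b n" "b \<longlonglongrightarrow> 0"
    then show "\<exists>v\<in>C0 X. \<forall>n. sup_norm (v - s n) \<le> b n" by (rule C0_complete)
  next
    fix x
    show "\<exists>B. \<forall>f\<in>C0 X. norm (\<Phi> f x) \<le> B * sup_norm f"
    proof (cases "x \<in> topspace X")
      case True
      then obtain M where M: "\<And>A. norm (\<tau> x A) \<le> M * norm A" using bounded by blast
      have "norm (\<Phi> f x) \<le> \<bar>M\<bar> * sup_norm f" if f: "f \<in> C0 X" for f
      proof -
        have "norm (\<Phi> f x) \<le> M * norm (f (\<phi> x))" using M form[OF True f] by simp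
        also have "\<dots> \<le> \<bar>M\<bar> * norm (f (\<phi> x))" by (intro mult_right_mono) auto
        also have "\<dots> \<le> \<bar>M\<bar> * sup_norm f" by (intro mult_left_mono norm_le_sup_norm[OF f]) simp
        finally show ?thesis .
      qed
      then show ?thesis by blast
    next
      case False
      then have "norm (\<Phi> f x) \<le> 0 * sup_norm f" if "f \<in> C0 X" for f
        using C0_outside[OF \<Phi>_C0[OF that] False] by simp
      then show ?thesis by blast
    qed
  qed (rule C0_zero)
  then obtain C where C: "0 \<le> C" "\<And>x f. f \<in> C0 X \<Longrightarrow> norm (\<Phi> f x) \<le> C * sup_norm f" by blast
  have "norm (\<tau> x A) \<le> C * norm A" if x: "x \<in> topspace X" for x A
  proof -
    obtain f where f: "f \<in> C0 X" "f (\<phi> x) = A" "sup_norm f \<le> norm A"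
      using C0_value[OF X \<phi>[OF x], of A] by metis
    have "norm (\<tau> x A) \<le> C * sup_norm f"
      using C(2)[OF f(1), of x] form[OF x f(1)] f(2) by simp
    also have "\<dots> \<le> C * norm A"
      by (rule mult_left_mono[OF f(3) C(1)])
    finally show ?thesis .
  qed
  with C(1) show ?thesis by blast
qed

text \<open>The normalisation \<open>\<parallel>\<tau> x 1\<parallel> = 1\<close>, shared by automorphisms and isometries, makes \<open>|u (\<phi> x)|\<close> the norm of
  \<open>\<Phi> (u 1) x\<close>; this gives continuity and properness of \<open>\<phi>\<close>.\<close>

locale C0_form =
  fixes X :: "'x topology" and \<Phi> :: "('x \<Rightarrow> 'h::complex_hilbert bop) \<Rightarrow> 'x \<Rightarrow> 'h bop"
    and \<tau> :: "'x \<Rightarrow> 'h bop \<Rightarrow> 'h bop" and \<phi> :: "'x \<Rightarrow> 'x" and M :: real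
  assumes X: "locally_compact_space X" "Hausdorff_space X"
    and \<Phi>_C0: "f \<in> C0 X \<Longrightarrow> \<Phi> f \<in> C0 X"
    and \<phi>: "bij_betw \<phi> (topspace X) (topspace X)"
    and form: "x \<in> topspace X \<Longrightarrow> f \<in> C0 X \<Longrightarrow> \<Phi> f x = \<tau> x (f (\<phi> x))"
    and \<tau>: "x \<in> topspace X \<Longrightarrow> \<tau> x \<in> linear_maps UNIV" "x \<in> topspace X \<Longrightarrow> bij (\<tau> x)"
    and \<tau>_id: "x \<in> topspace X \<Longrightarrow> norm (\<tau> x id_bop) = 1"
    and upper: "x \<in> topspace X \<Longrightarrow> norm (\<tau> x A) \<le> M * norm A"
    and lower: "x \<in> topspace X \<Longrightarrow> norm A \<le> M * norm (\<tau> x A)"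
    and M: "0 \<le> M"
begin

lemma \<phi>_in: "x \<in> topspace X \<Longrightarrow> \<phi> x \<in> topspace X"
  using \<phi> by (auto simp: bij_betw_def)

lemma norm_scalar:
  assumes u: "u \<in> C0 X" and x: "x \<in> topspace X"
  shows "norm (\<Phi> (\<lambda>y. u y *\<^sub>C id_bop) x) = cmod (u (\<phi> x))"
  by (simp add: form[OF x C0_scaleC_const[OF u]] linear_maps_UNIV_D(2)[OF \<tau>(1)[OF x]] \<tau>_id[OF x])

text \<open>For a bump function \<open>u\<close> at \<open>\<phi> x0\<close> supported in
  \<open>W\<close>, the condition \<open>cmod (u (\<phi> x)) > 1/2\<close> is an open condition on
  \<open>x\<close>, being one on the norm of \<open>\<Phi> (u 1) x\<close>; it forces
  \<open>\<phi> x\<close> into \<open>W\<close>.\<close>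

lemma continuous_map_\<phi>: "continuous_map X X \<phi>"
  unfolding continuous_map_def
proof (intro conjI allI impI)
  show "\<phi> \<in> topspace X \<rightarrow> topspace X" using \<phi>_in by blast
  fix W
  assume W: "openin X W"
  show "openin X {x \<in> topspace X. \<phi> x \<in> W}"
  proof (subst openin_subopen, intro ballI)
    fix x0
    assume x0: "x0 \<in> {x \<in> topspace X. \<phi> x \<in> W}"
    then obtain u :: "'x \<Rightarrow> complex" where u: "u \<in> C0 X" "u (\<phi> x0) = 1" "\<And>y. y \<notin> W \<Longrightarrow> u y = 0"
      using C0_bump[OF X W, of "\<phi> x0"] by (metis (mono_tags, lifting) mem_Collect_eq)
    let ?f = "\<Phi> (\<lambda>y. u y *\<^sub>C id_bop)"
    have "openin X {x \<in> topspace X. ?f x \<in> - cball 0 (1/2)}"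
      by (rule openin_continuous_map_preimage[OF C0_continuous[OF \<Phi>_C0[OF C0_scaleC_const[OF u(1)]]]])
        (simp flip: closed_def)
    moreover have "x0 \<in> {x \<in> topspace X. ?f x \<in> - cball 0 (1/2)}"
      using x0 norm_scalar[OF u(1), of x0] u(2) by simp
    moreover have "{x \<in> topspace X. ?f x \<in> - cball 0 (1/2)} \<subseteq> {x \<in> topspace X. \<phi> x \<in> W}"
      using norm_scalar[OF u(1)] u(3) by fastforce
    ultimately show "\<exists>T. openin X T \<and> x0 \<in> T \<and> T \<subseteq> {x \<in> topspace X. \<phi> x \<in> W}" by blast
  qed
qed

lemma open_map_\<phi>: "open_map X X \<phi>"
  unfolding open_map_def
proof (intro allI impI)
  fix U
  assume U: "openin X U"
  show "openin X (\<phi> ` U)"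
  proof (subst openin_subopen, intro ballI)
    fix y0
    assume "y0 \<in> \<phi> ` U"
    then obtain x0 where x0: "x0 \<in> U" "y0 = \<phi> x0" by blast
    then have x0X: "x0 \<in> topspace X" using U openin_subset by blast
    obtain u :: "'x \<Rightarrow> complex" where u: "u \<in> C0 X" "u y0 = 1"
      using C0_bump[OF X openin_topspace \<phi>_in[OF x0X]] x0(2) by metis
    let ?f = "\<Phi> (\<lambda>y. u y *\<^sub>C id_bop)"
    obtain K where K: "compactin X K" "\<And>x. x \<in> topspace X - K \<Longrightarrow> norm (?f x) < 1/2"
      using C0_vanish[OF \<Phi>_C0[OF C0_scaleC_const[OF u(1), of id_bop]], of "1/2"] by auto
    have "K - U = (topspace X - U) \<inter> K"
      using compactin_subset_topspace[OF K(1)] by blast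
    then have "compactin X (K - U)"
      using closed_Int_compactin[OF openin_closedin_eq[THEN iffD1, OF U, THEN conjunct2] K(1)] by simp
    then have "compactin X (\<phi> ` (K - U))"
      by (rule image_compactin[OF _ continuous_map_\<phi>])
    then have "closedin X (\<phi> ` (K - U))"
      by (rule compactin_imp_closedin[OF X(2)])
    moreover have "openin X {y \<in> topspace X. u y \<in> - cball 0 (1/2)}"
      by (rule openin_continuous_map_preimage[OF C0_continuous[OF u(1)]]) (simp flip: closed_def)
    ultimately have "openin X ({y \<in> topspace X. u y \<in> - cball 0 (1/2)} - \<phi> ` (K - U))"
      by (rule openin_diff[rotated])
    moreover have "y0 \<notin> \<phi> ` (K - U)"
    proof
      assume "y0 \<in> \<phi> ` (K - U)"
      then obtain x where "x \<in> K" "x \<notin> U" "\<phi> x = \<phi> x0" using x0(2) by auto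
      moreover have "x \<in> topspace X" using \<open>x \<in> K\<close> compactin_subset_topspace[OF K(1)] by blast
      ultimately have "x = x0"
        using \<phi> x0X by (metis bij_betw_def inj_onD)
      with x0(1) \<open>x \<notin> U\<close> show False by simp
    qed
    then have "y0 \<in> {y \<in> topspace X. u y \<in> - cball 0 (1/2)} - \<phi> ` (K - U)"
      using u(2) \<phi>_in[OF x0X] x0(2) by simp
    moreover have "{y \<in> topspace X. u y \<in> - cball 0 (1/2)} - \<phi> ` (K - U) \<subseteq> \<phi> ` U"
    proof
      fix y
      assume y: "y \<in> {y \<in> topspace X. u y \<in> - cball 0 (1/2)} - \<phi> ` (K - U)"
      then obtain x where x: "x \<in> topspace X" "y = \<phi> x"
        using \<phi> by (auto simp: bij_betw_def)
      have "x \<in> K"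
        using K(2)[of x] x y norm_scalar[OF u(1) x(1)] by auto
      with x y show "y \<in> \<phi> ` U" by blast
    qed
    ultimately show "\<exists>T. openin X T \<and> y0 \<in> T \<and> T \<subseteq> \<phi> ` U" by blast
  qed
qed

lemma homeomorphic_map_\<phi>: "homeomorphic_map X X \<phi>"
  using \<phi> by (intro bijective_open_imp_homeomorphic_map continuous_map_\<phi> open_map_\<phi>)
    (auto simp: bij_betw_def)

text \<open>Near \<open>x0\<close> the scalar \<open>u (\<phi> x)\<close> is nonzero, and
  \<open>\<tau> x A\<close> is the quotient of the continuous function \<open>\<Phi> (u A)\<close>
  by it.\<close>

lemma continuous_map_\<tau>: "continuous_map X euclidean (\<lambda>x. \<tau> x A)"
  unfolding continuous_map_euclidean_iff_tendsto
proof
  fix x0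
  assume x0: "x0 \<in> topspace X"
  obtain u :: "'x \<Rightarrow> complex" where u: "u \<in> C0 X" "u (\<phi> x0) = 1"
    using C0_bump[OF X openin_topspace \<phi>_in[OF x0]] by metis
  let ?f = "\<Phi> (\<lambda>y. u y *\<^sub>C A)"
  have f: "?f x = u (\<phi> x) *\<^sub>C \<tau> x A" if "x \<in> topspace X" for x
    by (simp add: form[OF that C0_scaleC_const[OF u(1)]] linear_maps_UNIV_D(2)[OF \<tau>(1)[OF that]])
  have "continuous_map X euclidean (u \<circ> \<phi>)"
    by (rule continuous_map_compose[OF continuous_map_\<phi> C0_continuous[OF u(1)]])
  then have lim_u: "((\<lambda>x. u (\<phi> x)) \<longlongrightarrow> 1) (atin X x0)"
    using x0 u(2) unfolding continuous_map_euclidean_iff_tendsto by (auto simp: comp_def)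
  have "((\<lambda>x. inverse (u (\<phi> x)) *\<^sub>C ?f x) \<longlongrightarrow> inverse 1 *\<^sub>C ?f x0) (atin X x0)"
    by (intro tendsto_scaleC_bop tendsto_inverse lim_u C0_tendsto[OF \<Phi>_C0[OF C0_scaleC_const[OF u(1)]] x0])
      simp
  moreover have "inverse 1 *\<^sub>C ?f x0 = \<tau> x0 A"
    by (simp add: f[OF x0] u(2) scaleC_one)
  moreover have "\<forall>\<^sub>F x in atin X x0. inverse (u (\<phi> x)) *\<^sub>C ?f x = \<tau> x A"
  proof -
    have "\<forall>\<^sub>F x in atin X x0. u (\<phi> x) \<noteq> 0"
      using lim_u by (rule tendsto_imp_eventually_ne) simp
    moreover have "\<forall>\<^sub>F x in atin X x0. x \<in> topspace X"
      using x0 by (auto simp: eventually_atin intro!: exI[of _ "topspace X"])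
    ultimately show ?thesis
      by eventually_elim (simp add: f scaleC_scaleC scaleC_one)
  qed
  ultimately show "((\<lambda>x. \<tau> x A) \<longlongrightarrow> \<tau> x0 A) (atin X x0)"
    by (auto intro: Lim_transform_eventually)
qed

lemma \<tau>_inv: "x \<in> topspace X \<Longrightarrow> \<tau> x (inv (\<tau> x) A) = A"
  using \<tau>(2) by (simp add: bij_is_surj surj_f_inv_f)

lemma norm_inv_\<tau>: "x \<in> topspace X \<Longrightarrow> norm (inv (\<tau> x) A) \<le> M * norm A"
  using lower[of x "inv (\<tau> x) A"] by (simp add: \<tau>_inv)

lemma inv_\<tau>_linear: "x \<in> topspace X \<Longrightarrow> inv (\<tau> x) \<in> linear_maps UNIV"
  by (intro linear_maps_inv \<tau>)

text \<open>With \<open>B\<close> the proposed limit, the error is \<open>inv (\<tau> x)\<close>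
  applied to \<open>g x - \<tau> x B\<close>, which tends to 0; the bound \<open>M\<close> on the
  inverses is uniform in \<open>x\<close>. Constant \<open>g\<close> gives strong continuity of the
  inverses, variable \<open>g\<close> the continuity of preimages under
  \<open>\<Phi>\<close>.\<close>

lemma tendsto_inv_\<tau>:
  assumes x0: "x0 \<in> topspace X" and g: "(g \<longlongrightarrow> g x0) (atin X x0)"
  shows "((\<lambda>x. inv (\<tau> x) (g x)) \<longlongrightarrow> inv (\<tau> x0) (g x0)) (atin X x0)"
proof -
  define B where "B = inv (\<tau> x0) (g x0)"
  have "((\<lambda>x. \<tau> x B) \<longlongrightarrow> \<tau> x0 B) (atin X x0)"
    using continuous_map_\<tau> x0 unfolding continuous_map_euclidean_iff_tendsto by blast
  then have "((\<lambda>x. M * norm (g x - \<tau> x B)) \<longlongrightarrow> M * norm (g x0 - \<tau> x0 B)) (atin X x0)"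
    by (intro tendsto_intros g)
  then have lim: "((\<lambda>x. M * norm (g x - \<tau> x B)) \<longlongrightarrow> 0) (atin X x0)"
    by (simp add: B_def \<tau>_inv[OF x0])
  have le: "norm (inv (\<tau> x) (g x) - B) \<le> M * norm (g x - \<tau> x B)" if x: "x \<in> topspace X" for x
  proof -
    have "inv (\<tau> x) (g x - \<tau> x B) = inv (\<tau> x) (g x) - B"
      using \<tau>(2)[OF x] by (simp add: linear_maps_UNIV_D(5)[OF inv_\<tau>_linear[OF x]] bij_is_inj)
    then show ?thesis using norm_inv_\<tau>[OF x, of "g x - \<tau> x B"] by simp
  qed
  have "\<forall>\<^sub>F x in atin X x0. norm (inv (\<tau> x) (g x) - B) \<le> M * norm (g x - \<tau> x B)"
    using x0 le by (auto simp: eventually_atin intro!: exI[of _ "topspace X"])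
  from Lim_null_comparison[OF this lim] show ?thesis
    unfolding B_def[symmetric] by (subst Lim_null)
qed

lemma strongly_continuous_\<tau>: "strongly_continuous X \<tau>"
  unfolding strongly_continuous_def
proof (intro conjI ballI allI continuous_map_\<tau>)
  fix x
  assume x: "x \<in> topspace X"
  show "bounded_linear (\<tau> x)"
    using upper[OF x]
    by (intro bounded_linear_intro[of _ M])
      (simp_all add: linear_maps_UNIV_D[OF \<tau>(1)[OF x]] scaleR_scaleC mult.commute)
qed (rule \<tau>(1))

lemma strongly_continuous_inv_\<tau>: "strongly_continuous X (\<lambda>x. inv (\<tau> x))"
  unfolding strongly_continuous_def continuous_map_euclidean_iff_tendsto
proof (intro conjI ballI allI)
  fix x
  assume x: "x \<in> topspace X"
  show "inv (\<tau> x) \<in> linear_maps UNIV" by (rule inv_\<tau>_linear[OF x])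
  show "bounded_linear (inv (\<tau> x))"
    using norm_inv_\<tau>[OF x]
    by (intro bounded_linear_intro[of _ M])
      (simp_all add: linear_maps_UNIV_D[OF inv_\<tau>_linear[OF x]] scaleR_scaleC mult.commute)
  show "((\<lambda>x. inv (\<tau> x) A) \<longlongrightarrow> inv (\<tau> x) A) (atin X x)" for A
    using tendsto_inv_\<tau>[OF x, of "\<lambda>_. A"] by simp
qed

section \<open>Bijectivity of maps of composition type\<close>

lemma \<Phi>_inj: "inj_on \<Phi> (C0 X)"
proof (rule inj_onI)
  fix f g
  assume f: "f \<in> C0 X" and g: "g \<in> C0 X" and eq: "\<Phi> f = \<Phi> g"
  show "f = g"
  proof
    fix y
    show "f y = g y"
    proof (cases "y \<in> topspace X")
      case True
      then obtain x where x: "x \<in> topspace X" "y = \<phi> x"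
        using \<phi> by (auto simp: bij_betw_def)
      have "\<tau> x (f y) = \<tau> x (g y)"
        using form[OF x(1) f] form[OF x(1) g] eq x(2) by simp
      then show ?thesis
        using \<tau>(2)[OF x(1)] by (meson bij_is_inj injD)
    qed (simp add: C0_outside[OF f] C0_outside[OF g])
  qed
qed

lemma \<Phi>_surj: "\<Phi> ` C0 X = C0 X"
proof
  show "\<Phi> ` C0 X \<subseteq> C0 X" using \<Phi>_C0 by blast
  show "C0 X \<subseteq> \<Phi> ` C0 X"
  proof
    fix g :: "'x \<Rightarrow> 'h bop"
    assume g: "g \<in> C0 X"
    obtain \<psi> where \<psi>: "homeomorphic_maps X X \<phi> \<psi>"
      using homeomorphic_map_\<phi> homeomorphic_map_maps by blast
    have \<psi>_cont: "continuous_map X X \<psi>" and \<psi>_\<phi>: "\<And>x. x \<in> topspace X \<Longrightarrow> \<psi> (\<phi> x) = x"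
      and \<phi>_\<psi>: "\<And>x. x \<in> topspace X \<Longrightarrow> \<phi> (\<psi> x) = x"
      using \<psi> by (auto simp: homeomorphic_maps_def)
    have \<psi>_in: "\<psi> y \<in> topspace X" if "y \<in> topspace X" for y
      using \<psi>_cont that by (auto simp: continuous_map_def)
    define F where "F x = inv (\<tau> x) (g x)" for x
    define f where "f y = (if y \<in> topspace X then F (\<psi> y) else 0)" for y
    have F: "continuous_map X euclidean F"
      unfolding continuous_map_euclidean_iff_tendsto F_def
      by (intro ballI tendsto_inv_\<tau> C0_tendsto[OF g])
    have f: "f \<in> C0 X"
      unfolding C0_def
    proof (intro CollectI conjI allI impI)
      show "continuous_map X euclidean f"
        by (rule continuous_map_eq[OF continuous_map_compose[OF \<psi>_cont F]]) (simp add: f_def)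
    next
      fix e :: real
      assume "0 < e"
      then obtain K where K: "compactin X K" "\<And>x. x \<in> topspace X - K \<Longrightarrow> norm (g x) < e / (M + 1)"
        using C0_vanish[OF g, of "e / (M + 1)"] M by auto
      have "norm (f y) < e" if y: "y \<in> topspace X - \<phi> ` K" for y
      proof -
        have "\<psi> y \<in> topspace X - K"
          using y \<psi>_in \<phi>_\<psi>[of y] by (auto simp: image_iff)
        then have "norm (f y) \<le> M * norm (g (\<psi> y))" "norm (g (\<psi> y)) < e / (M + 1)"
          using norm_inv_\<tau>[of "\<psi> y"] K(2) y by (auto simp: f_def F_def)
        moreover have "M * norm (g (\<psi> y)) \<le> (M + 1) * norm (g (\<psi> y))"
          by (intro mult_right_mono) auto
        ultimately show ?thesis
          using M by (simp add: pos_less_divide_eq mult.commute)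
      qed
      with image_compactin[OF K(1) continuous_map_\<phi>]
      show "\<exists>K. compactin X K \<and> (\<forall>x\<in>topspace X - K. norm (f x) < e)" by blast
    qed (simp add: f_def)
    have "\<Phi> f = g"
    proof
      fix x
      show "\<Phi> f x = g x"
        by (cases "x \<in> topspace X")
          (simp_all add: form[OF _ f] f_def \<phi>_in \<psi>_\<phi> F_def \<tau>_inv C0_outside[OF \<Phi>_C0[OF f]] C0_outside[OF g])
    qed
    with f show "g \<in> \<Phi> ` C0 X" by blast
  qed
qed

end

section \<open>Automorphisms and isometries\<close>

lemma Iso_inj_on:
  assumes \<Phi>: "\<Phi> \<in> Iso sup_norm (C0 X :: ('x \<Rightarrow> 'h::complex_hilbert bop) set)"
  shows "inj_on \<Phi> (C0 X)"
proof (rule inj_onI)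
  fix f g
  assume f: "f \<in> C0 X" and g: "g \<in> C0 X" and eq: "\<Phi> f = \<Phi> g"
  have "sup_norm (f - g) = sup_norm (\<Phi> f - \<Phi> g)"
    using \<Phi> f g by (simp add: Iso_def)
  also have "\<dots> \<le> 0"
    by (rule sup_norm_le) (simp add: eq)
  finally have "norm ((f - g) x) \<le> 0" for x
    using norm_le_sup_norm[OF C0_diff[OF f g], of x] by linarith
  then show "f = g" by (auto simp: fun_eq_iff)
qed

lemma Aut_module:
  fixes \<Phi> :: "('x \<Rightarrow> 'h::complex_hilbert bop) \<Rightarrow> 'x \<Rightarrow> 'h bop"
  assumes X: "locally_compact_space X" "Hausdorff_space X"
    and \<Phi>: "\<Phi> \<in> Aut (C0 X)" and h: "h \<in> C0 X"
  shows "\<exists>k. \<forall>f\<in>C0 X. \<forall>x\<in>topspace X. \<Phi> (\<lambda>y. h y *\<^sub>C f y) x = k x *\<^sub>C \<Phi> f x"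
proof -
  define H where "H = (\<lambda>y. h y *\<^sub>C (id_bop :: 'h bop))"
  have H: "H \<in> C0 X" unfolding H_def by (rule C0_scaleC_const[OF h])
  have mult: "\<Phi> (f * g) = \<Phi> f * \<Phi> g" if "f \<in> C0 X" "g \<in> C0 X" for f g
    using \<Phi> that by (simp add: Aut_def)
  have img: "\<Phi> ` C0 X = C0 X" using \<Phi> by (simp add: Aut_def bij_betw_def)
  have Hf: "H * f = (\<lambda>y. h y *\<^sub>C f y)" "f * H = (\<lambda>y. h y *\<^sub>C f y)" for f
    by (simp_all add: H_def fun_eq_iff scaleC_bop_mult_left scaleC_bop_mult_right)
  have "\<forall>x\<in>topspace X. \<exists>c. \<Phi> H x = c *\<^sub>C id_bop"
  proof
    fix x
    assume x: "x \<in> topspace X"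
    show "\<exists>c. \<Phi> H x = c *\<^sub>C id_bop"
    proof (rule commutes_with_all_imp_scalar)
      \<comment> \<open>Every \<open>B\<close> is the value at \<open>x\<close> of some
        \<open>\<Phi> f\<close>, since \<open>\<Phi>\<close> is onto; so commuting with the image of
        \<open>\<Phi>\<close> means commuting with all operators at each point.\<close>
      fix B :: "'h bop"
      obtain g :: "'x \<Rightarrow> 'h bop" where g: "g \<in> C0 X" "g x = B"
        using C0_value[OF X x, of B] by metis
      then have "g \<in> \<Phi> ` C0 X" by (simp add: img)
      then obtain f where f: "g = \<Phi> f" "f \<in> C0 X" by (rule imageE)
      have "\<Phi> H * \<Phi> f = \<Phi> f * \<Phi> H"
        using mult[OF H f(2)] mult[OF f(2) H] by (simp add: Hf)
      then have "(\<Phi> H * g) x = (g * \<Phi> H) x" by (simp add: f(1))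
      then show "\<Phi> H x * B = B * \<Phi> H x" by (simp add: g(2))
    qed
  qed
  from bchoice[OF this] obtain k where k: "\<forall>x\<in>topspace X. \<Phi> H x = k x *\<^sub>C id_bop" ..
  have "\<Phi> (\<lambda>y. h y *\<^sub>C f y) x = k x *\<^sub>C \<Phi> f x" if f: "f \<in> C0 X" and x: "x \<in> topspace X" for f x
  proof -
    have "\<Phi> (\<lambda>y. h y *\<^sub>C f y) x = \<Phi> H x * \<Phi> f x"
      using mult[OF H f] by (simp add: Hf)
    then show ?thesis using k x by (simp add: scaleC_bop_mult_left)
  qed
  then show ?thesis by blast
qed

text \<open>Multiplication by \<open>h\<close> is M-bounded, and conjugation by
  \<open>\<Phi>\<close> keeps it so. The conjugate is then a multiplication by some
  \<open>k\<close>; evaluated at \<open>\<Phi> f\<close>, this is the claim.\<close>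

lemma Iso_module:
  fixes \<Phi> \<Psi> :: "('x \<Rightarrow> 'h::complex_hilbert bop) \<Rightarrow> 'x \<Rightarrow> 'h bop"
  assumes X: "locally_compact_space X" "Hausdorff_space X"
    and \<Phi>: "\<Phi> \<in> Iso sup_norm (C0 X)" and \<Psi>: "\<Psi> \<in> Iso sup_norm (C0 X)"
    and inv: "\<And>f. f \<in> C0 X \<Longrightarrow> \<Psi> (\<Phi> f) = f" "\<And>f. f \<in> C0 X \<Longrightarrow> \<Phi> (\<Psi> f) = f"
    and h: "h \<in> C0 X"
  shows "\<exists>k. \<forall>f\<in>C0 X. \<forall>x\<in>topspace X. \<Phi> (\<lambda>y. h y *\<^sub>C f y) x = k x *\<^sub>C \<Phi> f x"
proof -
  obtain l where l: "0 < l" "\<And>y. cmod (h y) \<le> l" using C0_bounded[OF h] by blast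
  have lin: "\<Phi> \<in> linear_maps (C0 X)" "\<Psi> \<in> linear_maps (C0 X)"
    using \<Phi> \<Psi> by (auto simp: Iso_def)
  have iso: "sup_norm (\<Phi> f - \<Phi> g) = sup_norm (f - g)" "sup_norm (\<Psi> f - \<Psi> g) = sup_norm (f - g)"
    if "f \<in> C0 X" "g \<in> C0 X" for f g
    using \<Phi> \<Psi> that by (auto simp: Iso_def)
  define m where "m f = (\<lambda>y. h y *\<^sub>C f y)" for f :: "'x \<Rightarrow> 'h bop"
  have m: "m f \<in> C0 X" if "f \<in> C0 X" for f
    unfolding m_def by (rule C0_scaleC_fun[OF h that])
  have m_lin: "m (f + g) = m f + m g" "m (c *\<^sub>C f) = c *\<^sub>C m f" for f g c
    by (auto simp: m_def fun_eq_iff scaleC_add_right scaleC_scaleC mult.commute)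
  define T where "T f = \<Phi> (m (\<Psi> f))" for f
  note D = linear_maps_D[OF lin(1)] linear_maps_D[OF lin(2)]
  have "M_bounded X l T"
    unfolding M_bounded_def
  proof (intro conjI ballI allI impI)
    show "T \<in> linear_maps (C0 X)"
      by (simp add: linear_maps_def T_def D m_lin m C0_add)
    fix f g :: "'x \<Rightarrow> 'h bop" and r
    assume f: "f \<in> C0 X" and g: "g \<in> C0 X"
      and ball: "\<forall>\<mu>. cmod \<mu> \<le> l \<longrightarrow> sup_norm (\<mu> *\<^sub>C f - g) \<le> r"
    have \<Psi>f: "\<Psi> f \<in> C0 X" and \<Psi>g: "\<Psi> g \<in> C0 X" using f g D by auto
    \<comment> \<open>At each single point \<open>y\<close> multiplication by \<open>h\<close>
      agrees with multiplication by the constant \<open>h y\<close>, which is one of the admissible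
      \<open>\<mu>\<close>.\<close>
    have "norm (m (\<Psi> f) y - \<Psi> g y) \<le> r" for y
    proof -
      have "norm ((h y *\<^sub>C \<Psi> f - \<Psi> g) y) \<le> sup_norm (h y *\<^sub>C \<Psi> f - \<Psi> g)"
        by (rule norm_le_sup_norm[OF C0_diff[OF C0_scaleC[OF \<Psi>f] \<Psi>g]])
      also have "\<dots> = sup_norm (h y *\<^sub>C f - g)"
        using iso(2)[OF C0_scaleC[OF f] g, of "h y"] by (simp add: D(6)[OF f])
      also have "\<dots> \<le> r" using ball l(2) by blast
      finally show ?thesis by (simp add: m_def)
    qed
    then have "sup_norm (m (\<Psi> f) - \<Psi> g) \<le> r"
      by (intro sup_norm_le) simp
    then show "sup_norm (T f - g) \<le> r"
      using iso(1)[OF m[OF \<Psi>f] \<Psi>g] by (simp add: T_def inv(2)[OF g])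
  qed
  then have "\<forall>x\<in>topspace X. \<exists>k. \<forall>f\<in>C0 X. T f x = k *\<^sub>C f x"
    using l(1) by (blast intro: M_bounded_imp_multiplication[OF X] less_imp_le)
  from bchoice[OF this] obtain k where k: "\<forall>x\<in>topspace X. \<forall>f\<in>C0 X. T f x = k x *\<^sub>C f x" ..
  have "\<Phi> (m f) x = k x *\<^sub>C \<Phi> f x" if f: "f \<in> C0 X" and x: "x \<in> topspace X" for f x
    using k x D(1)[OF f] inv(1)[OF f] by (metis T_def)
  then show ?thesis unfolding m_def by blast
qed

section \<open>Inverses of automorphisms and isometries, and the passage to and from composition
  type\<close>

lemma inv_into_Aut:
  fixes \<Phi> :: "('x \<Rightarrow> 'h::complex_hilbert bop) \<Rightarrow> 'x \<Rightarrow> 'h bop"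
  assumes \<Phi>: "\<Phi> \<in> Aut (C0 X)"
  shows "inv_into (C0 X) \<Phi> \<in> Aut (C0 X)"
proof -
  have bij: "bij_betw \<Phi> (C0 X) (C0 X)" and lin: "\<Phi> \<in> linear_maps (C0 X)"
    and mult: "\<And>f g. f \<in> C0 X \<Longrightarrow> g \<in> C0 X \<Longrightarrow> \<Phi> (f * g) = \<Phi> f * \<Phi> g"
    using \<Phi> by (auto simp: Aut_def)
  have bij': "bij_betw (inv_into (C0 X) \<Phi>) (C0 X) (C0 X)"
    by (rule bij_betw_inv_into[OF bij])
  have in_C0: "inv_into (C0 X) \<Phi> f \<in> C0 X" if "f \<in> C0 X" for f
    using bij' that by (auto simp: bij_betw_def)
  have "inv_into (C0 X) \<Phi> (f * g) = inv_into (C0 X) \<Phi> f * inv_into (C0 X) \<Phi> g"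
    if "f \<in> C0 X" "g \<in> C0 X" for f g
    by (rule inv_into_f_eq)
      (use bij that in \<open>simp_all add: in_C0 C0_times mult bij_betw_inv_into_right bij_betw_imp_inj_on\<close>)
  then show ?thesis
    unfolding Aut_def using bij' linear_maps_inv_into[OF lin bij C0_add C0_scaleC] by blast
qed

lemma inv_into_Iso:
  fixes \<Phi> :: "('x \<Rightarrow> 'h::complex_hilbert bop) \<Rightarrow> 'x \<Rightarrow> 'h bop"
  assumes \<Phi>: "\<Phi> \<in> Iso sup_norm (C0 X)"
  shows "inv_into (C0 X) \<Phi> \<in> Iso sup_norm (C0 X)"
proof -
  have bij: "bij_betw \<Phi> (C0 X) (C0 X)"
    using Iso_inj_on[OF \<Phi>] \<Phi> by (simp add: Iso_def bij_betw_def)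
  have lin: "\<Phi> \<in> linear_maps (C0 X)"
    and iso: "\<And>f g. f \<in> C0 X \<Longrightarrow> g \<in> C0 X \<Longrightarrow> sup_norm (\<Phi> f - \<Phi> g) = sup_norm (f - g)"
    using \<Phi> by (auto simp: Iso_def)
  have img: "inv_into (C0 X) \<Phi> ` C0 X = C0 X"
    using bij_betw_inv_into[OF bij] by (simp add: bij_betw_def)
  have in_C0: "inv_into (C0 X) \<Phi> f \<in> C0 X" if "f \<in> C0 X" for f
    using img that by blast
  have "sup_norm (inv_into (C0 X) \<Phi> f - inv_into (C0 X) \<Phi> g) = sup_norm (f - g)"
    if "f \<in> C0 X" "g \<in> C0 X" for f g
    using iso[OF in_C0[OF that(1)] in_C0[OF that(2)]] that by (simp add: bij_betw_inv_into_right[OF bij])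
  then show ?thesis
    unfolding Iso_def using img linear_maps_inv_into[OF lin bij C0_add C0_scaleC] by blast
qed

lemma Aut_has_form:
  fixes \<Phi> :: "('x \<Rightarrow> 'h::complex_hilbert bop) \<Rightarrow> 'x \<Rightarrow> 'h bop"
  assumes X: "locally_compact_space X" "Hausdorff_space X" and z: "(z::'h) \<noteq> 0"
    and \<Phi>: "\<Phi> \<in> Aut (C0 X)"
  shows "\<exists>\<tau> \<phi>. has_form X (Aut UNIV) \<Phi> \<tau> \<phi>"
proof -
  define \<Psi> where "\<Psi> = inv_into (C0 X) \<Phi>"
  have \<Psi>: "\<Psi> \<in> Aut (C0 X)" unfolding \<Psi>_def by (rule inv_into_Aut[OF \<Phi>])
  have bij: "bij_betw \<Phi> (C0 X) (C0 X)" "bij_betw \<Psi> (C0 X) (C0 X)"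
    and lin: "\<Phi> \<in> linear_maps (C0 X)" "\<Psi> \<in> linear_maps (C0 X)"
    and mult: "\<And>f g. f \<in> C0 X \<Longrightarrow> g \<in> C0 X \<Longrightarrow> \<Phi> (f * g) = \<Phi> f * \<Phi> g"
    using \<Phi> \<Psi> by (auto simp: Aut_def)
  have inv: "\<Psi> (\<Phi> f) = f" "\<Phi> (\<Psi> f) = f" if "f \<in> C0 X" for f
    using bij(1) that by (simp_all add: \<Psi>_def bij_betw_inv_into_left bij_betw_inv_into_right)
  have "\<exists>\<tau> \<phi>. bij_betw \<phi> (topspace X) (topspace X) \<and> (\<forall>x\<in>topspace X. \<tau> x \<in> linear_maps UNIV \<and>
      bij (\<tau> x) \<and> (\<forall>f\<in>C0 X. \<Phi> f x = \<tau> x (f (\<phi> x))))"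
    by (rule module_isomorphism_form[OF X lin(1) bij_betw_imp_surj_on[OF bij(1)] lin(2)
          bij_betw_imp_surj_on[OF bij(2)] inv z Aut_module[OF X \<Phi>] Aut_module[OF X \<Psi>]])
  then obtain \<tau> \<phi> where \<phi>: "bij_betw \<phi> (topspace X) (topspace X)"
    and *: "\<forall>x\<in>topspace X. \<tau> x \<in> linear_maps UNIV \<and> bij (\<tau> x) \<and> (\<forall>f\<in>C0 X. \<Phi> f x = \<tau> x (f (\<phi> x)))"
    by (elim exE conjE)
  have \<tau>: "\<tau> x \<in> linear_maps UNIV \<and> bij (\<tau> x)"
    and form: "f \<in> C0 X \<Longrightarrow> \<Phi> f x = \<tau> x (f (\<phi> x))" if "x \<in> topspace X" for x f
    using * that by simp_all
  have "\<tau> x (A * B) = \<tau> x A * \<tau> x B" if x: "x \<in> topspace X" for x A B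
  proof -
    have \<phi>x: "\<phi> x \<in> topspace X" using \<phi> x by (auto simp: bij_betw_def)
    obtain f g :: "'x \<Rightarrow> 'h bop" where "f \<in> C0 X" "f (\<phi> x) = A" "g \<in> C0 X" "g (\<phi> x) = B"
      using C0_value[OF X \<phi>x, of A] C0_value[OF X \<phi>x, of B] by metis
    then show ?thesis
      using form[OF x, of "f * g"] form[OF x, of f] form[OF x, of g] mult[of f g] by (simp add: C0_times)
  qed
  then have "\<tau> \<in> topspace X \<rightarrow> Aut UNIV"
    using \<tau> by (auto simp: Aut_def)
  then show ?thesis
    using \<phi> form by (auto simp: has_form_def)
qed

lemma Iso_has_form:
  fixes \<Phi> :: "('x \<Rightarrow> 'h::complex_hilbert bop) \<Rightarrow> 'x \<Rightarrow> 'h bop"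
  assumes X: "locally_compact_space X" "Hausdorff_space X" and z: "(z::'h) \<noteq> 0"
    and \<Phi>: "\<Phi> \<in> Iso sup_norm (C0 X)"
  shows "\<exists>\<tau> \<phi>. has_form X (Iso norm UNIV) \<Phi> \<tau> \<phi>"
proof -
  define \<Psi> where "\<Psi> = inv_into (C0 X) \<Phi>"
  have \<Psi>: "\<Psi> \<in> Iso sup_norm (C0 X)" unfolding \<Psi>_def by (rule inv_into_Iso[OF \<Phi>])
  have img: "\<Phi> ` C0 X = C0 X" "\<Psi> ` C0 X = C0 X"
    and lin: "\<Phi> \<in> linear_maps (C0 X)" "\<Psi> \<in> linear_maps (C0 X)"
    using \<Phi> \<Psi> by (auto simp: Iso_def)
  have iso: "sup_norm (\<Phi> f) = sup_norm f" if f: "f \<in> C0 X" for f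
  proof -
    have "\<forall>f\<in>C0 X. \<forall>g\<in>C0 X. sup_norm (\<Phi> f - \<Phi> g) = sup_norm (f - g)"
      using \<Phi> by (simp add: Iso_def)
    then have "sup_norm (\<Phi> f - \<Phi> 0) = sup_norm (f - 0)"
      using f C0_zero by meson
    moreover have "\<Phi> 0 = 0" using linear_maps_D(3)[OF lin(1) C0_zero, of 0] by simp
    ultimately show ?thesis by simp
  qed
  have inv: "\<Psi> (\<Phi> f) = f" "\<Phi> (\<Psi> f) = f" if "f \<in> C0 X" for f
    using Iso_inj_on[OF \<Phi>] img(1) that by (simp_all add: \<Psi>_def f_inv_into_f)
  have "\<exists>\<tau> \<phi>. bij_betw \<phi> (topspace X) (topspace X) \<and> (\<forall>x\<in>topspace X. \<tau> x \<in> linear_maps UNIV \<and>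
      bij (\<tau> x) \<and> (\<forall>f\<in>C0 X. \<Phi> f x = \<tau> x (f (\<phi> x))))"
    by (rule module_isomorphism_form[OF X lin(1) img(1) lin(2) img(2) inv z
          Iso_module[OF X \<Phi> \<Psi> inv] Iso_module[OF X \<Psi> \<Phi> inv(2,1)]])
  then obtain \<tau> \<phi> where \<phi>: "bij_betw \<phi> (topspace X) (topspace X)"
    and *: "\<forall>x\<in>topspace X. \<tau> x \<in> linear_maps UNIV \<and> bij (\<tau> x) \<and> (\<forall>f\<in>C0 X. \<Phi> f x = \<tau> x (f (\<phi> x)))"
    by (elim exE conjE)
  have \<tau>: "\<tau> x \<in> linear_maps UNIV \<and> bij (\<tau> x)"
    and form: "f \<in> C0 X \<Longrightarrow> \<Phi> f x = \<tau> x (f (\<phi> x))" if "x \<in> topspace X" for x f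
    using * that by simp_all
  have "norm (\<tau> x A) = norm A" if x: "x \<in> topspace X" for x A
  proof (rule antisym)
    have \<phi>x: "\<phi> x \<in> topspace X" using \<phi> x by (auto simp: bij_betw_def)
    obtain f :: "'x \<Rightarrow> 'h bop" where f: "f \<in> C0 X" "f (\<phi> x) = A" "sup_norm f \<le> norm A"
      using C0_value[OF X \<phi>x, of A] by metis
    show "norm (\<tau> x A) \<le> norm A"
      using norm_le_sup_norm[OF linear_maps_D(1)[OF lin(1) f(1)], of x] iso[OF f(1)] f(2,3) form[OF x f(1)]
      by simp
    \<comment> \<open>The reverse inequality interpolates \<open>\<tau> x A\<close> at
      \<open>x\<close> instead and pulls back by \<open>\<Phi>\<close>: injectivity of
      \<open>\<tau> x\<close> identifies the value of the preimage at \<open>\<phi> x\<close> as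
      \<open>A\<close>.\<close>
    obtain g :: "'x \<Rightarrow> 'h bop" where g: "g \<in> C0 X" "g x = \<tau> x A" "sup_norm g \<le> norm (\<tau> x A)"
      using C0_value[OF X x, of "\<tau> x A"] by metis
    then have "g \<in> \<Phi> ` C0 X" by (simp add: img)
    then obtain f' where f': "g = \<Phi> f'" "f' \<in> C0 X" by (rule imageE)
    have "\<tau> x (f' (\<phi> x)) = \<tau> x A"
      using form[OF x f'(2)] g(2) f'(1) by simp
    then have "f' (\<phi> x) = A"
      using \<tau>[OF x] by (meson bij_is_inj injD)
    then show "norm A \<le> norm (\<tau> x A)"
      using norm_le_sup_norm[OF f'(2), of "\<phi> x"] iso[OF f'(2)] f'(1) g(3) by simp
  qed
  then have "\<tau> x \<in> Iso norm UNIV" if x: "x \<in> topspace X" for x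
    using \<tau>[OF x] x by (auto simp: Iso_def bij_is_surj linear_maps_UNIV_D(5)[symmetric])
  then show ?thesis
    using \<phi> form by (auto simp: has_form_def)
qed

text \<open>Each \<open>\<tau> x\<close> is bounded by automatic continuity, and the bounds become
  uniform in \<open>x\<close>. By \<open>Aut_bop_inv_bounded\<close> the same constant controls the
  inverses, so a single \<open>M\<close> satisfies both estimates of the locale.\<close>

lemma Aut_form_C0_form:
  fixes \<Phi> :: "('x \<Rightarrow> 'h::complex_hilbert bop) \<Rightarrow> 'x \<Rightarrow> 'h bop"
  assumes X: "locally_compact_space X" "Hausdorff_space X" and z: "(z::'h) \<noteq> 0"
    and \<Phi>: "\<Phi> \<in> linear_maps (C0 X)" and form: "has_form X (Aut UNIV) \<Phi> \<tau> \<phi>"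
  shows "\<exists>M. C0_form X \<Phi> \<tau> \<phi> M"
proof -
  have \<tau>: "\<tau> x \<in> Aut UNIV" if "x \<in> topspace X" for x
    using form that by (auto simp: has_form_def)
  have \<phi>: "bij_betw \<phi> (topspace X) (topspace X)"
    and eq: "\<And>x f. x \<in> topspace X \<Longrightarrow> f \<in> C0 X \<Longrightarrow> \<Phi> f x = \<tau> x (f (\<phi> x))"
    using form by (auto simp: has_form_def)
  have "\<exists>M\<ge>0. \<forall>x\<in>topspace X. \<forall>A. norm (\<tau> x A) \<le> M * norm A"
  proof (rule C0_form_uniform_bound[OF X \<Phi> _ eq])
    show "\<phi> x \<in> topspace X" if "x \<in> topspace X" for x
      using \<phi> that by (auto simp: bij_betw_def)
    show "\<exists>M. \<forall>A. norm (\<tau> x A) \<le> M * norm A" if "x \<in> topspace X" for x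
      by (rule Aut_bop_bounded[OF \<tau>[OF that]]) blast
  qed
  then obtain M where M: "0 \<le> M" "\<And>x A. x \<in> topspace X \<Longrightarrow> norm (\<tau> x A) \<le> M * norm A" by blast
  have "C0_form X \<Phi> \<tau> \<phi> M"
  proof
    fix x A
    assume x: "x \<in> topspace X"
    show "\<tau> x \<in> linear_maps UNIV" "bij (\<tau> x)" using \<tau>[OF x] by (simp_all add: Aut_def)
    show "norm (\<tau> x id_bop) = 1" by (simp add: Aut_bop_id[OF \<tau>[OF x]] norm_id_bop[OF z])
    show "norm (\<tau> x A) \<le> M * norm A" by (rule M(2)[OF x])
    show "norm A \<le> M * norm (\<tau> x A)"
      using Aut_bop_inv_bounded[OF \<tau>[OF x] M(2)[OF x], of A] M(1) by simp
  qed (use X \<phi> M(1) in \<open>simp_all add: linear_maps_D(1)[OF \<Phi>] eq\<close>)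
  then show ?thesis ..
qed

lemma Iso_form_C0_form:
  fixes \<Phi> :: "('x \<Rightarrow> 'h::complex_hilbert bop) \<Rightarrow> 'x \<Rightarrow> 'h bop"
  assumes X: "locally_compact_space X" "Hausdorff_space X" and z: "(z::'h) \<noteq> 0"
    and \<Phi>: "\<Phi> \<in> linear_maps (C0 X)" and form: "has_form X (Iso norm UNIV) \<Phi> \<tau> \<phi>"
  shows "C0_form X \<Phi> \<tau> \<phi> 1" and "x \<in> topspace X \<Longrightarrow> norm (\<tau> x A) = norm A"
proof -
  have \<tau>: "\<tau> x \<in> linear_maps UNIV" "surj (\<tau> x)" "norm (\<tau> x A - \<tau> x B) = norm (A - B)"
    if "x \<in> topspace X" for x A B
    using form that by (auto simp: has_form_def Iso_def)
  show norm_\<tau>: "norm (\<tau> x A) = norm A" if x: "x \<in> topspace X" for x A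
    using \<tau>(3)[OF x, of A 0] linear_maps_UNIV_D(3)[OF \<tau>(1)[OF x]] by simp
  show "C0_form X \<Phi> \<tau> \<phi> 1"
  proof
    fix x
    assume x: "x \<in> topspace X"
    have "inj (\<tau> x)"
    proof (rule injI)
      show "A = B" if "\<tau> x A = \<tau> x B" for A B
        using \<tau>(3)[OF x, of A B] that by simp
    qed
    with \<tau>(2)[OF x] show "bij (\<tau> x)" by (simp add: bij_def)
  qed (use X form in \<open>auto simp: has_form_def linear_maps_D(1)[OF \<Phi>] \<tau>(1) norm_\<tau> norm_id_bop[OF z]\<close>)
qed

theorem theorem1:
  fixes X :: "'x topology"
  assumes "infinite_cdim TYPE('h::complex_hilbert)"
    and "separable_space (euclidean :: 'h topology)"
    and "locally_compact_space X" and "Hausdorff_space X"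
  shows
    "(\<forall>\<Phi> \<in> linear_maps (C0 X :: ('x \<Rightarrow> 'h bop) set).
       \<Phi> \<in> Aut (C0 X) \<longleftrightarrow> (\<exists>\<tau> \<phi>. has_form X (Aut UNIV) \<Phi> \<tau> \<phi>)) \<and>
     (\<forall>\<Phi> \<in> linear_maps (C0 X :: ('x \<Rightarrow> 'h bop) set).
       \<Phi> \<in> Iso sup_norm (C0 X) \<longleftrightarrow> (\<exists>\<tau> \<phi>. has_form X (Iso norm UNIV) \<Phi> \<tau> \<phi>)) \<and>
     (\<forall>\<Phi> \<in> linear_maps (C0 X :: ('x \<Rightarrow> 'h bop) set). \<forall>\<tau> \<phi>.
       (\<Phi> \<in> Aut (C0 X) \<and> has_form X (Aut UNIV) \<Phi> \<tau> \<phi> \<or>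
        \<Phi> \<in> Iso sup_norm (C0 X) \<and> has_form X (Iso norm UNIV) \<Phi> \<tau> \<phi>) \<longrightarrow>
       strongly_continuous X \<tau> \<and> strongly_continuous X (\<lambda>x. inv (\<tau> x)) \<and>
       homeomorphic_map X X \<phi>)"
proof -
  note X = assms(3,4)
  have "\<exists>z::'h. z \<noteq> 0"
  proof (rule ccontr)
    assume "\<not> ?thesis"
    then have "(UNIV :: 'h set) = {0}" by auto
    then have "module.span scaleC {} = (UNIV :: 'h set)"
      by (simp add: module.span_empty[OF module_scaleC])
    then show False using assms(1) by (auto simp: infinite_cdim_def)
  qed
  then obtain z :: 'h where z: "z \<noteq> 0" ..
  have Aut_iff: "\<Phi> \<in> Aut (C0 X) \<longleftrightarrow> (\<exists>\<tau> \<phi>. has_form X (Aut UNIV) \<Phi> \<tau> \<phi>)"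
    if \<Phi>: "\<Phi> \<in> linear_maps (C0 X)" for \<Phi> :: "('x \<Rightarrow> 'h bop) \<Rightarrow> 'x \<Rightarrow> 'h bop"
  proof
    assume "\<exists>\<tau> \<phi>. has_form X (Aut UNIV) \<Phi> \<tau> \<phi>"
    then obtain \<tau> \<phi> where hf: "has_form X (Aut UNIV) \<Phi> \<tau> \<phi>" by blast
    obtain M where "C0_form X \<Phi> \<tau> \<phi> M" using Aut_form_C0_form[OF X z \<Phi> hf] ..
    then interpret C0_form X \<Phi> \<tau> \<phi> M .
    have "\<Phi> (f * g) = \<Phi> f * \<Phi> g" if f: "f \<in> C0 X" and g: "g \<in> C0 X" for f g
    proof
      fix x
      show "\<Phi> (f * g) x = (\<Phi> f * \<Phi> g) x"
      proof (cases "x \<in> topspace X")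
        case True
        then have "\<tau> x (A * B) = \<tau> x A * \<tau> x B" for A B
          using hf by (auto simp: has_form_def Aut_def)
        with True f g show ?thesis by (simp add: form C0_times)
      next
        case False
        with f g show ?thesis
          by (simp add: C0_outside[OF \<Phi>_C0] C0_times)
      qed
    qed
    then show "\<Phi> \<in> Aut (C0 X)"
      using \<Phi> \<Phi>_inj \<Phi>_surj by (simp add: Aut_def bij_betw_def)
  qed (rule Aut_has_form[OF X z])
  have Iso_iff: "\<Phi> \<in> Iso sup_norm (C0 X) \<longleftrightarrow> (\<exists>\<tau> \<phi>. has_form X (Iso norm UNIV) \<Phi> \<tau> \<phi>)"
    if \<Phi>: "\<Phi> \<in> linear_maps (C0 X)" for \<Phi> :: "('x \<Rightarrow> 'h bop) \<Rightarrow> 'x \<Rightarrow> 'h bop"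
  proof
    assume "\<exists>\<tau> \<phi>. has_form X (Iso norm UNIV) \<Phi> \<tau> \<phi>"
    then obtain \<tau> \<phi> where hf: "has_form X (Iso norm UNIV) \<Phi> \<tau> \<phi>" by blast
    interpret C0_form X \<Phi> \<tau> \<phi> 1 by (rule Iso_form_C0_form(1)[OF X z \<Phi> hf])
    have iso: "sup_norm (\<Phi> f) = sup_norm f" if f: "f \<in> C0 X" for f
    proof (rule antisym)
      have norm_eq: "norm (\<Phi> f x) = norm (f (\<phi> x))" if x: "x \<in> topspace X" for x
        using Iso_form_C0_form(2)[OF X z \<Phi> hf x] form[OF x f] by simp
      show "sup_norm (\<Phi> f) \<le> sup_norm f"
      proof (rule sup_norm_le)
        fix x
        show "norm (\<Phi> f x) \<le> sup_norm f"
          using norm_le_sup_norm[OF f] norm_eq[of x] C0_outside[OF \<Phi>_C0[OF f], of x]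
            order_trans[OF norm_ge_zero norm_le_sup_norm[OF f]]
          by (cases "x \<in> topspace X") auto
      qed
      show "sup_norm f \<le> sup_norm (\<Phi> f)"
      proof (rule sup_norm_le)
        fix y
        show "norm (f y) \<le> sup_norm (\<Phi> f)"
        proof (cases "y \<in> topspace X")
          case True
          then obtain x where "x \<in> topspace X" "y = \<phi> x"
            using \<phi> by (auto simp: bij_betw_def)
          then show ?thesis
            using norm_eq[of x] norm_le_sup_norm[OF \<Phi>_C0[OF f], of x] by simp
        next
          case False
          then show ?thesis
            using C0_outside[OF f False] order_trans[OF norm_ge_zero norm_le_sup_norm[OF \<Phi>_C0[OF f]]]
            by simp
        qed
      qed
    qed
    have "sup_norm (\<Phi> f - \<Phi> g) = sup_norm (f - g)" if "f \<in> C0 X" "g \<in> C0 X" for f g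
      using iso[OF C0_diff[OF that]] by (simp add: linear_maps_C0_diff[OF \<Phi> that])
    then show "\<Phi> \<in> Iso sup_norm (C0 X)"
      using \<Phi> \<Phi>_surj by (simp add: Iso_def)
  qed (rule Iso_has_form[OF X z])
  have cont: "strongly_continuous X \<tau> \<and> strongly_continuous X (\<lambda>x. inv (\<tau> x)) \<and> homeomorphic_map X X \<phi>"
    if \<Phi>: "\<Phi> \<in> linear_maps (C0 X)"
      and hf: "has_form X (Aut UNIV) \<Phi> \<tau> \<phi> \<or> has_form X (Iso norm UNIV) \<Phi> \<tau> \<phi>"
    for \<Phi> :: "('x \<Rightarrow> 'h bop) \<Rightarrow> 'x \<Rightarrow> 'h bop" and \<tau> \<phi>
  proof -
    obtain M where "C0_form X \<Phi> \<tau> \<phi> M"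
      using Aut_form_C0_form[OF X z \<Phi>] Iso_form_C0_form(1)[OF X z \<Phi>] hf by blast
    then interpret C0_form X \<Phi> \<tau> \<phi> M .
    show ?thesis
      using strongly_continuous_\<tau> strongly_continuous_inv_\<tau> homeomorphic_map_\<phi> by blast
  qed
  show ?thesis
    using Aut_iff Iso_iff cont by blast
qed

end
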